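(* There exists a finitely generated, recursively presented, residually finite, 3-step solvable group $G$ such that, for every finite generating set $S$ of $G$: (i) for every polynomial $f$, $\mathrm{Rf}_{G,S}(n)\ge f(n)$ for all sufficiently large $n$; and (ii) for every $\epsilon>0$, $\mathrm{Rf}_{G,S}(n)\le \exp\left(n^{\frac12+\epsilon}\right)$ for all sufficiently large $n$.
   Context: For a residually finite group $G$ (every non-trivial element survives in some finite quotient) with finite generating set $S$ and word norm $\|\cdot\|_S$, the residual finiteness growth function is, for $n\ge1$, $$\mathrm{Rf}_{G,S}(n)=\max_{g\in G\setminus\{1\},\ \|g\|_S\le n}\ \min\{|Q| : \varphi:G\to Q \text{ a homomorphism to a finite group},\ \varphi(g)\ne1\}.$$ Recursively presented means having a presentation with finitely many (or a computable set of) generators and a recursively enumerable set of relators. 3-step solvable means solvable of derived length 3. *)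

theory Defs
  imports
    Complex_Main
    "HOL-Library.Nat_Bijection"
    "HOL-Computational_Algebra.Polynomial"
    "HOL-Algebra.Coset"
    "HOL-Algebra.Generated_Groups"
    "HOL-Algebra.Solvable_Groups"
begin

section \<open>Computable and recursively enumerable sets of natural numbers\<close>

datatype recf =
    Zero
  | Succ
  | Proj nat
  | Comp recf "recf list"
  | PrimRec recf recf
  | Mu recf

text \<open>
  \<open>rec_eval f xs y\<close>: the partial recursive function with program \<open>f\<close> is defined on the argument
  tuple \<open>xs\<close> and has value \<open>y\<close>. Recursion and minimisation act on the first argument. Arities are
  not recorded: \<open>Zero\<close> is the constant 0 on tuples of any length, and a program has no value on a
  tuple whose length does not fit it.
\<close>

inductive rec_eval :: "recf \<Rightarrow> nat list \<Rightarrow> nat \<Rightarrow> bool" where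
  zero: "rec_eval Zero xs 0"
| succ: "rec_eval Succ [x] (Suc x)"
| proj: "i < length xs \<Longrightarrow> rec_eval (Proj i) xs (xs ! i)"
| comp: "length ys = length gs \<Longrightarrow> (\<forall>i<length gs. rec_eval (gs ! i) xs (ys ! i)) \<Longrightarrow>
    rec_eval f ys z \<Longrightarrow> rec_eval (Comp f gs) xs z"
| prim_0: "rec_eval f xs y \<Longrightarrow> rec_eval (PrimRec f g) (0 # xs) y"
| prim_Suc: "rec_eval (PrimRec f g) (n # xs) r \<Longrightarrow> rec_eval g (n # r # xs) y \<Longrightarrow>
    rec_eval (PrimRec f g) (Suc n # xs) y"
| mu: "rec_eval f (n # xs) 0 \<Longrightarrow> (\<forall>m<n. \<exists>k. rec_eval f (m # xs) (Suc k)) \<Longrightarrow>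
    rec_eval (Mu f) xs n"

definition computable_set :: "nat set \<Rightarrow> bool" where
  "computable_set A \<longleftrightarrow> (\<exists>f. \<forall>x. rec_eval f [x] (if x \<in> A then 1 else 0))"

definition re_set :: "nat set \<Rightarrow> bool" where
  "re_set A \<longleftrightarrow> (\<exists>f. A = {x. \<exists>y. rec_eval f [x] y})"


section \<open>Free groups and presentations\<close>

text \<open>In a word, the letter \<open>(x, True)\<close> stands for \<open>x\<close> and \<open>(x, False)\<close> for its formal inverse.\<close>

type_synonym 'a word = "('a \<times> bool) list"

definition words :: "'a set \<Rightarrow> 'a word set" where
  "words X = lists (X \<times> UNIV)"

inductive free_cancel :: "'a set \<Rightarrow> 'a word \<Rightarrow> 'a word \<Rightarrow> bool" for X where
  "u \<in> words X \<Longrightarrow> v \<in> words X \<Longrightarrow> x \<in> X \<Longrightarrow>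
    free_cancel X (u @ (x, b) # (x, \<not> b) # v) (u @ v)"

definition free_rel :: "'a set \<Rightarrow> ('a word \<times> 'a word) set" where
  "free_rel X = {(u, v). u \<in> words X \<and> v \<in> words X \<and> equivclp (free_cancel X) u v}"

definition free_group :: "'a set \<Rightarrow> 'a word set monoid" where
  "free_group X =
    \<lparr>carrier = words X // free_rel X,
     mult = (\<lambda>A B. \<Union>u\<in>A. \<Union>v\<in>B. free_rel X `` {u @ v}),
     one = free_rel X `` {[]}\<rparr>"

definition normal_closure :: "('a, 'b) monoid_scheme \<Rightarrow> 'a set \<Rightarrow> 'a set" where
  "normal_closure G A = \<Inter>{N. N \<lhd> G \<and> A \<subseteq> N}"

definition presented_group :: "'a set \<Rightarrow> 'a word set \<Rightarrow> 'a word set set monoid" where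
  "presented_group X R =
    free_group X Mod normal_closure (free_group X) ((\<lambda>r. free_rel X `` {r}) ` R)"

definition word_code :: "nat word \<Rightarrow> nat" where
  "word_code w = list_encode (map (\<lambda>(x, b). 2 * x + of_bool b) w)"

definition recursively_presented :: "('a, 'b) monoid_scheme \<Rightarrow> bool" where
  "recursively_presented G \<longleftrightarrow>
    (\<exists>(X :: nat set) R. (finite X \<or> computable_set X) \<and> R \<subseteq> words X \<and> re_set (word_code ` R) \<and>
      G \<cong> presented_group X R)"


section \<open>Group-theoretic properties\<close>

definition finite_generating_set :: "('a, 'b) monoid_scheme \<Rightarrow> 'a set \<Rightarrow> bool" where
  "finite_generating_set G S \<longleftrightarrow> finite S \<and> S \<subseteq> carrier G \<and> generate G S = carrier G"

definition finitely_generated :: "('a, 'b) monoid_scheme \<Rightarrow> bool" where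
  "finitely_generated G \<longleftrightarrow> (\<exists>S. finite_generating_set G S)"

text \<open>Least-number convention: only meaningful for solvable groups.\<close>

definition derived_length :: "('a, 'b) monoid_scheme \<Rightarrow> nat" where
  "derived_length G = (LEAST n. (derived G ^^ n) (carrier G) = {\<one>\<^bsub>G\<^esub>})"

text \<open>
  Every finite group is isomorphic to one whose carrier is a set of natural numbers, so nothing is
  lost by taking the finite groups \<open>Q\<close> of type \<open>nat monoid\<close>.
\<close>

definition separating_hom ::
    "('a, 'b) monoid_scheme \<Rightarrow> 'a \<Rightarrow> nat monoid \<Rightarrow> ('a \<Rightarrow> nat) \<Rightarrow> bool" where
  "separating_hom G g Q \<phi> \<longleftrightarrow>
    group Q \<and> finite (carrier Q) \<and> \<phi> \<in> hom G Q \<and> \<phi> g \<noteq> \<one>\<^bsub>Q\<^esub>"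

definition residually_finite :: "('a, 'b) monoid_scheme \<Rightarrow> bool" where
  "residually_finite G \<longleftrightarrow> (\<forall>g \<in> carrier G - {\<one>\<^bsub>G\<^esub>}. \<exists>Q \<phi>. separating_hom G g Q \<phi>)"

definition word_norm :: "('a, 'b) monoid_scheme \<Rightarrow> 'a set \<Rightarrow> 'a \<Rightarrow> nat" where
  "word_norm G S g =
    (LEAST k. \<exists>ws. set ws \<subseteq> S \<union> (\<lambda>s. inv\<^bsub>G\<^esub> s) ` S \<and> length ws = k \<and>
      foldr (mult G) ws \<one>\<^bsub>G\<^esub> = g)"

definition min_quotient_order :: "('a, 'b) monoid_scheme \<Rightarrow> 'a \<Rightarrow> nat" where
  "min_quotient_order G g = (LEAST k. \<exists>Q \<phi>. separating_hom G g Q \<phi> \<and> card (carrier Q) = k)"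

definition Rf :: "('a, 'b) monoid_scheme \<Rightarrow> 'a set \<Rightarrow> nat \<Rightarrow> nat" where
  "Rf G S n =
    Max (min_quotient_order G ` {g \<in> carrier G - {\<one>\<^bsub>G\<^esub>}. word_norm G S g \<le> n})"

end

theory Submission
  imports Defs "HOL-Library.Poly_Mapping" "HOL-Library.Z2" "HOL-Library.Countable_Set"
    "HOL-Algebra.Algebraic_Closure_Type"
begin

text \<open>
  Let \<open>A = F\<^sub>2[t, 1/t]\<close>. After P. Hall, consider the upper triangular matrices over \<open>A\<close> with rows
  \<open>(1, a, c)\<close>, \<open>(0, t^k, b)\<close>, \<open>(0, 0, 1)\<close>. They form a group that is central by metabelian, and the
  additive group of \<open>A\<close> sits in its centre as the entry \<open>c\<close>. The group of the theorem, \<open>hall\<close>,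
  is generated by \<open>x\<close> (\<open>a = 1\<close>), \<open>y\<close> (\<open>b = 1\<close>) and \<open>t\<close> (\<open>k = 1\<close>) after some central elements have
  been identified. With \<open>x\<^sub>k = t^-k x t^k\<close>, the commutator \<open>z\<^sub>k = [x\<^sub>k, y]\<close> is the central element
  \<open>c = t^k\<close>. The added relations are \<open>z\<^sub>k = z\<^sub>l\<close> for the pairs \<open>(k, l) = (near s, far s)\<close>, one pair for
  each natural number \<open>s\<close>. Everything rests on the choice of these exponents: they are values of
  \<open>order_mult r = 2^r (2^1 - 1) \<dots> (2^r - 1)\<close>, a number of size only \<open>2^O(r^2)\<close> such that \<open>t\<close> to
  this power is trivial on every cyclic \<open>F\<^sub>2[t, 1/t]\<close>-module of dimension at most \<open>r\<close>. The arguments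
  \<open>r\<close> run through the sparse sequence \<open>scale i = 2^(3^i)\<close>; \<open>near s\<close> belongs to \<open>scale (2 s)\<close> and
  \<open>far s\<close> to \<open>scale (2 s + 3)\<close>, so that \<open>far s\<close> leaps over \<open>near (s + 1)\<close>.

  Lower bound. The witness is \<open>z\<^sub>k / z\<^sub>0\<close> with \<open>k = near s\<close>, a word of length \<open>O(near s)\<close>. In a finite
  quotient of order below \<open>2^e\<close>, where \<open>e = scale (2 s + 3)\<close>, the conjugates of \<open>x\<close> span a cyclic
  module of dimension less than \<open>e\<close>; there \<open>x\<^sub>l = x\<^sub>0\<close> for \<open>l = far s\<close>, hence
  \<open>z\<^sub>k = z\<^sub>l = z\<^sub>0\<close> and the witness dies (\<open>witness_quotient_order\<close>). The next witness has length about
  \<open>near (s + 1) \<le> 2^(2 c^2)\<close> with \<open>c = scale (2 s + 2)\<close>, whereas the quotients that detect the present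
  one have order at least \<open>2^(c^3)\<close>. So the growth exceeds every polynomial, at all lengths.

  Upper bound. Let \<open>z\<close> be a nonzero element of the field with \<open>2^r\<close> elements, where \<open>r = scale j\<close>.
  Evaluating \<open>t\<close> at \<open>z\<close> maps the group to a group of order at most \<open>2^(4 r)\<close>, once the values
  \<open>z^near s - z^far s\<close> are factored out of the last coordinate. Since \<open>z^(2^r - 1) = 1\<close>, the exponents
  that belong to arguments at least \<open>r\<close> evaluate to 1, so only about \<open>j / 2\<close> relations give a nonzero
  value and there are at most \<open>2^j\<close> sums of them. If every \<open>z\<close> sends a central element \<open>c\<close> to such a sum,
  then some fixed sum serves for more \<open>z\<close> than the degrees involved allow, and \<open>c\<close> equals that sum as
  a Laurent polynomial; its normal form then forces \<open>c = 0\<close> (\<open>central_separation\<close>). An element of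
  length \<open>n\<close> can be treated with \<open>r\<close> polynomial in \<open>log n\<close>, so its detection needs quotients of
  quasi-polynomial order only, far below \<open>exp (n^(1/2))\<close>.

  Presentation. The relators are finitely many explicit families of words indexed by a natural
  number, and the code of the i-th word is primitive recursive in i, so the set of relators is
  recursively enumerable. That they suffice follows by rewriting a word to a product of a central
  element, conjugates of \<open>y\<close>, a power of \<open>t\<close> and conjugates of \<open>x\<close> (\<open>normal_form\<close>).
\<close>

section \<open>Laurent polynomials over the field with two elements\<close>

type_synonym laurent = "int \<Rightarrow>\<^sub>0 bit"

abbreviation tpow :: "int \<Rightarrow> laurent" where
  "tpow k \<equiv> Poly_Mapping.single k 1"

abbreviation supp :: "laurent \<Rightarrow> int set" where
  "supp \<equiv> Poly_Mapping.keys"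

abbreviation coef :: "laurent \<Rightarrow> int \<Rightarrow> bit" where
  "coef \<equiv> Poly_Mapping.lookup"

text \<open>The simplifier would otherwise turn the ring operations of the two-element field into bit
  operations.\<close>

declare add_bit_eq_xor [simp del] mult_bit_eq_and [simp del]

lemma bit_add_self [simp]: "(a :: bit) + a = 0"
  by (cases a) (simp_all add: add_bit_eq_xor)

lemma laurent_double [simp]: "(a :: laurent) + a = 0"
  by (rule poly_mapping_eqI) (simp only: lookup_add lookup_zero bit_add_self)

lemma laurent_two [simp]: "(2 :: laurent) = 0"
  by (metis laurent_double one_add_one)

lemma laurent_minus [simp]: "- (a :: laurent) = a"
  by (metis add_eq_0_iff laurent_double)

lemma laurent_diff [simp]: "(a :: laurent) - b = a + b"
  by (metis diff_conv_add_uminus laurent_minus)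

lemma laurent_add_eq_0_iff: "(a :: laurent) + b = 0 \<longleftrightarrow> a = b"
  by (metis add_eq_0_iff laurent_minus)

lemma tpow_mult [simp]: "tpow k * tpow l = tpow (k + l)"
  by (simp add: mult_single)

lemma tpow_mult_assoc [simp]: "tpow k * (tpow l * a) = tpow (k + l) * a"
  by (simp flip: mult.assoc)

lemma lookup_tpow: "coef (tpow k) j = (if k = j then 1 else 0)"
  by (simp add: lookup_single when_def)

lemma tpow_inj [simp]: "tpow k = tpow l \<longleftrightarrow> k = l"
  by (metis lookup_tpow zero_neq_one)

lemma keys_laurent_add: "supp (a + b :: laurent) = (supp a - supp b) \<union> (supp b - supp a)"
  by (auto simp: in_keys_iff lookup_add)

text \<open>All coefficients are 0 or 1, so a Laurent polynomial is a sum of powers of \<open>t\<close>.\<close>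

lemma laurent_induct [case_names zero add]:
  assumes "P 0" "\<And>k a. P a \<Longrightarrow> P (tpow k + a)"
  shows "P (a :: laurent)"
proof (induction "card (supp a)" arbitrary: a)
  case 0
  hence "a = 0" by simp
  thus ?case using assms by simp
next
  case (Suc n)
  then obtain k where k: "k \<in> supp a" by fastforce
  have keys: "supp (tpow k + a) = supp a - {k}"
    using k by (auto simp: keys_laurent_add)
  hence "card (supp (tpow k + a)) = n"
    using Suc.hyps(2) k by simp
  from Suc.hyps(1)[OF this[symmetric]] have "P (tpow k + (tpow k + a))"
    using assms by blast
  thus ?case by (simp flip: add.assoc)
qed

text \<open>The additive extension of a map on the powers of \<open>t\<close>. A coefficient is 0 or 1,
  so it selects a power instead of multiplying its image, and the target needs no scalars.\<close>

definition lin_ext :: "(int \<Rightarrow> 'b::comm_monoid_add) \<Rightarrow> laurent \<Rightarrow> 'b" where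
  "lin_ext u a = (\<Sum>k\<in>supp a. u k)"

lemma lin_ext_0 [simp]: "lin_ext u 0 = 0"
  by (simp add: lin_ext_def)

lemma lin_ext_tpow [simp]: "lin_ext u (tpow k) = u k"
  by (simp add: lin_ext_def)

text \<open>The support of a sum is the symmetric difference of the supports. The common part is counted
  twice on the right, and it cancels because the target has characteristic 2.\<close>

lemma lin_ext_add:
  fixes u :: "int \<Rightarrow> 'b::comm_monoid_add"
  assumes "\<And>k. u k + u k = 0"
  shows "lin_ext u (a + b) = lin_ext u a + lin_ext u b"
proof -
  let ?A = "supp a" and ?B = "supp b"
  have "sum u (?A - ?B) + sum u (?A \<inter> ?B) = sum u ?A"
    by (subst sum.union_disjoint [symmetric]) (auto intro!: sum.cong)
  moreover have "sum u (?B - ?A) + sum u (?A \<inter> ?B) = sum u ?B"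
    by (subst sum.union_disjoint [symmetric]) (auto intro!: sum.cong)
  moreover have "sum u (?A \<inter> ?B) + sum u (?A \<inter> ?B) = 0"
    by (simp add: assms flip: sum.distrib)
  ultimately have "sum u ?A + sum u ?B = sum u (?A - ?B) + sum u (?B - ?A)"
    by (metis (no_types, lifting) add.assoc add.commute add.right_neutral)
  thus ?thesis
    by (simp add: lin_ext_def keys_laurent_add sum.union_disjoint Int_Diff Diff_Int_distrib2)
qed

lemma additive_eqI:
  assumes "\<And>a b. f (a + b) = f a + f b" "\<And>a b. g (a + b) = g a + g b"
    "f 0 = g 0" "\<And>k. f (tpow k) = g (tpow k)"
  shows "f (a :: laurent) = g a"
  by (induction a rule: laurent_induct) (simp_all add: assms)

definition supp_within :: "nat \<Rightarrow> laurent \<Rightarrow> bool" where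
  "supp_within N a \<longleftrightarrow> supp a \<subseteq> {- int N..int N}"

lemma supp_within_0 [simp]: "supp_within N 0"
  by (simp add: supp_within_def)

lemma supp_within_mono: "supp_within N a \<Longrightarrow> N \<le> N' \<Longrightarrow> supp_within N' a"
  by (force simp: supp_within_def)

lemma supp_within_add: "supp_within N a \<Longrightarrow> supp_within N b \<Longrightarrow> supp_within N (a + b)"
  using keys_add[of a b] by (auto simp: supp_within_def)

lemma supp_within_mult: "supp_within N a \<Longrightarrow> supp_within N' b \<Longrightarrow> supp_within (N + N') (a * b)"
  using keys_mult[of a b] by (force simp: supp_within_def)

lemma supp_within_tpow: "\<bar>k\<bar> \<le> int N \<Longrightarrow> supp_within N (tpow k)"
  by (auto simp: supp_within_def)

lemma ex_supp_within: "\<exists>N. supp_within N a"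
proof -
  have "finite ((\<lambda>k. nat \<bar>k\<bar>) ` supp a)" by simp
  then obtain N where "\<forall>n\<in>(\<lambda>k. nat \<bar>k\<bar>) ` supp a. n \<le> N"
    using finite_nat_set_iff_bounded_le by auto
  hence "supp_within N a"
    by (fastforce simp: supp_within_def)
  thus ?thesis ..
qed

section \<open>The exponents and their identification\<close>

text \<open>Every factor has a purpose: \<open>t\<close> to the power \<open>2^i - 1\<close> is trivial
  modulo an irreducible polynomial of degree i other than \<open>t\<close>, and the factor
  \<open>2^r\<close> takes care of repeated irreducible factors. See
  \<open>dvd_xpow_order_mult\<close> below.\<close>

definition order_mult :: "nat \<Rightarrow> nat" where
  "order_mult r = 2 ^ r * (\<Prod>i=1..r. 2 ^ i - 1)"

lemma order_mult_0 [simp]: "order_mult 0 = 1" by (simp add: order_mult_def)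

lemma order_mult_Suc [simp]: "order_mult (Suc r) = order_mult r * (2 * (2 ^ Suc r - 1))"
  by (simp add: order_mult_def algebra_simps)

lemma order_mult_pos [simp]: "order_mult r > 0"
proof -
  have "(0::nat) < 2 ^ i - 1" if "i \<ge> 1" for i
    using one_less_power[of "2::nat" i] that by simp
  thus ?thesis unfolding order_mult_def by (auto intro!: prod_pos)
qed

lemma order_mult_strict_mono: "strict_mono order_mult"
proof (rule strict_mono_Suc_iff[THEN iffD2], rule allI)
  fix n
  have "(2::nat) \<le> 2 ^ Suc n" by simp
  hence "(2::nat) \<le> 2 * (2 ^ Suc n - 1)" by linarith
  hence "order_mult n * 1 < order_mult n * (2 * (2 ^ Suc n - 1))"
    by (intro mult_strict_left_mono) auto
  thus "order_mult n < order_mult (Suc n)" by simp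
qed

lemma order_mult_dvd: "1 \<le> i \<Longrightarrow> i \<le> r \<Longrightarrow> 2 ^ i - 1 dvd order_mult r"
  unfolding order_mult_def by (intro dvd_mult dvd_prodI) auto

lemma order_mult_ge: "2 ^ r \<le> order_mult r"
proof (induction r)
  case (Suc r)
  have "(2::nat) \<le> 2 ^ Suc r" by simp
  hence "(1::nat) \<le> 2 ^ Suc r - 1" by linarith
  with Suc have "2 ^ r * (2 * 1) \<le> order_mult r * (2 * (2 ^ Suc r - 1))"
    by (intro mult_mono) auto
  thus ?case by simp
qed auto

lemma order_mult_le: "order_mult r \<le> 2 ^ (2 * r ^ 2)"
proof (induction r)
  case (Suc r)
  have "order_mult r * (2 * (2 ^ Suc r - 1)) \<le> 2 ^ (2 * r ^ 2) * (2 * 2 ^ Suc r)"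
    using Suc by (intro mult_mono) auto
  also have "\<dots> = (2::nat) ^ (2 * r ^ 2 + r + 2)"
    by (simp add: power_add)
  also have "\<dots> \<le> 2 ^ (2 * (Suc r) ^ 2)"
    by (intro power_increasing) (auto simp: power2_eq_square)
  finally show ?case by simp
qed auto

text \<open>Consecutive values are related by cubing, while the logarithm of \<open>order_mult r\<close>
  grows only like \<open>r^2\<close>. Hence \<open>2^(scale (i + 1))\<close> exceeds every
  fixed power of \<open>order_mult (scale i)\<close>, which both bounds exploit.\<close>

definition scale :: "nat \<Rightarrow> nat" where "scale i = 2 ^ (3 ^ i)"

lemma scale_Suc: "scale (Suc i) = scale i ^ 3"
  by (simp add: scale_def mult.commute flip: power_mult)

lemma scale_strict_mono: "strict_mono scale"
  by (rule strict_monoI) (simp add: scale_def)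

lemma scale_ge: "i < scale i"
proof -
  have "i < 3 ^ i" by (induction i) auto
  also have "(3::nat) ^ i < 2 ^ 3 ^ i" by (rule less_exp)
  finally show ?thesis by (simp add: scale_def)
qed

lemma scale_ge_2: "2 \<le> scale i"
  using self_le_power[of 2 "3 ^ i"] by (simp add: scale_def)

text \<open>Even indices serve the short exponents and odd indices the long ones, so no exponent occurs
  twice. The shift by 3 puts \<open>far s\<close> one step beyond \<open>near (s + 1)\<close>.\<close>

definition near :: "nat \<Rightarrow> nat" where "near s = order_mult (scale (2 * s))"
definition far :: "nat \<Rightarrow> nat" where "far s = order_mult (scale (2 * s + 3))"

lemma order_mult_scale_eq_iff [simp]: "order_mult (scale i) = order_mult (scale j) \<longleftrightarrow> i = j"
  using order_mult_strict_mono scale_strict_mono by (simp add: strict_mono_eq)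

lemma order_mult_scale_less_iff [simp]: "order_mult (scale i) < order_mult (scale j) \<longleftrightarrow> i < j"
  using order_mult_strict_mono scale_strict_mono by (simp add: strict_mono_less)

lemma near_neq_far [simp]: "near s \<noteq> far s'" "far s' \<noteq> near s"
  unfolding near_def far_def by (auto; presburger)+

lemma far_eq_iff [simp]: "far s = far s' \<longleftrightarrow> s = s'"
  by (simp add: far_def)

lemma near_eq_iff [simp]: "near s = near s' \<longleftrightarrow> s = s'"
  by (simp add: near_def)

lemma near_less_far: "near s < far s"
  by (simp add: near_def far_def)

lemma near_strict_mono: "strict_mono near"
  by (rule strict_monoI) (simp add: near_def)

lemma near_ge: "4 \<le> near s"
proof -
  have "(2::nat) ^ 2 \<le> 2 ^ scale (2 * s)" by (intro power_increasing scale_ge_2) auto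
  also have "\<dots> \<le> near s" unfolding near_def by (rule order_mult_ge)
  finally show ?thesis by simp
qed

text \<open>The identification of exponents: \<open>far s\<close> is replaced by \<open>near s\<close>.
  It is idempotent, so its values are normal forms for the identified central elements.\<close>

definition \<phi> :: "int \<Rightarrow> int" where
  "\<phi> k = (if k \<in> int ` range far then int (near (inv_into UNIV far (nat k))) else k)"

lemma \<phi>_far [simp]: "\<phi> (int (far s)) = int (near s)"
proof -
  have "inj far" by (rule injI) simp
  thus ?thesis by (simp add: \<phi>_def)
qed

lemma \<phi>_other: "k \<notin> int ` range far \<Longrightarrow> \<phi> k = k"
  by (simp add: \<phi>_def)

lemma \<phi>_near [simp]: "\<phi> (int (near s)) = int (near s)"
  by (rule \<phi>_other) auto

lemma \<phi>_small: "k < 4 \<Longrightarrow> \<phi> k = k"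
proof (rule \<phi>_other, clarify)
  fix s assume "int (far s) < 4"
  thus False using near_ge[of s] near_less_far[of s] by linarith
qed

lemma \<phi>_abs: "\<bar>\<phi> k\<bar> \<le> \<bar>k\<bar>"
proof (cases "k \<in> int ` range far")
  case True
  then obtain s where "k = int (far s)" by auto
  thus ?thesis using near_less_far[of s] by simp
qed (simp add: \<phi>_other)

lemma \<phi>_not_far [simp]: "\<phi> k \<noteq> int (far s)"
  by (cases "k \<in> int ` range far") (auto simp: \<phi>_other)

text \<open>An additive projection with kernel spanned by the elements \<open>t^near s + t^far
  s\<close>. Its image is a set of representatives for the quotient by this kernel, and the
  group can be defined on representatives instead of cosets.\<close>

definition \<rho> :: "laurent \<Rightarrow> laurent" where
  "\<rho> = lin_ext (\<lambda>k. tpow (\<phi> k))"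

lemma \<rho>_add [simp]: "\<rho> (a + b) = \<rho> a + \<rho> b"
  unfolding \<rho>_def by (rule lin_ext_add) simp

lemma \<rho>_0 [simp]: "\<rho> 0 = 0" by (simp add: \<rho>_def)

lemma \<rho>_tpow [simp]: "\<rho> (tpow k) = tpow (\<phi> k)" by (simp add: \<rho>_def)

lemma supp_within_sum:
  "finite I \<Longrightarrow> (\<And>i. i \<in> I \<Longrightarrow> supp_within N (f i)) \<Longrightarrow> supp_within N (sum f I)"
  by (induction I rule: finite_induct) (auto intro: supp_within_add)

lemma supp_within_\<rho>: "supp_within N a \<Longrightarrow> supp_within N (\<rho> a)"
  unfolding \<rho>_def lin_ext_def
proof (rule supp_within_sum)
  fix k assume "supp_within N a" "k \<in> supp a"
  hence "k \<in> {- int N..int N}" by (auto simp: supp_within_def)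
  hence "\<bar>k\<bar> \<le> int N" by auto
  thus "supp_within N (tpow (\<phi> k))"
    using \<phi>_abs[of k] by (intro supp_within_tpow) linarith
qed simp

section \<open>The group\<close>

text \<open>The tuple \<open>(k, a, b, c)\<close> stands for the matrix with rows \<open>(1, a,
  c)\<close>, \<open>(0, t^k, b)\<close>, \<open>(0, 0, 1)\<close>.\<close>

type_synonym elem = "int \<times> laurent \<times> laurent \<times> laurent"

text \<open>Matrix multiplication, except that the product of \<open>a\<close> and \<open>b'\<close> in
  the corner passes through \<open>\<rho>\<close>. Associativity needs only that
  \<open>\<rho>\<close> is additive.\<close>

fun emult :: "elem \<Rightarrow> elem \<Rightarrow> elem" (infixl "\<odot>" 70) where
  "(k, a, b, c) \<odot> (k', a', b', c') =
    (k + k', a' + a * tpow k', b + tpow k * b', c + c' + \<rho> (a * b'))"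

definition eone :: elem where "eone = (0, 0, 0, 0)"

fun einv :: "elem \<Rightarrow> elem" where
  "einv (k, a, b, c) = (- k, a * tpow (- k), tpow (- k) * b, c + \<rho> (a * tpow (- k) * b))"

lemma emult_assoc: "(g \<odot> h) \<odot> l = g \<odot> (h \<odot> l)"
  by (cases g; cases h; cases l) (simp add: algebra_simps)

lemma emult_one [simp]: "eone \<odot> g = g" "g \<odot> eone = g"
  by (cases g; simp add: eone_def)+

lemma einv_left [simp]: "einv g \<odot> g = eone"
proof (cases g)
  fix k a b c assume fields: "g = (k, a, b, c)"
  have 1: "a * tpow (- k) * tpow k = a"
    by (simp add: mult.assoc)
  have 3: "c + \<rho> (a * tpow (- k) * b) + c + \<rho> (a * tpow (- k) * b) = 0"
    by (metis add.assoc add.commute laurent_double)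
  show ?thesis unfolding fields using 1 3
    by (simp only: einv.simps emult.simps eone_def) (simp add: mult.assoc)
qed

lemma countable_elem: "countable (UNIV :: elem set)"
proof -
  have "inj (supp :: laurent \<Rightarrow> int set)"
    by (rule injI, rule poly_mapping_eqI) (metis bit_not_one_iff in_keys_iff)
  moreover have "range (supp :: laurent \<Rightarrow> int set) \<subseteq> {A. finite A}"
    by auto
  hence "countable (range (supp :: laurent \<Rightarrow> int set))"
    by (rule countable_subset) (simp add: countable_Collect_finite)
  ultimately have "countable (UNIV :: laurent set)"
    using countable_image_inj_eq by blast
  thus ?thesis
    by (simp flip: UNIV_Times_UNIV)
qed

lemma infinite_elem: "infinite (UNIV :: elem set)"
proof -
  have "inj (\<lambda>k :: int. (k, 0, 0, 0) :: elem)" by (rule injI) simp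
  thus ?thesis using finite_imageD[of "\<lambda>k :: int. (k, 0, 0, 0) :: elem" UNIV]
    by (metis finite_subset infinite_UNIV_int subset_UNIV)
qed

text \<open>There are countably infinitely many tuples, so a bijection carries the multiplication to the
  natural numbers. Any bijection will do: recursive presentability is proved from relators,
  without computing in the group.\<close>

definition enc :: "elem \<Rightarrow> nat" where "enc = to_nat_on UNIV"
definition dec :: "nat \<Rightarrow> elem" where "dec = from_nat_into UNIV"

lemma dec_enc [simp]: "dec (enc g) = g"
  by (simp add: dec_def enc_def countable_elem)

lemma enc_dec [simp]: "enc (dec n) = n"
  by (simp add: dec_def enc_def countable_elem infinite_elem to_nat_on_from_nat_into_infinite)

lemma enc_eq_iff [simp]: "enc g = enc h \<longleftrightarrow> g = h"
  by (metis dec_enc)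

lemma dec_eq_iff [simp]: "dec g = dec h \<longleftrightarrow> g = h"
  by (metis enc_dec)

definition big_group :: "nat monoid" where
  "big_group = \<lparr>carrier = UNIV, mult = (\<lambda>m n. enc (dec m \<odot> dec n)), one = enc eone\<rparr>"

lemma big_group_simps [simp]:
  "carrier big_group = UNIV" "m \<otimes>\<^bsub>big_group\<^esub> n = enc (dec m \<odot> dec n)" "\<one>\<^bsub>big_group\<^esub> = enc eone"
  by (simp_all add: big_group_def)

interpretation big_group: group big_group
proof (rule groupI)
  fix x assume "x \<in> carrier big_group"
  show "\<exists>y\<in>carrier big_group. y \<otimes>\<^bsub>big_group\<^esub> x = \<one>\<^bsub>big_group\<^esub>"
    by (rule bexI[of _ "enc (einv (dec x))"]) auto
qed (auto simp: emult_assoc)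

lemma big_group_inv [simp]: "inv\<^bsub>big_group\<^esub> n = enc (einv (dec n))"
  by (rule big_group.inv_equality) auto

definition gx :: elem where "gx = (0, 1, 0, 0)"
definition gy :: elem where "gy = (0, 0, 1, 0)"
definition gt :: elem where "gt = (1, 0, 0, 0)"

definition hall :: "nat monoid" where
  "hall = big_group\<lparr>carrier := generate big_group (enc ` {gx, gy, gt})\<rparr>"

lemma subgroup_hall: "subgroup (carrier hall) big_group"
  unfolding hall_def using big_group.generate_is_subgroup by simp

interpretation hall: group hall
  using big_group.subgroup_imp_group[OF big_group.generate_is_subgroup] unfolding hall_def by simp

lemma hall_simps [simp]:
  "m \<otimes>\<^bsub>hall\<^esub> n = enc (dec m \<odot> dec n)" "\<one>\<^bsub>hall\<^esub> = enc eone"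
  by (simp_all add: hall_def)

lemma hall_inv: "n \<in> carrier hall \<Longrightarrow> inv\<^bsub>hall\<^esub> n = enc (einv (dec n))"
  using big_group.m_inv_consistent[OF subgroup_hall, of n] unfolding hall_def by simp

lemma fg_hall: "finite_generating_set hall (enc ` {gx, gy, gt})"
  unfolding finite_generating_set_def
proof (intro conjI)
  show "enc ` {gx, gy, gt} \<subseteq> carrier hall"
    unfolding hall_def by (auto intro: generate.incl)
  then show "generate hall (enc ` {gx, gy, gt}) = carrier hall"
    using big_group.generate_consistent[OF _ subgroup_hall] unfolding hall_def by simp
qed simp

section \<open>Computable functions\<close>

text \<open>Needed for minimisation: a program known to compute a total function has no other value at
  the arguments where the search stops.\<close>

lemma rec_eval_det: "rec_eval f xs y \<Longrightarrow> rec_eval f xs y' \<Longrightarrow> y = y'"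
proof (induction arbitrary: y' rule: rec_eval.induct)
  case (comp ys gs xs f z)
  from comp.prems show ?case
  proof (cases rule: rec_eval.cases)
    case (comp ys')
    have "ys = ys'"
      using comp comp.IH comp.hyps by (intro nth_equalityI) auto
    thus ?thesis using comp comp.IH by auto
  qed
next
  case (prim_Suc f g n xs r y)
  from prim_Suc.prems show ?case
    by (cases rule: rec_eval.cases) (use prim_Suc.IH in blast)
next
  case (mu f n xs)
  from mu.prems show ?case
  proof (cases rule: rec_eval.cases)
    case mu': mu
    have "\<not> n < y'"
      using mu.IH(1) mu' by fastforce
    moreover have "\<not> y' < n"
      using mu.IH(2) mu' by fastforce
    ultimately show ?thesis by simp
  qed
next
  case (prim_0 f xs y g)
  from prim_0.prems show ?case
    by (cases rule: rec_eval.cases) (use prim_0.IH in blast)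
qed (erule rec_eval.cases; simp)+

text \<open>Only totally defined functions are considered, one arity at a time. Closure under
  substitution and primitive recursion then reads as a set of introduction rules for HOL
  functions.\<close>

definition computable :: "nat \<Rightarrow> (nat list \<Rightarrow> nat) \<Rightarrow> bool" where
  "computable n F \<longleftrightarrow> (\<exists>p. \<forall>xs. length xs = n \<longrightarrow> rec_eval p xs (F xs))"

lemma computable_cong: "computable n F \<Longrightarrow> (\<And>xs. length xs = n \<Longrightarrow> F xs = F' xs) \<Longrightarrow> computable n F'"
  unfolding computable_def by metis

lemma computable_nth: "i < n \<Longrightarrow> computable n (\<lambda>xs. xs ! i)"
  unfolding computable_def by (auto intro: rec_eval.proj)

lemma computable_comp:
  assumes "computable (length Gs) F" "\<And>G. G \<in> set Gs \<Longrightarrow> computable n G"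
  shows "computable n (\<lambda>xs. F (map (\<lambda>G. G xs) Gs))"
proof -
  obtain p where p: "\<And>ys. length ys = length Gs \<Longrightarrow> rec_eval p ys (F ys)"
    using assms(1) unfolding computable_def by blast
  have "\<forall>i<length Gs. \<exists>q. \<forall>xs. length xs = n \<longrightarrow> rec_eval q xs ((Gs ! i) xs)"
    using assms(2) unfolding computable_def by auto
  then obtain q where q: "\<And>i xs. i < length Gs \<Longrightarrow> length xs = n \<Longrightarrow> rec_eval (q i) xs ((Gs ! i) xs)"
    by metis
  have "rec_eval (Comp p (map q [0..<length Gs])) xs (F (map (\<lambda>G. G xs) Gs))" if "length xs = n" for xs
    by (rule rec_eval.comp[where ys = "map (\<lambda>G. G xs) Gs"]) (auto intro: p q that)
  thus ?thesis unfolding computable_def by blast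
qed

text \<open>The recursion argument comes first in \<open>PrimRec\<close>, and the step function sees the
  counter, the previous value and then the parameters.\<close>

lemma computable_rec:
  assumes "computable n Z" "computable (Suc (Suc n)) S" "computable n N"
  shows "computable n (\<lambda>xs. rec_nat (Z xs) (\<lambda>m r. S (m # r # xs)) (N xs))"
proof -
  obtain p q where p: "\<And>xs. length xs = n \<Longrightarrow> rec_eval p xs (Z xs)"
    and q: "\<And>xs. length xs = Suc (Suc n) \<Longrightarrow> rec_eval q xs (S xs)"
    using assms unfolding computable_def by metis
  have "rec_eval (PrimRec p q) (m # xs) (rec_nat (Z xs) (\<lambda>m r. S (m # r # xs)) m)"
    if "length xs = n" for m xs
    by (induction m) (auto intro!: rec_eval.prim_0 rec_eval.prim_Suc p q that)
  hence 1: "computable (Suc n) (\<lambda>ys. rec_nat (Z (tl ys)) (\<lambda>m r. S (m # r # tl ys)) (hd ys))"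
    unfolding computable_def by (intro exI[of _ "PrimRec p q"]) (auto simp: length_Suc_conv)
  let ?Gs = "N # map (\<lambda>i xs. xs ! i) [0..<n]"
  have "computable n (\<lambda>xs. (\<lambda>ys. rec_nat (Z (tl ys)) (\<lambda>m r. S (m # r # tl ys)) (hd ys)) (map (\<lambda>G. G xs) ?Gs))"
    by (rule computable_comp) (use 1 assms(3) in \<open>auto intro: computable_nth\<close>)
  thus ?thesis
    by (rule computable_cong) (auto simp: comp_def map_nth)
qed

lemma computable_Suc:
  assumes "computable n F"
  shows "computable n (\<lambda>xs. Suc (F xs))"
proof -
  have "computable 1 (\<lambda>ys. Suc (ys ! 0))"
    unfolding computable_def by (rule exI[of _ Succ]) (auto simp: length_Suc_conv intro: rec_eval.succ)
  thus ?thesis using computable_comp[of "[F]" "\<lambda>ys. Suc (ys ! 0)" n] assms by simp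
qed

lemma computable_const: "computable n (\<lambda>_. c)"
proof (induction c)
  case 0
  show ?case unfolding computable_def using rec_eval.zero by blast
qed (rule computable_Suc)

definition computable1 :: "(nat \<Rightarrow> nat) \<Rightarrow> bool" where
  "computable1 f \<longleftrightarrow> computable 1 (\<lambda>xs. f (xs ! 0))"

definition computable2 :: "(nat \<Rightarrow> nat \<Rightarrow> nat) \<Rightarrow> bool" where
  "computable2 f \<longleftrightarrow> computable 2 (\<lambda>xs. f (xs ! 0) (xs ! 1))"

lemma computable_computable1: "computable1 f \<Longrightarrow> computable n F \<Longrightarrow> computable n (\<lambda>xs. f (F xs))"
  using computable_comp[of "[F]" "\<lambda>xs. f (xs ! 0)" n] by (simp add: computable1_def)

lemma computable_computable2: "computable2 f \<Longrightarrow> computable n F \<Longrightarrow> computable n G \<Longrightarrow> computable n (\<lambda>xs. f (F xs) (G xs))"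
  using computable_comp[of "[F, G]" "\<lambda>xs. f (xs ! 0) (xs ! 1)" n] by (auto simp: computable2_def numeral_2_eq_2)

lemmas computable12_defs = computable1_def computable2_def

lemma computable2_add: "computable2 (+)"
proof -
  have "computable 2 (\<lambda>xs. rec_nat (xs ! 1) (\<lambda>m r. Suc ((m # r # xs) ! 1)) (xs ! 0))"
    by (rule computable_rec) (auto intro!: computable_nth computable_Suc)
  moreover have "rec_nat b (\<lambda>m r. Suc r) a = a + b" for a b :: nat
    by (induction a) auto
  ultimately show ?thesis by (simp add: computable12_defs)
qed

lemma computable2_mult: "computable2 (*)"
proof -
  have "computable 2 (\<lambda>xs. rec_nat 0 (\<lambda>m r. (m # r # xs) ! 1 + (m # r # xs) ! 3) (xs ! 0))"
    by (rule computable_rec) (auto intro!: computable_nth computable_computable2[OF computable2_add] computable_const)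
  moreover have "rec_nat 0 (\<lambda>m r. r + b) a = a * b" for a b :: nat
    by (induction a) auto
  ultimately show ?thesis by (simp add: computable12_defs numeral_3_eq_3)
qed

lemma computable1_pred: "computable1 (\<lambda>n. n - Suc 0)"
proof -
  have "computable 1 (\<lambda>xs. rec_nat 0 (\<lambda>m r. (m # r # xs) ! 0) (xs ! 0))"
    by (rule computable_rec) (auto intro!: computable_nth computable_const)
  moreover have "rec_nat 0 (\<lambda>m r. m) a = a - 1" for a :: nat
    by (cases a) auto
  ultimately show ?thesis by (simp add: computable12_defs)
qed

lemma computable2_diff: "computable2 (-)"
proof -
  have "computable 2 (\<lambda>xs. rec_nat (xs ! 0) (\<lambda>m r. (m # r # xs) ! 1 - 1) (xs ! 1))"
    by (rule computable_rec) (auto intro!: computable_nth computable_computable1[OF computable1_pred])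
  moreover have "rec_nat a (\<lambda>m r. r - 1) b = a - b" for a b :: nat
    by (induction b) auto
  ultimately show ?thesis by (simp add: computable12_defs)
qed

lemma computable2_power: "computable2 (\<lambda>a b. a ^ b)"
proof -
  have "computable 2 (\<lambda>xs. rec_nat 1 (\<lambda>m r. (m # r # xs) ! 1 * (m # r # xs) ! 2) (xs ! 1))"
    by (rule computable_rec) (auto intro!: computable_nth computable_computable2[OF computable2_mult] computable_const)
  moreover have "rec_nat 1 (\<lambda>m r. r * a) b = a ^ b" for a b :: nat
    by (induction b) auto
  ultimately show ?thesis by (simp add: computable12_defs)
qed

lemmas computable_arith = computable_nth computable_const computable_Suc computable_computable2[OF computable2_add] computable_computable2[OF computable2_mult] computable_computable2[OF computable2_diff]
  computable_computable2[OF computable2_power]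

lemma computable1_triangle: "computable1 triangle"
proof -
  have "computable 1 (\<lambda>xs. rec_nat 0 (\<lambda>m r. (m # r # xs) ! 1 + Suc ((m # r # xs) ! 0)) (xs ! 0))"
    by (rule computable_rec) (auto intro!: computable_arith)
  moreover have "rec_nat 0 (\<lambda>m r. r + Suc m) a = triangle a" for a :: nat
    by (induction a) auto
  ultimately show ?thesis by (simp add: computable12_defs)
qed

lemma computable1_order_mult: "computable1 order_mult"
proof -
  have "computable 1 (\<lambda>xs. rec_nat 1 (\<lambda>m r. (m # r # xs) ! 1 * (2 * (2 ^ Suc ((m # r # xs) ! 0) - 1))) (xs ! 0))"
    by (rule computable_rec) (auto intro!: computable_arith)
  moreover have "rec_nat 1 (\<lambda>m r. r * (2 * (2 ^ Suc m - 1))) a = order_mult a" for a :: nat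
    by (induction a) auto
  ultimately show ?thesis by (simp add: computable12_defs)
qed

lemma computable1_near: "computable1 near"
  unfolding near_def[abs_def] scale_def computable1_def by (auto intro!: computable_computable1[OF computable1_order_mult] computable_arith)

lemma computable1_far: "computable1 far"
  unfolding far_def[abs_def] scale_def computable1_def by (auto intro!: computable_computable1[OF computable1_order_mult] computable_arith)

lemma computable_prod_encode: "computable n F \<Longrightarrow> computable n G \<Longrightarrow> computable n (\<lambda>xs. prod_encode (F xs, G xs))"
  unfolding prod_encode_def by (auto intro!: computable_computable1[OF computable1_triangle] computable_arith)

text \<open>A family of words is treated through what it does when put in front of another family. In
  this form concatenation is composition, and no program for concatenating coded lists is
  required.\<close>

definition computable_words :: "(nat \<Rightarrow> nat word) \<Rightarrow> bool" where
  "computable_words W \<longleftrightarrow> (\<forall>U. computable1 (\<lambda>i. word_code (U i)) \<longrightarrow> computable1 (\<lambda>i. word_code (W i @ U i)))"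

lemma word_code_Cons: "word_code ((x, b) # w) = Suc (prod_encode (2 * x + of_bool b, word_code w))"
  by (simp add: word_code_def)

lemma computable_words_append: "computable_words V \<Longrightarrow> computable_words W \<Longrightarrow> computable_words (\<lambda>i. V i @ W i)"
  unfolding computable_words_def by simp

lemma computable_words_Nil: "computable_words (\<lambda>i. [])"
  unfolding computable_words_def by simp

text \<open>The code of a repeated letter followed by a word is an iteration of the code of
  \<open>Cons\<close>.\<close>

lemma computable_words_replicate:
  assumes "computable1 N"
  shows "computable_words (\<lambda>i. replicate (N i) l)"
  unfolding computable_words_def
proof (intro allI impI)
  fix U :: "nat \<Rightarrow> nat word"
  assume U: "computable1 (\<lambda>i. word_code (U i))"
  obtain x b where l: "l = (x, b)" by fastforce
  have "computable 1 (\<lambda>xs. rec_nat (word_code (U (xs ! 0)))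
      (\<lambda>m r. Suc (prod_encode (2 * x + of_bool b, (m # r # xs) ! 1))) (N (xs ! 0)))"
    by (rule computable_rec) (use assms U in \<open>auto intro!: computable_prod_encode computable_arith simp: computable12_defs\<close>)
  moreover have "rec_nat (word_code u) (\<lambda>m r. Suc (prod_encode (2 * x + of_bool b, r))) n
      = word_code (replicate n l @ u)" for u n
    by (induction n) (auto simp: l word_code_Cons)
  ultimately show "computable1 (\<lambda>i. word_code (replicate (N i) l @ U i))"
    by (simp add: computable12_defs)
qed

lemma computable_words_Cons: "computable_words W \<Longrightarrow> computable_words (\<lambda>i. l # W i)"
  using computable_words_append[OF computable_words_replicate[of "\<lambda>_. 1" l]] by (simp add: computable1_def computable_const)

lemma computable_words_imp_computable1: "computable_words W \<Longrightarrow> computable1 (\<lambda>i. word_code (W i))"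
  unfolding computable_words_def by (drule spec[of _ "\<lambda>_. []"]) (simp add: computable1_def computable_const)

text \<open>A number is the code of a word in one of the families iff the product of its distances from
  the codes of the i-th words vanishes for some i; unbounded search for i halts exactly on
  these numbers.\<close>

lemma re_set_families:
  assumes "\<And>W. W \<in> set Ws \<Longrightarrow> computable_words W"
  shows "re_set (word_code ` (\<Union>W\<in>set Ws. range W))"
proof -
  define d :: "nat \<Rightarrow> nat \<Rightarrow> nat" where "d a b = (a - b) + (b - a)" for a b
  have d: "d a b = 0 \<longleftrightarrow> a = b" for a b by (auto simp: d_def)
  define F where "F xs = prod_list (map (\<lambda>W. d (xs ! 1) (word_code (W (xs ! 0)))) Ws)" for xs :: "nat list"
  have F0: "F [i, x] = 0 \<longleftrightarrow> (\<exists>W\<in>set Ws. x = word_code (W i))" for i x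
    unfolding F_def by (induction Ws) (auto simp: d)
  have "computable 2 F"
    unfolding F_def using assms
  proof (induction Ws)
    case (Cons W Ws)
    have "computable 2 (\<lambda>xs. word_code (W (xs ! 0)))"
      by (rule computable_computable1[OF computable_words_imp_computable1]) (use Cons.prems in \<open>auto intro: computable_nth\<close>)
    moreover have "computable 2 (\<lambda>xs. prod_list (map (\<lambda>W. d (xs ! 1) (word_code (W (xs ! 0)))) Ws))"
      by (rule Cons.IH) (use Cons.prems in auto)
    ultimately show ?case
      unfolding d_def list.map prod_list.Cons by (intro computable_arith) auto
  qed (simp add: computable_const)
  then obtain p where p: "\<And>i x. rec_eval p [i, x] (F [i, x])"
    unfolding computable_def by (metis length_Cons list.size(3) numeral_2_eq_2)
  have "x \<in> word_code ` (\<Union>W\<in>set Ws. range W) \<longleftrightarrow> (\<exists>y. rec_eval (Mu p) [x] y)" for x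
  proof
    assume "x \<in> word_code ` (\<Union>W\<in>set Ws. range W)"
    hence ex: "\<exists>i. F [i, x] = 0" using F0 by auto
    define i where "i = (LEAST i. F [i, x] = 0)"
    have "F [i, x] = 0" unfolding i_def using ex by (rule LeastI_ex)
    moreover have "F [m, x] \<noteq> 0" if "m < i" for m
      using that not_less_Least unfolding i_def by blast
    ultimately have "rec_eval (Mu p) [x] i"
      using p by (intro rec_eval.mu) (metis, metis not0_implies_Suc)
    thus "\<exists>y. rec_eval (Mu p) [x] y" ..
  next
    assume "\<exists>y. rec_eval (Mu p) [x] y"
    then obtain y where "rec_eval (Mu p) [x] y" ..
    hence "rec_eval p [y, x] 0" by (cases rule: rec_eval.cases) auto
    with p[of y x] have "F [y, x] = 0" using rec_eval_det by metis
    thus "x \<in> word_code ` (\<Union>W\<in>set Ws. range W)" using F0 by auto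
  qed
  thus ?thesis unfolding re_set_def by (intro exI[of _ "Mu p"]) blast
qed

section \<open>Free groups and von Dyck's theorem\<close>

lemma append_in_words [simp]: "u @ v \<in> words Y \<longleftrightarrow> u \<in> words Y \<and> v \<in> words Y"
  by (simp add: words_def)

lemma Cons_in_words [simp]: "(x, b) # v \<in> words Y \<longleftrightarrow> x \<in> Y \<and> v \<in> words Y"
  by (auto simp: words_def)

lemma Nil_in_words [simp]: "[] \<in> words Y"
  by (simp add: words_def)

lemma equivclp_map:
  assumes "equivclp r x y" "\<And>x y. r x y \<Longrightarrow> s (f x) (f y)"
  shows "equivclp s (f x) (f y)"
  using assms(1)
proof (induction rule: equivclp_induct)
  case (step y z)
  hence "s (f y) (f z) \<or> s (f z) (f y)" using assms(2) by auto
  hence "equivclp s (f y) (f z)"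
    by (elim disjE) (rule r_into_equivclp, assumption, rule equivclp_sym, rule r_into_equivclp)
  with step.IH show ?case by (rule equivclp_trans)
qed simp

lemma free_cancel_append:
  assumes "free_cancel Y u v" "w \<in> words Y"
  shows "free_cancel Y (w @ u) (w @ v)" "free_cancel Y (u @ w) (v @ w)"
proof -
  from assms(1) obtain u' v' x b where *: "u = u' @ (x, b) # (x, \<not> b) # v'" "v = u' @ v'"
      "u' \<in> words Y" "v' \<in> words Y" "x \<in> Y"
    by cases
  show "free_cancel Y (w @ u) (w @ v)"
    using free_cancel.intros[of "w @ u'" Y v' x b] * assms(2) by simp
  show "free_cancel Y (u @ w) (v @ w)"
    using free_cancel.intros[of u' Y "v' @ w" x b] * assms(2) by simp
qed

abbreviation fcls :: "'a set \<Rightarrow> 'a word \<Rightarrow> 'a word set" where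
  "fcls Y w \<equiv> free_rel Y `` {w}"

lemma equiv_free_rel: "equiv (words Y) (free_rel Y)"
proof (rule equivI)
  show "sym (free_rel Y)"
    by (rule symI) (simp add: free_rel_def equivclp_sym)
  show "trans (free_rel Y)"
    by (rule transI) (simp add: free_rel_def, blast intro: equivclp_trans)
qed (auto simp: free_rel_def refl_on_def)

lemma fcls_eq_iff: "u \<in> words Y \<Longrightarrow> v \<in> words Y \<Longrightarrow> fcls Y u = fcls Y v \<longleftrightarrow> equivclp (free_cancel Y) u v"
  by (subst eq_equiv_class_iff[OF equiv_free_rel]) (simp_all add: free_rel_def)

lemma free_rel_append:
  assumes "(u, u') \<in> free_rel Y" "(v, v') \<in> free_rel Y"
  shows "(u @ v, u' @ v') \<in> free_rel Y"
proof -
  have w: "u \<in> words Y" "u' \<in> words Y" "v \<in> words Y" "v' \<in> words Y"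
    using assms by (auto simp: free_rel_def)
  have "equivclp (free_cancel Y) (u @ v) (u' @ v)"
    by (rule equivclp_map[where r = "free_cancel Y" and f = "\<lambda>u. u @ v"])
       (use assms w in \<open>simp_all add: free_rel_def free_cancel_append\<close>)
  moreover have "equivclp (free_cancel Y) (u' @ v) (u' @ v')"
    by (rule equivclp_map[where r = "free_cancel Y" and f = "\<lambda>v. u' @ v"])
       (use assms w in \<open>simp_all add: free_rel_def free_cancel_append\<close>)
  ultimately show ?thesis
    using w equivclp_trans[of "free_cancel Y" "u @ v"] by (simp add: free_rel_def)
qed

lemma carrier_free_group: "carrier (free_group Y) = fcls Y ` words Y"
  by (auto simp: free_group_def quotient_def)

lemma one_free_group: "\<one>\<^bsub>free_group Y\<^esub> = fcls Y []"
  by (simp add: free_group_def)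

lemma mult_free_group:
  assumes "u \<in> words Y" "v \<in> words Y"
  shows "fcls Y u \<otimes>\<^bsub>free_group Y\<^esub> fcls Y v = fcls Y (u @ v)"
proof -
  have "fcls Y (u' @ v') = fcls Y (u @ v)" if "u' \<in> fcls Y u" "v' \<in> fcls Y v" for u' v'
  proof -
    have "(u @ v, u' @ v') \<in> free_rel Y"
      using that by (intro free_rel_append) auto
    thus ?thesis
      using equiv_class_eq[OF equiv_free_rel] by metis
  qed
  hence "(\<Union>u'\<in>fcls Y u. \<Union>v'\<in>fcls Y v. fcls Y (u' @ v')) = (\<Union>u'\<in>fcls Y u. \<Union>v'\<in>fcls Y v. fcls Y (u @ v))"
    by (intro SUP_cong refl)
  moreover have "fcls Y u \<noteq> {}" "fcls Y v \<noteq> {}"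
    using equiv_class_self[OF equiv_free_rel] assms by blast+
  ultimately show ?thesis
    by (simp add: free_group_def)
qed

definition inv_word :: "'a word \<Rightarrow> 'a word" where
  "inv_word w = rev (map (\<lambda>(x, b). (x, \<not> b)) w)"

lemma inv_word_in_words [simp]: "w \<in> words Y \<Longrightarrow> inv_word w \<in> words Y"
  by (auto simp: words_def inv_word_def lists_eq_set)

text \<open>Letters cancel from the middle outwards.\<close>

lemma fcls_inv_word: "w \<in> words Y \<Longrightarrow> fcls Y (inv_word w @ w) = fcls Y []"
proof (induction w)
  case (Cons l w)
  obtain x b where l: "l = (x, b)" by fastforce
  have w: "x \<in> Y" "w \<in> words Y" using Cons.prems l by auto
  have "free_cancel Y (inv_word w @ (x, \<not> b) # (x, \<not> (\<not> b)) # w) (inv_word w @ w)"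
    using w by (intro free_cancel.intros) auto
  hence "fcls Y (inv_word (l # w) @ l # w) = fcls Y (inv_word w @ w)"
    using w by (subst fcls_eq_iff) (auto simp: l inv_word_def[of "_ # _"] simp flip: inv_word_def)
  thus ?case using Cons.IH w by simp
qed (simp add: inv_word_def)

lemma group_free_group: "group (free_group Y)"
proof (rule groupI)
  fix a assume "a \<in> carrier (free_group Y)"
  then obtain w where w: "w \<in> words Y" "a = fcls Y w" by (auto simp: carrier_free_group)
  show "\<exists>b\<in>carrier (free_group Y). b \<otimes>\<^bsub>free_group Y\<^esub> a = \<one>\<^bsub>free_group Y\<^esub>"
    by (rule bexI[of _ "fcls Y (inv_word w)"])
       (use w in \<open>auto simp: carrier_free_group mult_free_group one_free_group fcls_inv_word\<close>)
qed (auto simp: carrier_free_group mult_free_group one_free_group)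

primrec eval_word :: "('b, 'c) monoid_scheme \<Rightarrow> ('a \<Rightarrow> 'b) \<Rightarrow> 'a word \<Rightarrow> 'b" where
  "eval_word H f [] = \<one>\<^bsub>H\<^esub>"
| "eval_word H f (l # w) = (if snd l then f (fst l) else inv\<^bsub>H\<^esub> f (fst l)) \<otimes>\<^bsub>H\<^esub> eval_word H f w"

context group
begin

lemma eval_word_closed [simp]: "f \<in> Y \<rightarrow> carrier G \<Longrightarrow> w \<in> words Y \<Longrightarrow> eval_word G f w \<in> carrier G"
proof (induction w)
  case (Cons l w)
  obtain x b where l: "l = (x, b)" by fastforce
  have "x \<in> Y" "w \<in> words Y" using Cons.prems l by auto
  moreover from this have "f x \<in> carrier G" using Cons.prems by auto
  ultimately show ?case using Cons by (simp add: l)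
qed simp

lemma eval_word_append:
  "f \<in> Y \<rightarrow> carrier G \<Longrightarrow> u \<in> words Y \<Longrightarrow> v \<in> words Y \<Longrightarrow> eval_word G f (u @ v) = eval_word G f u \<otimes> eval_word G f v"
proof (induction u)
  case (Cons l u)
  obtain x b where l: "l = (x, b)" by fastforce
  have "x \<in> Y" "u \<in> words Y" using Cons.prems l by auto
  moreover from this have "f x \<in> carrier G" using Cons.prems by auto
  ultimately show ?case using Cons by (simp add: l m_assoc)
qed simp

lemma eval_word_free_cancel:
  assumes "f \<in> Y \<rightarrow> carrier G" "free_cancel Y u v"
  shows "eval_word G f u = eval_word G f v"
  using assms(2)
proof cases
  case (1 u' v' x b)
  have "f x \<in> carrier G" using assms 1 by auto
  moreover have "eval_word G f v' \<in> carrier G" using assms 1 by auto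
  ultimately have "eval_word G f ((x, b) # (x, \<not> b) # v') = eval_word G f v'"
    by (simp flip: m_assoc)
  thus ?thesis using 1 assms(1)
    by (simp only: eval_word_append[where Y = Y] Cons_in_words)
qed

lemma eval_word_fcls_eq:
  assumes "f \<in> Y \<rightarrow> carrier G" "(u, v) \<in> free_rel Y"
  shows "eval_word G f u = eval_word G f v"
proof -
  have "equivclp (free_cancel Y) u v" using assms by (simp add: free_rel_def)
  thus ?thesis
    by (induction rule: equivclp_induct) (use eval_word_free_cancel[OF assms(1)] in auto)
qed

text \<open>The universal property of the free group.\<close>

lemma ex_free_hom:
  assumes f: "f \<in> Y \<rightarrow> carrier G"
  obtains h where "h \<in> hom (free_group Y) G" "\<And>w. w \<in> words Y \<Longrightarrow> h (fcls Y w) = eval_word G f w"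
proof -
  define h where "h A = eval_word G f (SOME w. w \<in> A)" for A
  have h: "h (fcls Y w) = eval_word G f w" if "w \<in> words Y" for w
  proof -
    have "w \<in> fcls Y w" using that by (auto simp: free_rel_def)
    hence "(SOME w'. w' \<in> fcls Y w) \<in> fcls Y w" by (rule someI)
    thus ?thesis unfolding h_def using eval_word_fcls_eq[OF f] by auto
  qed
  moreover have "h \<in> hom (free_group Y) G"
    by (rule homI) (use f in \<open>auto simp: carrier_free_group h mult_free_group eval_word_append\<close>)
  ultimately show ?thesis using that by blast
qed

lemma generate_subset_eval_word:
  assumes f: "f \<in> Y \<rightarrow> carrier G"
  shows "generate G (f ` Y) \<subseteq> eval_word G f ` words Y"
proof
  fix g assume "g \<in> generate G (f ` Y)"
  thus "g \<in> eval_word G f ` words Y"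
  proof induction
    case one
    thus ?case by (intro image_eqI[of _ _ "[]"]) auto
  next
    case (incl g)
    then obtain x where "x \<in> Y" "g = f x" by auto
    moreover from this have "f x \<in> carrier G" using f by auto
    ultimately show ?case by (intro image_eqI[of _ _ "[(x, True)]"]) auto
  next
    case (inv g)
    then obtain x where "x \<in> Y" "g = f x" by auto
    moreover from this have "f x \<in> carrier G" using f by auto
    ultimately show ?case by (intro image_eqI[of _ _ "[(x, False)]"]) auto
  next
    case (eng g h)
    then obtain u v where "u \<in> words Y" "v \<in> words Y" "g = eval_word G f u" "h = eval_word G f v" by auto
    thus ?case using f by (intro image_eqI[of _ _ "u @ v"]) (auto simp: eval_word_append)
  qed
qed

end

text \<open>Von Dyck's theorem in the form needed here: a group generated by elements that satisfy the
  relators is presented by them as soon as every word that is trivial in it is trivial in all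
  groups that satisfy the relators. The groups to be tested are the quotients of the free
  group by normal subgroups containing the relators, which fixes the type of \<open>P\<close>.\<close>

theorem presented_group_iso:
  fixes H :: "('b, 'c) monoid_scheme" and Y :: "'a set"
  assumes "group H" and f: "f \<in> Y \<rightarrow> carrier H" and generated: "generate H (f ` Y) = carrier H"
    and R: "R \<subseteq> words Y" and rel: "\<And>r. r \<in> R \<Longrightarrow> eval_word H f r = \<one>\<^bsub>H\<^esub>"
    and univ: "\<And>(P :: 'a word set set monoid) p w. group P \<Longrightarrow> p \<in> Y \<rightarrow> carrier P \<Longrightarrow>
       (\<And>r. r \<in> R \<Longrightarrow> eval_word P p r = \<one>\<^bsub>P\<^esub>) \<Longrightarrow> w \<in> words Y \<Longrightarrow> eval_word H f w = \<one>\<^bsub>H\<^esub> \<Longrightarrow>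
       eval_word P p w = \<one>\<^bsub>P\<^esub>"
  shows "H \<cong> presented_group Y R"
proof -
  let ?F = "free_group Y"
  interpret H: group H by fact
  interpret F: group ?F by (rule group_free_group)
  obtain h where h: "h \<in> hom ?F H" "\<And>w. w \<in> words Y \<Longrightarrow> h (fcls Y w) = eval_word H f w"
    by (rule H.ex_free_hom[OF f], rule that)
  interpret h: group_hom ?F H h
    by (intro group_hom.intro group_hom_axioms.intro F.is_group H.is_group h(1))
  have surj: "h ` carrier ?F = carrier H"
  proof
    show "carrier H \<subseteq> h ` carrier ?F"
    proof
      fix g assume "g \<in> carrier H"
      then obtain w where "w \<in> words Y" "g = eval_word H f w"
        using H.generate_subset_eval_word[OF f] generated by auto
      thus "g \<in> h ` carrier ?F"
        by (intro image_eqI[of _ _ "fcls Y w"]) (simp_all add: h(2) carrier_free_group)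
    qed
  qed auto
  let ?K = "kernel ?F H h"
  \<comment> \<open>The relators lie in the kernel. Conversely, an element of the kernel is trivial modulo
    each competing normal subgroup.\<close>
  have "normal_closure ?F (fcls Y ` R) = ?K"
  proof
    have "?K \<lhd> ?F" by (rule h.normal_kernel)
    moreover have "fcls Y ` R \<subseteq> ?K"
      using R rel h by (auto simp: kernel_def carrier_free_group)
    ultimately show "normal_closure ?F (fcls Y ` R) \<subseteq> ?K"
      unfolding normal_closure_def by blast
    show "?K \<subseteq> normal_closure ?F (fcls Y ` R)"
      unfolding normal_closure_def
    proof (rule Inter_greatest, clarify)
      fix N a
      assume N: "N \<lhd> ?F" "fcls Y ` R \<subseteq> N" and a: "a \<in> ?K"
      from a obtain w where w: "w \<in> words Y" "a = fcls Y w" "eval_word H f w = \<one>\<^bsub>H\<^esub>"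
        using h(2) by (auto simp: kernel_def carrier_free_group)
      interpret N: normal N ?F by (rule N(1))
      interpret P: group "?F Mod N" by (rule N.factorgroup_is_group)
      define p where "p x = N #>\<^bsub>?F\<^esub> fcls Y [(x, True)]" for x
      have c: "fcls Y u \<in> carrier ?F" if "u \<in> words Y" for u
        using that by (auto simp: carrier_free_group)
      have cN: "N #>\<^bsub>?F\<^esub> fcls Y u \<in> carrier (?F Mod N)" if "u \<in> words Y" for u
        using c[OF that] by (simp add: carrier_FactGroup)
      have p: "p \<in> Y \<rightarrow> carrier (?F Mod N)"
        unfolding p_def by (intro Pi_I cN) simp
      have wev_p: "eval_word (?F Mod N) p v = N #>\<^bsub>?F\<^esub> fcls Y v" if "v \<in> words Y" for v
        using that
      proof (induction v)
        case Nil
        have "N #>\<^bsub>?F\<^esub> \<one>\<^bsub>?F\<^esub> = N"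
          by (rule F.coset_mult_one[OF N.subset])
        thus ?case by (simp add: one_free_group)
      next
        case (Cons l v)
        obtain x b where l: "l = (x, b)" by fastforce
        have v: "x \<in> Y" "v \<in> words Y" using Cons.prems l by auto
        have "inv\<^bsub>?F\<^esub> fcls Y [(x, True)] = fcls Y (inv_word [(x, True)])"
          by (rule F.inv_equality)
             (use v in \<open>auto simp: mult_free_group fcls_inv_word one_free_group c\<close>)
        hence "inv\<^bsub>?F Mod N\<^esub> p x = N #>\<^bsub>?F\<^esub> fcls Y [(x, False)]"
          unfolding p_def using v
          by (subst N.inv_FactGroup) (simp_all add: cN N.rcos_inv c inv_word_def)
        hence "(if b then p x else inv\<^bsub>?F Mod N\<^esub> p x) = N #>\<^bsub>?F\<^esub> fcls Y [(x, b)]"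
          by (simp add: p_def)
        hence "eval_word (?F Mod N) p (l # v) =
            (N #>\<^bsub>?F\<^esub> fcls Y [(x, b)]) <#>\<^bsub>?F\<^esub> (N #>\<^bsub>?F\<^esub> fcls Y v)"
          using Cons.IH v by (simp only: l eval_word.simps fst_conv snd_conv mult_FactGroup)
        also have "\<dots> = N #>\<^bsub>?F\<^esub> (fcls Y [(x, b)] \<otimes>\<^bsub>?F\<^esub> fcls Y v)"
          using v by (intro N.rcos_sum c) auto
        finally show ?case
          using v by (simp add: l mult_free_group)
      qed
      have "eval_word (?F Mod N) p r = \<one>\<^bsub>?F Mod N\<^esub>" if "r \<in> R" for r
      proof -
        have "fcls Y r \<in> N" using N(2) that by auto
        hence "N #>\<^bsub>?F\<^esub> fcls Y r = N"
          using F.coset_join2 N.subset N.subgroup_axioms by (metis N.mem_carrier)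
        thus ?thesis using wev_p R that by auto
      qed
      from univ[OF P.is_group p this w(1,3)] have "N #>\<^bsub>?F\<^esub> a = N"
        using wev_p[OF w(1)] w(2) by simp
      thus "a \<in> N"
        using F.coset_join1[OF _ _ N.subgroup_axioms] a
        by (auto simp: kernel_def)
    qed
  qed
  hence "presented_group Y R \<cong> H"
    unfolding presented_group_def using h.FactGroup_iso[OF surj] by simp
  moreover have "group (presented_group Y R)"
    unfolding presented_group_def
    using \<open>normal_closure _ _ = ?K\<close> h.normal_kernel normal.factorgroup_is_group by metis
  ultimately show ?thesis using group.iso_sym by blast
qed

section \<open>A normal form from the relations\<close>

lemma lookup_sum_list_tpow:
  "coef (sum_list (map tpow ks)) j = of_nat (count_list ks j)"
  by (induction ks) (auto simp: lookup_add lookup_tpow)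

lemma sum_list_tpow_eq_0_iff: "sum_list (map tpow ks) = 0 \<longleftrightarrow> (\<forall>j. even (count_list ks j))"
proof -
  have "(of_nat n :: bit) = 0 \<longleftrightarrow> even n" for n
    by (induction n) (auto simp: add_bit_eq_xor)
  thus ?thesis
    by (simp add: poly_mapping_eq_iff fun_eq_iff lookup_sum_list_tpow)
qed

context group
begin

text \<open>The factors below commute, but they live in a noncommutative group, so products are taken
  along lists. Lists with repetitions also spare any reduction modulo 2 during rewriting.\<close>

definition lprod :: "(int \<Rightarrow> 'a) \<Rightarrow> int list \<Rightarrow> 'a" where
  "lprod u ks = foldr (\<lambda>i g. u i \<otimes> g) ks \<one>"

lemma lprod_Nil [simp]: "lprod u [] = \<one>"
  and lprod_Cons [simp]: "lprod u (k # ks) = u k \<otimes> lprod u ks"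
  by (simp_all add: lprod_def)

lemma lprod_closed [simp]: "(\<And>k. u k \<in> carrier G) \<Longrightarrow> lprod u ks \<in> carrier G"
  by (induction ks) auto

lemma lprod_append: "(\<And>k. u k \<in> carrier G) \<Longrightarrow> lprod u (ks @ ls) = lprod u ks \<otimes> lprod u ls"
  by (induction ks) (auto simp: m_assoc)

lemma lprod_commute:
  assumes "\<And>k. u k \<in> carrier G" "g \<in> carrier G" "\<And>k. g \<otimes> u k = u k \<otimes> g"
  shows "g \<otimes> lprod u ks = lprod u ks \<otimes> g"
proof (induction ks)
  case (Cons k ks)
  have "g \<otimes> (u k \<otimes> lprod u ks) = u k \<otimes> (g \<otimes> lprod u ks)"
    using assms by (simp flip: m_assoc)
  thus ?case using Cons assms by (simp add: m_assoc)
qed (use assms in auto)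

text \<open>Two equal factors can be moved next to each other, where they cancel.\<close>

lemma lprod_even:
  assumes u: "\<And>k. u k \<in> carrier G" "\<And>k l. u k \<otimes> u l = u l \<otimes> u k" "\<And>k. u k \<otimes> u k = \<one>"
    and even: "\<And>k. even (count_list ks k)"
  shows "lprod u ks = \<one>"
  using even
proof (induction ks rule: length_induct)
  case (1 ks)
  show ?case
  proof (cases ks)
    case (Cons k ls)
    have "odd (count_list ls k)" using "1.prems"[of k] Cons by simp
    hence "k \<in> set ls" by (metis count_notin even_zero)
    then obtain as bs where ls: "ls = as @ k # bs" by (auto simp: in_set_conv_decomp)
    have "even (count_list (as @ bs) j)" for j
      using "1.prems"[of j] Cons ls by (auto split: if_splits)
    moreover have "length (as @ bs) < length ks" using Cons ls by simp
    ultimately have IH: "lprod u (as @ bs) = \<one>" using "1.IH" by blast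
    have "u k \<otimes> lprod u as = lprod u as \<otimes> u k"
      by (rule lprod_commute) (use u in auto)
    have "lprod u ks = (u k \<otimes> lprod u as) \<otimes> (u k \<otimes> lprod u bs)"
      using u(1) by (simp add: Cons ls lprod_append m_assoc)
    also have "\<dots> = lprod u as \<otimes> ((u k \<otimes> u k) \<otimes> lprod u bs)"
      unfolding \<open>u k \<otimes> lprod u as = _\<close> using u(1) by (simp add: m_assoc)
    also have "\<dots> = lprod u (as @ bs)"
      using u(1,3) by (simp add: lprod_append)
    finally show ?thesis using IH by simp
  qed simp
qed

end

text \<open>An arbitrary group in which the defining relations hold. A conjugate of \<open>x\<close> or
  \<open>y\<close> is required to commute with the letter only when the conjugating exponent
  has one sign; conjugation by \<open>t\<close> yields the rest. Likewise \<open>z k\<close>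
  is a commutator with \<open>y\<close> itself, and the other commutators follow from its
  centrality.\<close>

locale hall_relations = group P for P (structure) +
  fixes x y t
  assumes closed [simp]: "x \<in> carrier P" "y \<in> carrier P" "t \<in> carrier P"
  fixes T x' y' z
  defines "T \<equiv> \<lambda>k::int. t [^] k"
    and "x' \<equiv> \<lambda>k. T (- k) \<otimes> (x \<otimes> T k)"
    and "y' \<equiv> \<lambda>k. T k \<otimes> (y \<otimes> T (- k))"
    and "z \<equiv> \<lambda>k. x' k \<otimes> (y \<otimes> (x' k \<otimes> y))"
  assumes xx [simp]: "x \<otimes> x = \<one>" and yy [simp]: "y \<otimes> y = \<one>"
    and xx_comm: "\<And>n::nat. x \<otimes> x' (int n) = x' (int n) \<otimes> x"
    and yy_comm: "\<And>n::nat. y \<otimes> y' (- int n) = y' (- int n) \<otimes> y"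
    and z_x: "\<And>k. z k \<otimes> x = x \<otimes> z k"
    and z_y: "\<And>k. z k \<otimes> y = y \<otimes> z k"
    and z_t: "\<And>k. z k \<otimes> t = t \<otimes> z k"
    and z_near: "\<And>s. z (int (far s)) = z (int (near s))"
begin

lemma T_closed [simp]: "T k \<in> carrier P" by (simp add: T_def)
lemma x'_closed [simp]: "x' k \<in> carrier P" by (simp add: x'_def)
lemma y'_closed [simp]: "y' k \<in> carrier P" by (simp add: y'_def)
lemma z_closed [simp]: "z k \<in> carrier P" by (simp add: z_def)

lemma T_0 [simp]: "T 0 = \<one>" by (simp add: T_def)
lemma T_1: "T 1 = t" by (simp add: T_def)
lemma T_add [simp]: "T k \<otimes> T l = T (k + l)" by (simp add: T_def int_pow_mult)
lemma T_add' [simp]: "g \<in> carrier P \<Longrightarrow> T k \<otimes> (T l \<otimes> g) = T (k + l) \<otimes> g"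
  by (simp flip: m_assoc)
lemma xx' [simp]: "g \<in> carrier P \<Longrightarrow> x \<otimes> (x \<otimes> g) = g"
  by (simp flip: m_assoc)
lemma yy' [simp]: "g \<in> carrier P \<Longrightarrow> y \<otimes> (y \<otimes> g) = g"
  by (simp flip: m_assoc)

lemma inv_x: "inv x = x" by (rule inv_equality) auto
lemma inv_y: "inv y = y" by (rule inv_equality) auto

lemma x'_T: "x' i \<otimes> T k = T k \<otimes> x' (i + k)"
  by (simp add: x'_def m_assoc)

lemma T_y: "T k \<otimes> y = y' k \<otimes> T k"
  by (simp add: y'_def m_assoc)

lemma x'_0: "x' 0 = x" by (simp add: x'_def)
lemma x'_invol: "x' i \<otimes> x' i = \<one>" by (simp add: x'_def m_assoc)
lemma y'_invol: "y' i \<otimes> y' i = \<one>" by (simp add: y'_def m_assoc)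

lemma conjugates_commute:
  assumes [simp]: "g \<in> carrier P"
    and comm: "\<And>n. g \<otimes> (T (- int n) \<otimes> (g \<otimes> T (int n))) = T (- int n) \<otimes> (g \<otimes> T (int n)) \<otimes> g"
  defines "u \<equiv> \<lambda>k. T (- k) \<otimes> (g \<otimes> T k)"
  shows "u i \<otimes> u j = u j \<otimes> u i"
proof -
  have *: "u i \<otimes> u (i + int m) = u (i + int m) \<otimes> u i" for i m
  proof -
    have "u i \<otimes> u (i + int m) = T (- i) \<otimes> ((g \<otimes> u (int m)) \<otimes> T i)"
      by (simp add: u_def m_assoc add.commute)
    also have "\<dots> = u (i + int m) \<otimes> u i"
      unfolding u_def comm by (simp add: m_assoc add.commute)
    finally show ?thesis .
  qed
  show ?thesis
    using *[of i "nat (j - i)"] *[of j "nat (i - j)"] by (cases "i \<le> j") simp_all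
qed

lemma x'_comm: "x' i \<otimes> x' j = x' j \<otimes> x' i"
  using conjugates_commute[of x i j] xx_comm by (simp add: x'_def)

lemma y'_comm: "y' i \<otimes> y' j = y' j \<otimes> y' i"
  using conjugates_commute[of y "- i" "- j"] yy_comm by (simp add: y'_def)

lemma commute_mult:
  assumes "c \<in> carrier P" "g \<in> carrier P" "h \<in> carrier P" "c \<otimes> g = g \<otimes> c" "c \<otimes> h = h \<otimes> c"
  shows "c \<otimes> (g \<otimes> h) = (g \<otimes> h) \<otimes> c"
proof -
  have "c \<otimes> (g \<otimes> h) = (c \<otimes> g) \<otimes> h" using assms(1-3) by (simp add: m_assoc)
  also have "\<dots> = g \<otimes> (c \<otimes> h)" unfolding assms(4) using assms(1-3) by (simp add: m_assoc)
  also have "\<dots> = (g \<otimes> h) \<otimes> c" unfolding assms(5) using assms(1-3) by (simp add: m_assoc)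
  finally show ?thesis .
qed

lemma z_T: "z k \<otimes> T l = T l \<otimes> z k"
proof -
  have nat: "z k \<otimes> T (int n) = T (int n) \<otimes> z k" for n
  proof (induction n)
    case (Suc n)
    have "T (int (Suc n)) = t \<otimes> T (int n)" by (simp flip: T_1)
    thus ?case using commute_mult[OF _ _ _ z_t Suc] by simp
  qed simp
  show ?thesis
  proof (cases "l \<ge> 0")
    case True
    thus ?thesis using nat[of "nat l"] by simp
  next
    case False
    hence "z k \<otimes> T (- l) = T (- l) \<otimes> z k" using nat[of "nat (- l)"] by simp
    hence "T l \<otimes> (z k \<otimes> T (- l)) \<otimes> T l = T l \<otimes> (T (- l) \<otimes> z k) \<otimes> T l" by simp
    thus ?thesis by (simp add: m_assoc)
  qed
qed

lemma z_x': "z k \<otimes> x' i = x' i \<otimes> z k"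
  unfolding x'_def by (intro commute_mult z_T z_x) simp_all

lemma z_y': "z k \<otimes> y' i = y' i \<otimes> z k"
  unfolding y'_def by (intro commute_mult z_T z_y) simp_all

lemma z_comm: "z k \<otimes> z l = z l \<otimes> z k"
proof -
  have l: "z l = x' l \<otimes> (y \<otimes> (x' l \<otimes> y))" by (simp add: z_def)
  show ?thesis unfolding l by (intro commute_mult z_x' z_y) simp_all
qed

lemma x'_y: "x' i \<otimes> y = z i \<otimes> (y \<otimes> x' i)"
proof -
  have "z i \<otimes> (y \<otimes> x' i) = x' i \<otimes> (y \<otimes> (x' i \<otimes> x' i))"
    by (simp add: z_def m_assoc)
  thus ?thesis by (simp add: x'_invol)
qed

text \<open>Since \<open>x' i\<close> is an involution, moving it twice across \<open>y\<close> changes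
  nothing, but creates the central factor \<open>z i\<close> twice.\<close>

lemma z_invol: "z i \<otimes> z i = \<one>"
proof -
  have "y = x' i \<otimes> x' i \<otimes> y" by (simp add: x'_invol)
  also have "\<dots> = x' i \<otimes> (z i \<otimes> (y \<otimes> x' i))"
    by (simp add: m_assoc x'_y)
  also have "\<dots> = (x' i \<otimes> z i) \<otimes> (y \<otimes> x' i)"
    by (simp add: m_assoc)
  also have "\<dots> = z i \<otimes> (x' i \<otimes> y \<otimes> x' i)"
    by (subst z_x' [symmetric]) (simp add: m_assoc)
  also have "\<dots> = z i \<otimes> z i \<otimes> y \<otimes> (x' i \<otimes> x' i)"
    by (simp add: x'_y m_assoc)
  finally have "\<one> \<otimes> y = z i \<otimes> z i \<otimes> y" by (simp add: x'_invol)
  thus ?thesis by (simp only: right_cancel closed m_closed one_closed z_closed)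
qed

lemma z_phi: "z (\<phi> k) = z k"
  by (cases "k \<in> int ` range far") (auto simp: z_near \<phi>_other)

lemma lprod_z_phi: "lprod z (map \<phi> ks) = lprod z ks"
  by (induction ks) (simp_all add: z_phi)

lemma lprod_x'_T: "lprod x' as \<otimes> T k = T k \<otimes> lprod x' (map (\<lambda>i. i + k) as)"
proof (induction as)
  case (Cons i as)
  have "x' i \<otimes> (lprod x' as \<otimes> T k) = (x' i \<otimes> T k) \<otimes> lprod x' (map (\<lambda>i. i + k) as)"
    unfolding Cons by (simp add: m_assoc)
  thus ?case by (simp add: x'_T m_assoc)
qed simp

lemma lprod_x'_y: "lprod x' as \<otimes> y = lprod z as \<otimes> (y \<otimes> lprod x' as)"
proof (induction as)
  case (Cons i as)
  have "x' i \<otimes> (lprod x' as \<otimes> y) = (x' i \<otimes> lprod z as) \<otimes> (y \<otimes> lprod x' as)"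
    unfolding Cons by (simp add: m_assoc)
  also have "x' i \<otimes> lprod z as = lprod z as \<otimes> x' i"
    by (rule lprod_commute) (simp_all add: z_x')
  also have "\<dots> \<otimes> (y \<otimes> lprod x' as) = lprod z as \<otimes> ((x' i \<otimes> y) \<otimes> lprod x' as)"
    by (simp add: m_assoc)
  also have "\<dots> = (lprod z as \<otimes> z i) \<otimes> (y \<otimes> (x' i \<otimes> lprod x' as))"
    by (simp add: x'_y m_assoc)
  also have "lprod z as \<otimes> z i = z i \<otimes> lprod z as"
    by (rule lprod_commute [symmetric]) (simp_all add: z_comm)
  finally show ?case by (simp add: m_assoc)
qed simp

text \<open>The order of the factors is the one in which the matrix with entries \<open>k, a, b,
  c\<close> is the product of its four parts: centre, \<open>b\<close>, power of
  \<open>t\<close>, \<open>a\<close>.\<close>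

definition normal_word :: "int list \<Rightarrow> int list \<Rightarrow> int \<Rightarrow> int list \<Rightarrow> 'a" where
  "normal_word cs bs k as = lprod z cs \<otimes> (lprod y' bs \<otimes> (T k \<otimes> lprod x' as))"

lemma normal_word_closed [simp]: "normal_word cs bs k as \<in> carrier P"
  by (simp add: normal_word_def)

lemma normal_word_x: "normal_word cs bs k as \<otimes> x = normal_word cs bs k (as @ [0])"
  by (simp add: normal_word_def m_assoc lprod_append x'_0)

lemma normal_word_T: "normal_word cs bs k as \<otimes> T l = normal_word cs bs (k + l) (map (\<lambda>i. i + l) as)"
  by (simp add: normal_word_def m_assoc lprod_x'_T)

text \<open>Moving \<open>y\<close> to the left past the conjugates of \<open>x\<close> creates one
  central factor for each of them; moving it past \<open>t^k\<close> turns it into \<open>y'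
  k\<close>.\<close>

lemma normal_word_y: "normal_word cs bs k as \<otimes> y = normal_word (cs @ as) (bs @ [k]) k as"
proof -
  have 1: "T k \<otimes> lprod z as = lprod z as \<otimes> T k"
    by (rule lprod_commute) (simp_all add: z_T)
  have 2: "lprod y' bs \<otimes> lprod z as = lprod z as \<otimes> lprod y' bs"
  proof (rule lprod_commute)
    fix k show "lprod y' bs \<otimes> z k = z k \<otimes> lprod y' bs"
      by (rule lprod_commute [symmetric]) (simp_all add: z_y')
  qed simp_all
  have "normal_word cs bs k as \<otimes> y = lprod z cs \<otimes> (lprod y' bs \<otimes> (T k \<otimes> lprod z as) \<otimes> (y \<otimes> lprod x' as))"
    by (simp add: normal_word_def m_assoc lprod_x'_y)
  also have "lprod y' bs \<otimes> (T k \<otimes> lprod z as) = lprod y' bs \<otimes> lprod z as \<otimes> T k"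
    unfolding 1 by (simp add: m_assoc)
  also have "\<dots> = lprod z as \<otimes> lprod y' bs \<otimes> T k" unfolding 2 ..
  also have "\<dots> \<otimes> (y \<otimes> lprod x' as) = lprod z as \<otimes> (lprod y' bs \<otimes> ((T k \<otimes> y) \<otimes> lprod x' as))"
    by (simp add: m_assoc)
  also have "lprod z cs \<otimes> \<dots> = normal_word (cs @ as) (bs @ [k]) k as"
    by (simp add: normal_word_def m_assoc lprod_append T_y)
  finally show ?thesis .
qed

lemma normal_word_trivial:
  assumes "sum_list (map tpow as) = 0" "sum_list (map tpow bs) = 0"
    "\<rho> (sum_list (map tpow cs)) = 0"
  shows "normal_word cs bs 0 as = \<one>"
proof -
  have "lprod x' as = \<one>"
    by (rule lprod_even) (use assms(1) x'_comm x'_invol in \<open>simp_all add: sum_list_tpow_eq_0_iff\<close>)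
  moreover have "lprod y' bs = \<one>"
    by (rule lprod_even) (use assms(2) y'_comm y'_invol in \<open>simp_all add: sum_list_tpow_eq_0_iff\<close>)
  moreover have "\<rho> (sum_list (map tpow cs)) = sum_list (map tpow (map \<phi> cs))"
    by (induction cs) simp_all
  hence "even (count_list (map \<phi> cs) k)" for k
    using assms(3) sum_list_tpow_eq_0_iff[of "map \<phi> cs"] by simp
  hence "lprod z (map \<phi> cs) = \<one>"
    by (intro lprod_even z_comm z_invol z_closed)
  ultimately show ?thesis by (simp add: normal_word_def lprod_z_phi)
qed

end

section \<open>A recursively enumerable set of relators\<close>

text \<open>The letters 0, 1 and 2 stand for \<open>x\<close>, \<open>y\<close> and \<open>t\<close>.\<close>

definition letters :: "nat set" where
  "letters = {0, 1, 2}"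

lemma letters_simps [simp]: "0 \<in> letters" "1 \<in> letters" "Suc 0 \<in> letters" "2 \<in> letters"
  by (simp_all add: letters_def)

text \<open>Families of words are indexed by natural numbers, so integer exponents come as a sign and an
  absolute value.\<close>

definition signed :: "bool \<Rightarrow> nat \<Rightarrow> int" where
  "signed b n = (if b then int n else - int n)"

definition x_word :: "bool \<Rightarrow> nat \<Rightarrow> nat word" where
  "x_word b i = replicate i (2, \<not> b) @ (0, True) # replicate i (2, b)"

definition y_word :: "bool \<Rightarrow> nat \<Rightarrow> nat word" where
  "y_word b i = replicate i (2, b) @ (1, True) # replicate i (2, \<not> b)"

text \<open>The commutator of two involutions is the square of their product.\<close>

definition z_word :: "bool \<Rightarrow> nat \<Rightarrow> nat word" where
  "z_word b i = x_word b i @ (1, True) # x_word b i @ [(1, True)]"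

text \<open>The inverse of \<open>z_word b i\<close> modulo the squares of \<open>x\<close> and
  \<open>y\<close>; unlike the formal inverse it contains no inverse of \<open>x\<close> or
  \<open>y\<close>.\<close>

definition z_word_inv :: "bool \<Rightarrow> nat \<Rightarrow> nat word" where
  "z_word_inv b i = (1, True) # x_word b i @ (1, True) # x_word b i"

text \<open>In this order: \<open>x\<close> and \<open>y\<close> are involutions, conjugates of
  \<open>x\<close> commute, conjugates of \<open>y\<close> commute, the paired central
  elements agree, and the commutators of conjugates of \<open>x\<close> with \<open>y\<close>
  are central.\<close>

definition relator_families :: "(nat \<Rightarrow> nat word) list" where
  "relator_families =
    [\<lambda>i. [(0, True), (0, True)], \<lambda>i. [(1, True), (1, True)],
     \<lambda>i. (0, True) # x_word True i @ (0, True) # x_word True i,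
     \<lambda>i. (1, True) # y_word False i @ (1, True) # y_word False i,
     \<lambda>s. z_word True (far s) @ z_word_inv True (near s)] @
    [\<lambda>i. z_word b i @ (l, True) # z_word_inv b i @ [(l, False)]. b \<leftarrow> [True, False], l \<leftarrow> [0, 1, 2]]"

definition relators :: "nat word set" where
  "relators = (\<Union>W\<in>set relator_families. range W)"

lemma replicate_in_words [simp]: "x \<in> S \<Longrightarrow> replicate n (x, b) \<in> words S"
  by (auto simp: words_def)

lemma relator_words [simp]: "x_word b i \<in> words letters" "y_word b i \<in> words letters"
    "z_word b i \<in> words letters" "z_word_inv b i \<in> words letters"
  by (simp_all add: x_word_def y_word_def z_word_def z_word_inv_def)

lemma relators_subset: "relators \<subseteq> words letters"
  by (auto simp: relators_def relator_families_def)

lemma computable_words_x_word: "computable1 N \<Longrightarrow> computable_words (\<lambda>i. x_word b (N i))"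
  and computable_words_y_word: "computable1 N \<Longrightarrow> computable_words (\<lambda>i. y_word b (N i))"
  unfolding x_word_def y_word_def by (intro computable_words_append computable_words_Cons computable_words_replicate; assumption)+

lemma computable_words_z_word: "computable1 N \<Longrightarrow> computable_words (\<lambda>i. z_word b (N i))"
  and computable_words_z_word_inv: "computable1 N \<Longrightarrow> computable_words (\<lambda>i. z_word_inv b (N i))"
  unfolding z_word_def z_word_inv_def by (intro computable_words_append computable_words_Cons computable_words_x_word computable_words_Nil; assumption)+

lemma computable1_id: "computable1 (\<lambda>i. i)"
  unfolding computable1_def by (rule computable_nth) simp

lemma re_set_relators: "re_set (word_code ` relators)"
  unfolding relators_def
proof (rule re_set_families)
  fix W assume "W \<in> set relator_families"
  thus "computable_words W"
    using computable1_id computable1_near computable1_far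
    by (auto simp: relator_families_def intro!: computable_words_append computable_words_Cons computable_words_Nil computable_words_x_word computable_words_y_word computable_words_z_word computable_words_z_word_inv)
qed

text \<open>The value of a word computed with tuples. Inverse letters of \<open>x\<close> and
  \<open>y\<close> need no separate case because both are involutions.\<close>

primrec eval_elem :: "nat word \<Rightarrow> elem" where
  "eval_elem [] = eone"
| "eval_elem (l # w) = (if fst l = 0 then gx else if fst l = 1 then gy else (signed (snd l) 1, 0, 0, 0)) \<odot> eval_elem w"

lemma eval_elem_append: "eval_elem (u @ v) = eval_elem u \<odot> eval_elem v"
  by (induction u) (simp_all add: emult_assoc)

lemma eval_elem_replicate: "eval_elem (replicate n (2, b)) = (signed b n, 0, 0, 0)"
  by (induction n) (auto simp: eone_def signed_def)

lemma signed_not [simp]: "signed (\<not> b) n = - signed b n"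
  by (simp add: signed_def)

lemma eval_elem_x_word: "eval_elem (x_word b i) = (0, tpow (signed b i), 0, 0)"
  by (simp add: x_word_def eval_elem_append eval_elem_replicate gx_def del: single_one)

lemma eval_elem_y_word: "eval_elem (y_word b i) = (0, 0, tpow (signed b i), 0)"
  by (simp add: y_word_def eval_elem_append eval_elem_replicate gy_def)

lemma eval_elem_z_word: "eval_elem (z_word b i) = (0, 0, 0, tpow (\<phi> (signed b i)))"
  by (simp add: z_word_def eval_elem_append eval_elem_x_word gy_def eone_def)

lemma eval_elem_z_word_inv: "eval_elem (z_word_inv b i) = (0, 0, 0, tpow (\<phi> (signed b i)))"
  by (simp add: z_word_inv_def eval_elem_append eval_elem_x_word gy_def)

lemma eval_elem_relator: "r \<in> relators \<Longrightarrow> eval_elem r = eone"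
  by (auto simp: relators_def relator_families_def eval_elem_append eval_elem_x_word eval_elem_y_word eval_elem_z_word eval_elem_z_word_inv
        gx_def gy_def eone_def signed_def)

definition letter_elem :: "nat \<Rightarrow> nat" where
  "letter_elem i = enc (if i = 0 then gx else if i = 1 then gy else gt)"

lemma letter_elem_closed: "letter_elem \<in> letters \<rightarrow> carrier hall"
  using fg_hall by (auto simp: letter_elem_def finite_generating_set_def)

lemma eval_word_hall:
  assumes "w \<in> words letters"
  shows "eval_word hall letter_elem w = enc (eval_elem w)"
  using assms
proof (induction w)
  case (Cons l w)
  obtain i b where l: "l = (i, b)" by fastforce
  have i: "i \<in> letters" and w: "w \<in> words letters" using Cons.prems by (simp_all add: l)
  hence "letter_elem i \<in> carrier hall" using letter_elem_closed by blast
  hence "inv\<^bsub>hall\<^esub> letter_elem i = enc (einv (dec (letter_elem i)))" by (rule hall_inv)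
  moreover have "einv gx = gx" "einv gy = gy" "einv gt = (- 1, 0, 0, 0)"
    by (simp_all add: gx_def gy_def gt_def)
  ultimately show ?case
    using i Cons.IH[OF w] by (auto simp: l letter_elem_def signed_def gt_def letters_def)
qed simp

lemma generate_letter_elem: "generate hall (letter_elem ` letters) = carrier hall"
proof -
  have "letter_elem ` letters = enc ` {gx, gy, gt}" by (simp add: letter_elem_def letters_def)
  thus ?thesis using fg_hall by (simp add: finite_generating_set_def)
qed

context
  fixes P :: "('c, 'd) monoid_scheme" (structure) and p :: "nat \<Rightarrow> 'c"
  assumes P: "group P" and p: "p \<in> letters \<rightarrow> carrier P"
    and rel: "\<And>r. r \<in> relators \<Longrightarrow> eval_word P p r = \<one>"
begin

interpretation P: group P by (rule P)

lemma p_closed: "p 0 \<in> carrier P" "p 1 \<in> carrier P" "p (Suc 0) \<in> carrier P" "p 2 \<in> carrier P"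
  using p by auto

lemma eval_word_P_append: "u \<in> words letters \<Longrightarrow> v \<in> words letters \<Longrightarrow>
    eval_word P p (u @ v) = eval_word P p u \<otimes> eval_word P p v"
  by (rule P.eval_word_append[OF p])

lemma eval_word_P_replicate: "eval_word P p (replicate n (2, b)) = p 2 [^] signed b n"
proof (induction n)
  case (Suc n)
  have "p 2 [^] (1 + int n) = p 2 \<otimes> p 2 [^] int n"
    using P.int_pow_mult[of "p 2" 1 "int n"] p_closed by simp
  moreover have "p 2 [^] (- 1 - int n) = inv (p 2) \<otimes> p 2 [^] (- int n)"
    using P.int_pow_mult[of "p 2" "- 1" "- int n"] p_closed by (simp add: P.int_pow_neg)
  ultimately show ?case using Suc by (simp add: signed_def)
qed (simp add: signed_def)

abbreviation (input) "xP k \<equiv> p 2 [^] (- k :: int) \<otimes> (p 0 \<otimes> p 2 [^] k)"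
abbreviation (input) "yP k \<equiv> p 2 [^] (k :: int) \<otimes> (p 1 \<otimes> p 2 [^] (- k))"
abbreviation (input) "zP k \<equiv> xP k \<otimes> (p 1 \<otimes> (xP k \<otimes> p 1))"

lemma eval_word_P_x_word: "eval_word P p (x_word b i) = xP (signed b i)"
  using p_closed by (simp add: x_word_def eval_word_P_append eval_word_P_replicate)

lemma eval_word_P_y_word: "eval_word P p (y_word b i) = yP (signed b i)"
  using p_closed by (simp add: y_word_def eval_word_P_append eval_word_P_replicate)

lemma eval_word_P_z_word: "eval_word P p (z_word b i) = zP (signed b i)"
  using p_closed by (simp add: z_word_def eval_word_P_append eval_word_P_x_word)

lemma sq_0: "p 0 \<otimes> p 0 = \<one>" and sq_1: "p 1 \<otimes> p 1 = \<one>"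
  using rel[of "[(0, True), (0, True)]"] rel[of "[(1, True), (1, True)]"] p_closed
  by (auto simp: relators_def relator_families_def)

lemma conjugate_sq:
  assumes g: "g \<in> carrier P" "g \<otimes> g = \<one>"
  shows "p 2 [^] (- k :: int) \<otimes> (g \<otimes> p 2 [^] k) \<otimes> (p 2 [^] (- k) \<otimes> (g \<otimes> p 2 [^] k)) = \<one>"
    (is "?u \<otimes> ?u = _")
proof -
  have "?u \<otimes> ?u = p 2 [^] (- k) \<otimes> (g \<otimes> ((p 2 [^] k \<otimes> p 2 [^] (- k)) \<otimes> (g \<otimes> p 2 [^] k)))"
    using p_closed g(1) by (simp add: P.m_assoc)
  also have "p 2 [^] k \<otimes> p 2 [^] (- k) = \<one>"
    using p_closed P.int_pow_mult[of "p 2" k "- k"] by simp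
  also have "p 2 [^] (- k) \<otimes> (g \<otimes> (\<one> \<otimes> (g \<otimes> p 2 [^] k))) = p 2 [^] (- k) \<otimes> ((g \<otimes> g) \<otimes> p 2 [^] k)"
    using p_closed g(1) by (simp add: P.m_assoc)
  also have "\<dots> = \<one>"
    unfolding g(2) using p_closed P.int_pow_mult[of "p 2" "- k" k] by simp
  finally show ?thesis .
qed

lemma xP_sq: "xP k \<otimes> xP k = \<one>" and yP_sq: "yP k \<otimes> yP k = \<one>"
  using conjugate_sq[OF p_closed(1) sq_0, of k] conjugate_sq[OF p_closed(2) sq_1, of "- k"]
  by simp_all

lemma commute_of_involutions:
  assumes "g \<in> carrier P" "h \<in> carrier P" "g \<otimes> g = \<one>" "h \<otimes> h = \<one>" "g \<otimes> (h \<otimes> (g \<otimes> h)) = \<one>"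
  shows "g \<otimes> h = h \<otimes> g"
proof -
  have "inv (g \<otimes> h) = g \<otimes> h"
    by (rule P.inv_equality) (use assms in \<open>simp_all add: P.m_assoc\<close>)
  moreover have "inv g = g" "inv h = h"
    using assms by (auto intro: P.inv_equality)
  ultimately show ?thesis using assms by (simp add: P.inv_mult_group)
qed

lemma z_word_inv_inv: "p 1 \<otimes> (xP k \<otimes> (p 1 \<otimes> xP k)) = inv (zP k)"
proof -
  define a where "a = xP k"
  have a: "a \<in> carrier P" "a \<otimes> a = \<one>" using p_closed xP_sq by (simp_all add: a_def)
  have "inv a = a" "inv (p 1) = p 1"
    using a sq_1 p_closed by (auto intro: P.inv_equality)
  thus ?thesis unfolding a_def[symmetric]
    using a p_closed by (simp add: P.inv_mult_group P.m_assoc)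
qed

lemma eval_word_P_z_word_inv: "eval_word P p (z_word_inv b i) = inv (zP (signed b i))"
  unfolding z_word_inv_inv [symmetric]
  using p_closed by (simp add: z_word_inv_def eval_word_P_append eval_word_P_x_word)

lemma eq_of_mult_inv:
  assumes "g \<in> carrier P" "h \<in> carrier P" "g \<otimes> inv h = \<one>"
  shows "g = h"
proof -
  have "g = (g \<otimes> inv h) \<otimes> h" using assms(1,2) by (simp add: P.m_assoc)
  thus ?thesis unfolding assms(3) using assms(2) by simp
qed

lemma zP_commutes:
  assumes "l \<in> letters"
  shows "zP k \<otimes> p l = p l \<otimes> zP k"
proof -
  obtain b i where k: "k = signed b i"
    by (metis (full_types) int_cases2 signed_def)
  have l: "p l \<in> carrier P" "l \<in> letters" using assms p by blast+
  have z: "zP k \<in> carrier P" using p_closed by simp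
  have "z_word b i @ (l, True) # z_word_inv b i @ [(l, False)] \<in> relators"
    using assms unfolding relators_def relator_families_def letters_def by (cases b) auto
  from rel[OF this] have "zP k \<otimes> (p l \<otimes> (inv (zP k) \<otimes> inv (p l))) = \<one>"
    using l by (simp add: eval_word_P_append eval_word_P_z_word eval_word_P_z_word_inv flip: k)
  moreover have "inv (p l \<otimes> zP k) = inv (zP k) \<otimes> inv (p l)"
    using l z by (simp add: P.inv_mult_group)
  ultimately have "(zP k \<otimes> p l) \<otimes> inv (p l \<otimes> zP k) = \<one>"
    using l z by (simp only: P.m_assoc P.inv_closed P.m_closed)
  from eq_of_mult_inv[OF _ _ this] show ?thesis using l z by simp
qed

text \<open>The relators are exactly the assumptions of \<open>hall_relations\<close>; a relator of the
  form \<open>(g h)^2\<close> says that the involutions g and h commute.\<close>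

lemma hall_relations_P: "hall_relations P (p 0) (p 1) (p 2)"
proof (unfold_locales, goal_cases)
  case (6 n)
  have "(0, True) # x_word True n @ (0, True) # x_word True n \<in> relators"
    unfolding relators_def relator_families_def by auto
  from rel[OF this] have "p 0 \<otimes> (xP (int n) \<otimes> (p 0 \<otimes> xP (int n))) = \<one>"
    using p_closed by (simp add: eval_word_P_append eval_word_P_x_word, simp add: signed_def)
  from commute_of_involutions[OF _ _ sq_0 xP_sq this] show ?case by (simp add: p_closed)
next
  case (7 n)
  have "(1, True) # y_word False n @ (1, True) # y_word False n \<in> relators"
    unfolding relators_def relator_families_def by auto
  from rel[OF this] have "p 1 \<otimes> (yP (- int n) \<otimes> (p 1 \<otimes> yP (- int n))) = \<one>"
    using p_closed by (simp add: eval_word_P_append eval_word_P_y_word, simp add: signed_def)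
  from commute_of_involutions[OF _ _ sq_1 yP_sq this] show ?case by (simp add: p_closed)
next
  case (11 s)
  have "z_word True (far s) @ z_word_inv True (near s) \<in> relators"
    unfolding relators_def relator_families_def by auto
  from rel[OF this] have "zP (int (far s)) \<otimes> inv (zP (int (near s))) = \<one>"
    by (simp add: eval_word_P_append eval_word_P_z_word eval_word_P_z_word_inv, simp add: signed_def)
  from eq_of_mult_inv[OF _ _ this] show ?case by (simp add: p_closed)
qed (simp_all add: p_closed sq_0 sq_1[simplified] zP_commutes[simplified])

interpretation H: hall_relations P "p 0" "p (Suc 0)" "p 2" "\<lambda>k. p 2 [^] (k :: int)"
    "\<lambda>k. p 2 [^] (- k) \<otimes> (p 0 \<otimes> p 2 [^] k)"
    "\<lambda>k. p 2 [^] k \<otimes> (p (Suc 0) \<otimes> p 2 [^] (- k))"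
    "\<lambda>k. p 2 [^] (- k) \<otimes> (p 0 \<otimes> p 2 [^] k) \<otimes> (p (Suc 0) \<otimes> (p 2 [^] (- k) \<otimes> (p 0 \<otimes> p 2 [^] k) \<otimes> p (Suc 0)))"
  using hall_relations_P by simp_all

abbreviation (input) tsum :: "int list \<Rightarrow> laurent" where
  "tsum ks \<equiv> sum_list (map tpow ks)"

lemma tsum_shift: "tsum as * tpow k = tsum (map (\<lambda>i. i + k) as)"
  by (induction as) (simp_all add: algebra_simps)

text \<open>By induction on the word, appending one letter at a time. The lists in the normal form in an
  arbitrary group satisfying the relators are the same lists that give the tuple of the word.
  A word with trivial tuple therefore has only lists with vanishing sums, and its normal form
  is trivial.\<close>

lemma normal_form:
  assumes "w \<in> words letters"
  shows "\<exists>cs bs k as. eval_word P p w = H.normal_word cs bs k as \<and> eval_elem w = (k, tsum as, tsum bs, \<rho> (tsum cs))"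
  using assms
proof (induction w rule: rev_induct)
  case Nil
  have "eval_word P p [] = H.normal_word [] [] 0 []" by (simp add: H.normal_word_def)
  moreover have "eval_elem [] = (0, tsum [], tsum [], \<rho> (tsum []))" by (simp add: eone_def)
  ultimately show ?case by blast
next
  case (snoc l w)
  obtain i b where l: "l = (i, b)" by fastforce
  have i: "i \<in> letters" and w: "w \<in> words letters" using snoc.prems by (simp_all add: l)
  obtain cs bs k as where IH: "eval_word P p w = H.normal_word cs bs k as"
      "eval_elem w = (k, tsum as, tsum bs, \<rho> (tsum cs))"
    using snoc.IH w by blast
  have pi: "p i \<in> carrier P" using p i by blast
  have eval_word: "eval_word P p (w @ [l]) = H.normal_word cs bs k as \<otimes> (if b then p i else inv (p i))"
    using i w pi by (simp add: eval_word_P_append IH l)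
  consider "i = 0" | "i = 1" | "i = 2" using i by (auto simp: letters_def)
  thus ?case
  proof cases
    case 1
    have "eval_word P p (w @ [l]) = H.normal_word cs bs k as \<otimes> p 0"
      using eval_word 1 H.inv_x by simp
    hence "eval_word P p (w @ [l]) = H.normal_word cs bs k (as @ [0])" by (simp add: H.normal_word_x)
    moreover have "eval_elem (w @ [l]) = (k, tsum (as @ [0]), tsum bs, \<rho> (tsum cs))"
      by (simp add: eval_elem_append l 1 IH gx_def add.commute)
    ultimately show ?thesis by blast
  next
    case 2
    have "eval_word P p (w @ [l]) = H.normal_word cs bs k as \<otimes> p (Suc 0)"
      using eval_word 2 H.inv_y by simp
    hence "eval_word P p (w @ [l]) = H.normal_word (cs @ as) (bs @ [k]) k as" unfolding H.normal_word_y .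
    moreover have "eval_elem (w @ [l]) = (k, tsum as, tsum (bs @ [k]), \<rho> (tsum (cs @ as)))"
      by (simp add: eval_elem_append l 2 IH gy_def)
    ultimately show ?thesis by blast
  next
    case 3
    have "eval_word P p (w @ [l]) = H.normal_word cs bs k as \<otimes> p 2 [^] signed b 1"
      using eval_word 3 p_closed by (simp add: signed_def P.int_pow_neg)
    hence "eval_word P p (w @ [l]) = H.normal_word cs bs (k + signed b 1) (map (\<lambda>i. i + signed b 1) as)"
      by (simp add: H.normal_word_T)
    moreover have "eval_elem (w @ [l]) = (k + signed b 1, tsum (map (\<lambda>i. i + signed b 1) as), tsum bs, \<rho> (tsum cs))"
      by (simp add: eval_elem_append l 3 IH eone_def tsum_shift del: map_map)
    ultimately show ?thesis by blast
  qed
qed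

lemma eval_word_P_trivial:
  assumes "w \<in> words letters" "eval_elem w = eone"
  shows "eval_word P p w = \<one>"
proof -
  from normal_form[OF assms(1)] obtain cs bs k as where
    normal_word: "eval_word P p w = H.normal_word cs bs k as" "eval_elem w = (k, tsum as, tsum bs, \<rho> (tsum cs))"
    by blast
  hence "k = 0" "tsum as = 0" "tsum bs = 0" "\<rho> (tsum cs) = 0"
    using assms(2) by (simp_all only: eone_def prod.inject)
  hence "H.normal_word cs bs k as = \<one>" using H.normal_word_trivial by simp
  thus ?thesis using normal_word(1) by simp
qed

end

theorem recursively_presented_hall: "recursively_presented hall"
proof -
  have "hall \<cong> presented_group letters relators"
  proof (rule presented_group_iso)
    show "Group.group hall" by (rule hall.is_group)
    show "letter_elem \<in> letters \<rightarrow> carrier hall" by (rule letter_elem_closed)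
    show "generate hall (letter_elem ` letters) = carrier hall" by (rule generate_letter_elem)
    show "relators \<subseteq> words letters" by (rule relators_subset)
    fix r assume r: "r \<in> relators"
    hence "r \<in> words letters" using relators_subset by blast
    thus "eval_word hall letter_elem r = \<one>\<^bsub>hall\<^esub>" using r by (simp add: eval_word_hall eval_elem_relator)
  next
    fix P :: "nat word set set monoid" and p w
    assume P: "Group.group P" "p \<in> letters \<rightarrow> carrier P" "\<And>r. r \<in> relators \<Longrightarrow> eval_word P p r = \<one>\<^bsub>P\<^esub>"
      and w: "w \<in> words letters" "eval_word hall letter_elem w = \<one>\<^bsub>hall\<^esub>"
    have "eval_elem w = eone" using w by (simp add: eval_word_hall)
    from eval_word_P_trivial[OF P w(1) this] show "eval_word P p w = \<one>\<^bsub>P\<^esub>" .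
  qed
  moreover have "finite letters" by (simp add: letters_def)
  ultimately show ?thesis
    unfolding recursively_presented_def using relators_subset re_set_relators by blast
qed

section \<open>Word norms and finite quotients\<close>

text \<open>Word norms are minima over all expressions; upper bounds on lengths are easier to combine.\<close>

definition reach :: "('a, 'b) monoid_scheme \<Rightarrow> 'a set \<Rightarrow> nat \<Rightarrow> 'a \<Rightarrow> bool" where
  "reach G S n g \<longleftrightarrow> (\<exists>ws. set ws \<subseteq> S \<union> (\<lambda>s. inv\<^bsub>G\<^esub> s) ` S \<and> length ws \<le> n \<and>
      foldr (mult G) ws \<one>\<^bsub>G\<^esub> = g)"

lemma reachE:
  assumes "reach G S n g"
  obtains ws where "set ws \<subseteq> S \<union> (\<lambda>s. inv\<^bsub>G\<^esub> s) ` S" "length ws \<le> n"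
    "foldr (mult G) ws \<one>\<^bsub>G\<^esub> = g"
  using assms unfolding reach_def by blast

lemma reachI:
  "set ws \<subseteq> S \<union> (\<lambda>s. inv\<^bsub>G\<^esub> s) ` S \<Longrightarrow> length ws \<le> n \<Longrightarrow>
    foldr (mult G) ws \<one>\<^bsub>G\<^esub> = g \<Longrightarrow> reach G S n g"
  unfolding reach_def by blast

lemma reach_mono: "reach G S n g \<Longrightarrow> n \<le> n' \<Longrightarrow> reach G S n' g"
  by (erule reachE, rule reachI) simp_all

lemma word_norm_le:
  assumes "reach G S n g"
  shows "word_norm G S g \<le> n"
proof -
  from assms obtain ws where "set ws \<subseteq> S \<union> (\<lambda>s. inv\<^bsub>G\<^esub> s) ` S" "length ws \<le> n"
    "foldr (mult G) ws \<one>\<^bsub>G\<^esub> = g" by (rule reachE)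
  hence "word_norm G S g \<le> length ws"
    unfolding word_norm_def by (intro Least_le exI[of _ ws]) simp
  thus ?thesis using \<open>length ws \<le> n\<close> by simp
qed

lemma reach_word_norm:
  assumes "reach G S n g"
  shows "reach G S (word_norm G S g) g"
proof -
  let ?P = "\<lambda>k. \<exists>ws. set ws \<subseteq> S \<union> (\<lambda>s. inv\<^bsub>G\<^esub> s) ` S \<and> length ws = k \<and> foldr (mult G) ws \<one>\<^bsub>G\<^esub> = g"
  from assms obtain ws where "set ws \<subseteq> S \<union> (\<lambda>s. inv\<^bsub>G\<^esub> s) ` S" "foldr (mult G) ws \<one>\<^bsub>G\<^esub> = g"
    by (rule reachE)
  hence "?P (length ws)" by (intro exI[of _ ws]) simp
  hence "?P (LEAST k. ?P k)" by (rule LeastI)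
  then obtain vs where "set vs \<subseteq> S \<union> (\<lambda>s. inv\<^bsub>G\<^esub> s) ` S" "length vs = word_norm G S g"
      "foldr (mult G) vs \<one>\<^bsub>G\<^esub> = g"
    unfolding word_norm_def by blast
  thus ?thesis by (intro reachI[of vs]) simp_all
qed

context group
begin

lemma foldr_mult_closed: "set ws \<subseteq> carrier G \<Longrightarrow> foldr (\<otimes>) ws \<one> \<in> carrier G"
  by (induction ws) auto

lemma foldr_mult_append:
  "set us \<subseteq> carrier G \<Longrightarrow> set vs \<subseteq> carrier G \<Longrightarrow>
    foldr (\<otimes>) (us @ vs) \<one> = foldr (\<otimes>) us \<one> \<otimes> foldr (\<otimes>) vs \<one>"
  by (induction us) (auto simp: m_assoc foldr_mult_closed simp del: foldr_append)

lemma gens_closed: "S \<subseteq> carrier G \<Longrightarrow> S \<union> (\<lambda>s. inv s) ` S \<subseteq> carrier G"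
  by auto

lemma reach_mult:
  assumes "S \<subseteq> carrier G" "reach G S m g" "reach G S n h"
  shows "reach G S (m + n) (g \<otimes> h)"
proof -
  obtain us where u: "set us \<subseteq> S \<union> (\<lambda>s. inv s) ` S" "length us \<le> m" "foldr (\<otimes>) us \<one> = g"
    using assms(2) by (rule reachE)
  obtain vs where v: "set vs \<subseteq> S \<union> (\<lambda>s. inv s) ` S" "length vs \<le> n" "foldr (\<otimes>) vs \<one> = h"
    using assms(3) by (rule reachE)
  have "foldr (\<otimes>) (us @ vs) \<one> = g \<otimes> h"
    using foldr_mult_append[OF order.trans[OF u(1) gens_closed[OF assms(1)]]
      order.trans[OF v(1) gens_closed[OF assms(1)]]] u(3) v(3) by (simp del: foldr_append)
  thus ?thesis
    using u v by (intro reachI[of "us @ vs"]) simp_all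
qed

lemma reach_one [simp]: "reach G S n \<one>"
  by (rule reachI[of "[]"]) simp_all

lemma reach_incl:
  assumes "S \<subseteq> carrier G" "g \<in> S \<union> (\<lambda>s. inv s) ` S"
  shows "reach G S 1 g"
proof (rule reachI)
  show "set [g] \<subseteq> S \<union> (\<lambda>s. inv s) ` S" using assms(2) by simp
  have "g \<in> carrier G" using assms gens_closed by blast
  thus "foldr (\<otimes>) [g] \<one> = g" by simp
qed simp

lemma ex_reach:
  assumes "S \<subseteq> carrier G" "g \<in> generate G S"
  shows "\<exists>n. reach G S n g"
  using assms(2)
proof induction
  case one
  show ?case by (rule exI, rule reach_one)
next
  case (incl h)
  hence "reach G S 1 h" by (rule reach_incl[OF assms(1) UnI1])
  thus ?case ..
next
  case (inv h)
  hence "reach G S 1 (inv h)" by (rule reach_incl[OF assms(1) UnI2[OF imageI]])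
  thus ?case ..
next
  case (eng g h)
  from eng.IH obtain m n where "reach G S m g" "reach G S n h" by (elim exE)
  hence "reach G S (m + n) (g \<otimes> h)" by (rule reach_mult[OF assms(1)])
  thus ?case ..
qed

lemma finite_reach:
  assumes "finite S"
  shows "finite {g. reach G S n g}"
proof -
  have "{g. reach G S n g} \<subseteq>
      (\<lambda>ws. foldr (\<otimes>) ws \<one>) ` {ws. set ws \<subseteq> S \<union> (\<lambda>s. inv s) ` S \<and> length ws \<le> n}"
  proof
    fix g assume "g \<in> {g. reach G S n g}"
    hence "reach G S n g" by simp
    then obtain ws where "set ws \<subseteq> S \<union> (\<lambda>s. inv s) ` S" "length ws \<le> n" "foldr (\<otimes>) ws \<one> = g"
      by (rule reachE)
    thus "g \<in> (\<lambda>ws. foldr (\<otimes>) ws \<one>) ` {ws. set ws \<subseteq> S \<union> (\<lambda>s. inv s) ` S \<and> length ws \<le> n}"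
      by (intro image_eqI[of _ _ ws]) simp_all
  qed
  moreover have "finite {ws. set ws \<subseteq> S \<union> (\<lambda>s. inv s) ` S \<and> length ws \<le> n}"
    using assms by (intro finite_lists_length_le) simp
  ultimately show ?thesis by (rule finite_surj[rotated])
qed

lemma reach_iff_word_norm:
  assumes "finite_generating_set G S" "g \<in> carrier G"
  shows "word_norm G S g \<le> n \<longleftrightarrow> reach G S n g"
proof
  have "S \<subseteq> carrier G" "g \<in> generate G S"
    using assms by (simp_all add: finite_generating_set_def)
  from ex_reach[OF this] obtain n' where "reach G S n' g" ..
  hence "reach G S (word_norm G S g) g" by (rule reach_word_norm)
  thus "reach G S n g" if "word_norm G S g \<le> n" using that by (rule reach_mono)
qed (rule word_norm_le)

lemma finite_ball:
  assumes "finite_generating_set G S"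
  shows "finite {g \<in> carrier G - {\<one>}. word_norm G S g \<le> n}"
proof (rule finite_subset)
  show "{g \<in> carrier G - {\<one>}. word_norm G S g \<le> n} \<subseteq> {g. reach G S n g}"
  proof
    fix g assume "g \<in> {g \<in> carrier G - {\<one>}. word_norm G S g \<le> n}"
    hence "g \<in> carrier G" "word_norm G S g \<le> n" by simp_all
    thus "g \<in> {g. reach G S n g}" by (simp add: reach_iff_word_norm[OF assms])
  qed
  show "finite {g. reach G S n g}"
    using assms by (simp add: finite_generating_set_def finite_reach)
qed

lemma min_quotient_order_le:
  assumes "separating_hom G g Q \<psi>"
  shows "min_quotient_order G g \<le> card (carrier Q)"
  unfolding min_quotient_order_def
  by (rule Least_le, intro exI[of _ Q] exI[of _ \<psi>] conjI assms refl)

lemma min_quotient_order_ge: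
  assumes "separating_hom G g Q0 \<psi>0"
    and "\<And>Q \<psi>. separating_hom G g Q \<psi> \<Longrightarrow> B \<le> card (carrier Q)"
  shows "B \<le> min_quotient_order G g"
proof -
  let ?P = "\<lambda>k. \<exists>Q \<psi>. separating_hom G g Q \<psi> \<and> card (carrier Q) = k"
  have "?P (card (carrier Q0))" using assms(1) by (intro exI[of _ Q0] exI[of _ \<psi>0] conjI refl)
  hence "?P (LEAST k. ?P k)" by (rule LeastI)
  then obtain Q \<psi> where "separating_hom G g Q \<psi>" "card (carrier Q) = min_quotient_order G g"
    unfolding min_quotient_order_def by (elim exE conjE)
  thus ?thesis using assms(2)[of Q \<psi>] by simp
qed

lemma Rf_ge:
  assumes "finite_generating_set G S" "g \<in> carrier G" "g \<noteq> \<one>" "reach G S n g"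
  shows "min_quotient_order G g \<le> Rf G S n"
  unfolding Rf_def
proof (rule Max_ge)
  show "min_quotient_order G g \<in> min_quotient_order G ` {g \<in> carrier G - {\<one>}. word_norm G S g \<le> n}"
    using assms(2,3) word_norm_le[OF assms(4)] by (intro imageI) simp
qed (rule finite_imageI[OF finite_ball[OF assms(1)]])

lemma Rf_le:
  assumes "finite_generating_set G S" "g0 \<in> carrier G" "g0 \<noteq> \<one>" "reach G S n g0"
    and "\<And>g. g \<in> carrier G \<Longrightarrow> g \<noteq> \<one> \<Longrightarrow> reach G S n g \<Longrightarrow> min_quotient_order G g \<le> B"
  shows "Rf G S n \<le> B"
  unfolding Rf_def
proof (rule Max.boundedI)
  show "finite (min_quotient_order G ` {g \<in> carrier G - {\<one>}. word_norm G S g \<le> n})"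
    by (rule finite_imageI[OF finite_ball[OF assms(1)]])
  have "g0 \<in> {g \<in> carrier G - {\<one>}. word_norm G S g \<le> n}"
    using assms(2,3) word_norm_le[OF assms(4)] by simp
  hence "min_quotient_order G g0 \<in> min_quotient_order G ` {g \<in> carrier G - {\<one>}. word_norm G S g \<le> n}"
    by (rule imageI)
  thus "min_quotient_order G ` {g \<in> carrier G - {\<one>}. word_norm G S g \<le> n} \<noteq> {}"
    by (metis empty_iff)
next
  fix k assume "k \<in> min_quotient_order G ` {g \<in> carrier G - {\<one>}. word_norm G S g \<le> n}"
  then obtain g where "k = min_quotient_order G g" "g \<in> carrier G" "g \<noteq> \<one>" "word_norm G S g \<le> n"
    by (elim imageE) simp
  thus "k \<le> B" using assms(5)[of g] by (simp add: reach_iff_word_norm[OF assms(1)])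
qed

text \<open>Finite quotients will be given by a map with finitely many values such that the value of a
  product depends only on the values of the factors. Its image then carries a group structure,
  which is copied to the natural numbers.\<close>

lemma quotient_of_congruence:
  fixes f :: "'a \<Rightarrow> 'c"
  assumes cong: "\<And>g g' h h'. g \<in> carrier G \<Longrightarrow> g' \<in> carrier G \<Longrightarrow> h \<in> carrier G \<Longrightarrow> h' \<in> carrier G \<Longrightarrow>
      f g = f g' \<Longrightarrow> f h = f h' \<Longrightarrow> f (g \<otimes> h) = f (g' \<otimes> h')"
    and fin: "finite (f ` carrier G)" and g: "g \<in> carrier G" "f g \<noteq> f \<one>"
  obtains Q \<psi> where "separating_hom G g Q \<psi>" "card (carrier Q) = card (f ` carrier G)"
proof -
  obtain e :: "'c \<Rightarrow> nat" where e: "inj_on e (f ` carrier G)"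
    using finite_imp_inj_to_nat_seg[OF fin] by (elim exE conjE)
  define \<psi> where "\<psi> = (\<lambda>g. e (f g))"
  define r where "r = inv_into (carrier G) \<psi>"
  have \<psi>_eq: "\<psi> g = \<psi> h \<longleftrightarrow> f g = f h" if "g \<in> carrier G" "h \<in> carrier G" for g h
    unfolding \<psi>_def by (rule inj_on_eq_iff[OF e imageI[OF that(1)] imageI[OF that(2)]])
  have r: "r (\<psi> g) \<in> carrier G" "\<psi> (r (\<psi> g)) = \<psi> g" if "g \<in> carrier G" for g
    unfolding r_def using imageI[OF that, of \<psi>] by (rule inv_into_into, rule f_inv_into_f)
  have fr: "f (r (\<psi> g)) = f g" if "g \<in> carrier G" for g
    using \<psi>_eq[OF r(1)[OF that] that] r(2)[OF that] by simp
  define Q where "Q = \<lparr>carrier = \<psi> ` carrier G, mult = (\<lambda>u v. \<psi> (r u \<otimes> r v)), one = \<psi> \<one>\<rparr>"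
  have mult: "\<psi> g \<otimes>\<^bsub>Q\<^esub> \<psi> h = \<psi> (g \<otimes> h)" if "g \<in> carrier G" "h \<in> carrier G" for g h
  proof -
    have "f (r (\<psi> g) \<otimes> r (\<psi> h)) = f (g \<otimes> h)"
      by (intro cong r fr that)
    hence "\<psi> (r (\<psi> g) \<otimes> r (\<psi> h)) = \<psi> (g \<otimes> h)"
      by (simp add: \<psi>_def)
    thus ?thesis by (simp add: Q_def)
  qed
  have one: "\<one>\<^bsub>Q\<^esub> = \<psi> \<one>" by (simp add: Q_def)
  have carr: "carrier Q = \<psi> ` carrier G" by (simp add: Q_def)
  have \<psi>_in: "\<psi> h \<in> carrier Q" if "h \<in> carrier G" for h
    unfolding carr using that by (rule imageI)
  have "group Q"
  proof (rule groupI)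
    fix u v w assume "u \<in> carrier Q" "v \<in> carrier Q" "w \<in> carrier Q"
    then obtain a b c where abc: "a \<in> carrier G" "u = \<psi> a" "b \<in> carrier G" "v = \<psi> b"
        "c \<in> carrier G" "w = \<psi> c"
      unfolding carr by (elim imageE)
    show "u \<otimes>\<^bsub>Q\<^esub> v \<otimes>\<^bsub>Q\<^esub> w = u \<otimes>\<^bsub>Q\<^esub> (v \<otimes>\<^bsub>Q\<^esub> w)"
      using abc by (simp add: mult m_assoc)
  next
    fix u v assume "u \<in> carrier Q" "v \<in> carrier Q"
    then obtain a b where ab: "a \<in> carrier G" "u = \<psi> a" "b \<in> carrier G" "v = \<psi> b"
      unfolding carr by (elim imageE)
    show "u \<otimes>\<^bsub>Q\<^esub> v \<in> carrier Q"
      using ab by (simp add: mult \<psi>_in)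
  next
    fix u assume "u \<in> carrier Q"
    then obtain a where a: "a \<in> carrier G" "u = \<psi> a"
      unfolding carr by (elim imageE)
    show "\<one>\<^bsub>Q\<^esub> \<otimes>\<^bsub>Q\<^esub> u = u" using a by (simp add: mult one)
    show "\<exists>v\<in>carrier Q. v \<otimes>\<^bsub>Q\<^esub> u = \<one>\<^bsub>Q\<^esub>"
      by (rule bexI[of _ "\<psi> (inv a)"]) (simp_all add: a mult one \<psi>_in)
  qed (simp add: one \<psi>_in)
  moreover have "\<psi> \<in> hom G Q"
    by (rule homI) (simp_all add: mult \<psi>_in)
  moreover have "\<psi> g \<noteq> \<one>\<^bsub>Q\<^esub>" using g by (simp add: one \<psi>_eq)
  moreover have im: "carrier Q = e ` f ` carrier G" by (simp add: carr \<psi>_def image_image)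
  ultimately have "separating_hom G g Q \<psi>"
    using fin by (simp add: separating_hom_def)
  moreover have "card (carrier Q) = card (f ` carrier G)"
    unfolding im using e by (rule card_image)
  ultimately show ?thesis by (rule that)
qed

end

section \<open>Derived length\<close>

lemma derived_length_eqI:
  assumes "group G" "(derived G ^^ n) (carrier G) = {\<one>\<^bsub>G\<^esub>}"
    "\<And>m. m < n \<Longrightarrow> (derived G ^^ m) (carrier G) \<noteq> {\<one>\<^bsub>G\<^esub>}"
  shows "derived_length G = n"
  unfolding derived_length_def
  by (rule Least_equality) (use assms in \<open>auto simp: linorder_not_less[symmetric]\<close>)

context
begin

private definition D1 where "D1 = {n. fst (dec n) = 0}"
private definition D2 where "D2 = {n. fst (dec n) = 0 \<and> fst (snd (dec n)) = 0 \<and> fst (snd (snd (dec n))) = 0}"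

private lemma subgroups: "subgroup D1 big_group" "subgroup D2 big_group"
proof -
  show "subgroup D1 big_group"
  proof (rule big_group.subgroupI)
    fix m assume "m \<in> D1"
    thus "inv\<^bsub>big_group\<^esub> m \<in> D1" by (cases "dec m") (simp add: D1_def)
    fix n assume "n \<in> D1"
    thus "m \<otimes>\<^bsub>big_group\<^esub> n \<in> D1" using \<open>m \<in> D1\<close> by (cases "dec m"; cases "dec n") (simp add: D1_def)
  next
    have "enc eone \<in> D1" by (simp add: D1_def eone_def)
    thus "D1 \<noteq> {}" by blast
  qed auto
  show "subgroup D2 big_group"
  proof (rule big_group.subgroupI)
    fix m assume "m \<in> D2"
    thus "inv\<^bsub>big_group\<^esub> m \<in> D2" by (cases "dec m") (simp add: D2_def)
    fix n assume "n \<in> D2"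
    thus "m \<otimes>\<^bsub>big_group\<^esub> n \<in> D2" using \<open>m \<in> D2\<close> by (cases "dec m"; cases "dec n") (simp add: D2_def)
  next
    have "enc eone \<in> D2" by (simp add: D2_def eone_def)
    thus "D2 \<noteq> {}" by blast
  qed auto
qed

private lemma derived_le:
  assumes "subgroup K big_group" "\<And>m n. m \<in> H \<Longrightarrow> n \<in> H \<Longrightarrow>
     enc (dec m \<odot> dec n \<odot> einv (dec m) \<odot> einv (dec n)) \<in> K"
  shows "derived big_group H \<subseteq> K"
  unfolding derived_def
  by (rule big_group.generate_subgroup_incl) (use assms in auto)

private lemma derived_steps:
  "derived big_group UNIV \<subseteq> D1" "derived big_group D1 \<subseteq> D2" "derived big_group D2 \<subseteq> {enc eone}"
proof -
  show "derived big_group UNIV \<subseteq> D1"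
  proof (rule derived_le[OF subgroups(1)])
    fix m n show "enc (dec m \<odot> dec n \<odot> einv (dec m) \<odot> einv (dec n)) \<in> D1"
      by (cases "dec m"; cases "dec n") (simp add: D1_def)
  qed
  show "derived big_group D1 \<subseteq> D2"
  proof (rule derived_le[OF subgroups(2)])
    fix m n assume "m \<in> D1" "n \<in> D1"
    thus "enc (dec m \<odot> dec n \<odot> einv (dec m) \<odot> einv (dec n)) \<in> D2"
      by (cases "dec m"; cases "dec n") (simp add: D1_def D2_def algebra_simps)
  qed
  have "subgroup {enc eone} big_group" using big_group.triv_subgroup by simp
  thus "derived big_group D2 \<subseteq> {enc eone}"
  proof (rule derived_le)
    fix m n assume "m \<in> D2" "n \<in> D2"
    thus "enc (dec m \<odot> dec n \<odot> einv (dec m) \<odot> einv (dec n)) \<in> {enc eone}"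
      by (cases "dec m"; cases "dec n") (simp add: D2_def eone_def algebra_simps)
  qed
qed

text \<open>Commutators have \<open>k = 0\<close>; commutators of these have \<open>a = b = 0\<close> as
  well; and what remains is central.\<close>

lemma derived_hall_3: "(derived hall ^^ 3) (carrier hall) = {\<one>\<^bsub>hall\<^esub>}"
proof -
  have c: "derived hall K = derived big_group K" if "K \<subseteq> carrier hall" for K
    using big_group.derived_consistent[OF that subgroup_hall] by (simp add: hall_def)
  let ?d = "\<lambda>n. (derived hall ^^ n) (carrier hall)"
  have sub: "?d n \<subseteq> carrier hall" for n
    by (rule hall.exp_of_derived_in_carrier) simp
  have 1: "?d 1 \<subseteq> D1"
    using big_group.mono_derived[of "carrier hall" UNIV] derived_steps(1) c[of "carrier hall"] by auto
  have 2: "?d 2 \<subseteq> D2"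
    using big_group.mono_derived[OF 1] derived_steps(2) c[OF sub[of 1]] by (simp add: numeral_2_eq_2)
  have 3: "?d 3 \<subseteq> {enc eone}"
    using big_group.mono_derived[OF 2] derived_steps(3) c[OF sub[of 2]]
    by (simp add: numeral_3_eq_3 numeral_2_eq_2)
  moreover have "subgroup (?d 3) hall"
    by (rule hall.exp_of_derived_is_subgroup) (rule hall.subgroup_self)
  hence "\<one>\<^bsub>hall\<^esub> \<in> ?d 3" by (rule subgroup.one_closed)
  ultimately show ?thesis by auto
qed

text \<open>A nontrivial commutator of commutators, namely of \<open>[x, t]\<close> and \<open>[y,
  t]\<close>. Its central entry \<open>t^-1 + t\<close> only involves exponents below 4, which
  the identification leaves alone.\<close>

lemma derived_hall_2: "(derived hall ^^ 2) (carrier hall) \<noteq> {\<one>\<^bsub>hall\<^esub>}"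
proof -
  have gens: "enc gx \<in> carrier hall" "enc gy \<in> carrier hall" "enc gt \<in> carrier hall"
    using fg_hall by (auto simp: finite_generating_set_def)
  let ?c = "\<lambda>g h. g \<odot> h \<odot> einv g \<odot> einv h"
  have comm: "enc (?c g h) \<in> derived hall K" if "enc g \<in> K" "enc h \<in> K" "K \<subseteq> carrier hall" for g h K
  proof -
    have "enc g \<otimes>\<^bsub>hall\<^esub> enc h \<otimes>\<^bsub>hall\<^esub> inv\<^bsub>hall\<^esub> enc g \<otimes>\<^bsub>hall\<^esub> inv\<^bsub>hall\<^esub> enc h \<in> derived hall K"
      unfolding derived_def
      by (rule generate.incl, rule UN_I[OF that(1)], rule UN_I[OF that(2)], rule singletonI)
    moreover have "inv\<^bsub>hall\<^esub> enc g = enc (einv g)" "inv\<^bsub>hall\<^esub> enc h = enc (einv h)"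
      using hall_inv[OF subsetD[OF that(3,1)]] hall_inv[OF subsetD[OF that(3,2)]] by simp_all
    ultimately show ?thesis by simp
  qed
  have comms: "?c gx gt = (0, tpow (- 1) + 1, 0, 0)" "?c gy gt = (0, 0, 1 + tpow 1, 0)"
    by (simp_all add: gx_def gy_def gt_def algebra_simps)
  have "enc (?c gx gt) \<in> derived hall (carrier hall)" "enc (?c gy gt) \<in> derived hall (carrier hall)"
    by (rule comm[OF gens(1,3) order.refl], rule comm[OF gens(2,3) order.refl])
  moreover have "derived hall (carrier hall) \<subseteq> carrier hall"
    by (rule hall.derived_in_carrier) simp
  ultimately have "enc (?c (?c gx gt) (?c gy gt)) \<in> derived hall (derived hall (carrier hall))"
    by (rule comm)
  moreover have "?c (?c gx gt) (?c gy gt) = (0, 0, 0, tpow (- 1) + tpow 1)"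
  proof -
    have "?c (0, a, 0, 0) (0, 0, b, 0) = (0, 0, 0, \<rho> (a * b))" for a b
      by simp
    moreover have "(tpow (- 1) + 1) * (1 + tpow 1) = tpow (- 1) + tpow 1 + (1 + 1)"
      by (simp only: distrib_left distrib_right mult_1_left mult_1_right tpow_mult) simp
    hence "\<rho> ((tpow (- 1) + 1) * (1 + tpow 1)) = tpow (- 1) + tpow 1"
      by (simp add: \<phi>_small)
    ultimately show ?thesis unfolding comms by simp
  qed
  moreover have "(0, 0, 0, tpow (- 1) + tpow 1) \<noteq> eone"
    by (simp add: eone_def laurent_add_eq_0_iff)
  ultimately have "derived hall (derived hall (carrier hall)) \<noteq> {enc eone}" by fastforce
  thus ?thesis by (simp add: numeral_2_eq_2)
qed

theorem derived_length_hall: "derived_length hall = 3" and solvable_hall: "solvable hall"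
proof -
  have "(derived hall ^^ m) (carrier hall) \<noteq> {\<one>\<^bsub>hall\<^esub>}" if "m < 3" for m
  proof
    assume eq: "(derived hall ^^ m) (carrier hall) = {\<one>\<^bsub>hall\<^esub>}"
    have "derived hall {\<one>\<^bsub>hall\<^esub>} = {\<one>\<^bsub>hall\<^esub>}"
    proof -
      have "derived hall {\<one>\<^bsub>hall\<^esub>} \<subseteq> {\<one>\<^bsub>hall\<^esub>}"
        by (rule hall.derived_incl[OF order.refl hall.triv_subgroup])
      moreover have "\<one>\<^bsub>hall\<^esub> \<in> derived hall {\<one>\<^bsub>hall\<^esub>}"
        unfolding derived_def by (rule generate.one)
      ultimately show ?thesis by blast
    qed
    hence "(derived hall ^^ (k + m)) (carrier hall) = {\<one>\<^bsub>hall\<^esub>}" for k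
      by (induction k) (simp_all only: eq funpow.simps comp_apply add_0 add_Suc)
    from this[of "2 - m"] show False using that derived_hall_2 by simp
  qed
  thus "derived_length hall = 3"
    by (intro derived_length_eqI derived_hall_3 hall.is_group)
  show "solvable hall"
    using hall.solvable_iff_trivial_derived_seq derived_hall_3 by blast
qed

end

section \<open>Polynomials over the field with two elements\<close>

abbreviation pdeg :: "bit poly \<Rightarrow> nat" where "pdeg \<equiv> Polynomial.degree"
abbreviation pcoeff :: "bit poly \<Rightarrow> nat \<Rightarrow> bit" where "pcoeff \<equiv> Polynomial.coeff"
abbreviation xpow :: "nat \<Rightarrow> bit poly" where "xpow n \<equiv> Polynomial.monom 1 n"

lemma bitpoly_double [simp]: "(p :: bit poly) + p = 0"
  by (rule poly_eqI) (simp only: coeff_add bit_add_self coeff_0)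

lemma bitpoly_two [simp]: "(2 :: bit poly) = 0"
  by (metis bitpoly_double one_add_one)

lemma bitpoly_diff: "(p :: bit poly) - q = p + q"
proof -
  have "p - q = p - q + (q + q)" unfolding bitpoly_double by simp
  thus ?thesis by (simp only: diff_add_cancel flip: add.assoc)
qed

lemma mult_pcoeff_0: "pcoeff (p * q) 0 = pcoeff p 0 * pcoeff q 0"
  by (simp flip: poly_0_coeff_0)

text \<open>A polynomial is determined by its set of exponents.\<close>

lemma card_bitpoly: "finite {p. pdeg p < n}" "n > 0 \<Longrightarrow> card {p. pdeg p < n} = 2 ^ n"
proof -
  let ?R = "{p :: bit poly. \<forall>j\<ge>n. pcoeff p j = 0}"
  have bij: "bij_betw (\<lambda>p. {j. pcoeff p j = 1}) ?R (Pow {..<n})"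
  proof (rule bij_betw_imageI)
    show "inj_on (\<lambda>p. {j. pcoeff p j = 1}) ?R"
    proof (rule inj_onI, rule poly_eqI)
      fix p q :: "bit poly" and j
      assume "{j. pcoeff p j = 1} = {j. pcoeff q j = 1}"
      hence "pcoeff p j = 1 \<longleftrightarrow> pcoeff q j = 1" by blast
      thus "pcoeff p j = pcoeff q j" by (cases "pcoeff p j"; cases "pcoeff q j") auto
    qed
    show "(\<lambda>p. {j. pcoeff p j = 1}) ` ?R = Pow {..<n}"
    proof
      show "(\<lambda>p. {j. pcoeff p j = 1}) ` ?R \<subseteq> Pow {..<n}"
        by (auto simp: not_le[symmetric])
      show "Pow {..<n} \<subseteq> (\<lambda>p. {j. pcoeff p j = 1}) ` ?R"
      proof
        fix B assume "B \<in> Pow {..<n}"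
        hence B: "B \<subseteq> {..<n}" "finite B" by (auto intro: finite_subset)
        have c: "pcoeff (\<Sum>j\<in>B. xpow j) k = (if k \<in> B then 1 else 0)" for k
          using B(2) by (simp add: coeff_sum if_distrib[of "\<lambda>x. x = _"] sum.delta cong: if_cong)
        show "B \<in> (\<lambda>p. {j. pcoeff p j = 1}) ` ?R"
          by (rule image_eqI[of _ _ "\<Sum>j\<in>B. xpow j"]) (use B in \<open>auto simp: c\<close>)
      qed
    qed
  qed
  have sub: "pdeg p < n \<Longrightarrow> p \<in> ?R" for p
    by (simp add: coeff_eq_0)
  have "finite ?R" using bij_betw_finite[OF bij] by simp
  thus "finite {p. pdeg p < n}" by (rule rev_finite_subset) (use sub in blast)
  assume "n > 0"
  hence "p \<in> ?R \<Longrightarrow> pdeg p < n" for p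
    using degree_lessI[of p n] by (cases "p = 0") auto
  hence "{p. pdeg p < n} = ?R" using sub by blast
  thus "card {p. pdeg p < n} = 2 ^ n"
    using bij_betw_same_card[OF bij] by (simp add: card_Pow)
qed

text \<open>Euclid's algorithm. A nonzero remainder of smaller degree always exists because p cannot
  divide \<open>\<pi>\<close>, by minimality of the degree of \<open>\<pi>\<close> among the
  nonconstant divisors of h. This replaces irreducibility of \<open>\<pi>\<close> by the only
  consequence that is used.\<close>

lemma invertible_mod_minimal_divisor:
  fixes \<pi> h p :: "bit poly"
  assumes \<pi>: "\<pi> dvd h" and min: "\<And>d. d dvd h \<Longrightarrow> pdeg d > 0 \<Longrightarrow> pdeg \<pi> \<le> pdeg d"
    and p: "p \<noteq> 0" "pdeg p < pdeg \<pi>"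
  shows "\<exists>u. \<pi> dvd u * p - 1"
  using p
proof (induction "pdeg p" arbitrary: p rule: less_induct)
  case less
  show ?case
  proof (cases "pdeg p = 0")
    case True
    then obtain c where c: "p = [:c:]" by (rule degree_eq_zeroE)
    with less.prems have "p = 1" by (cases c) (auto simp: one_pCons)
    thus ?thesis by (intro exI[of _ 1]) simp
  next
    case False
    have "\<pi> mod p \<noteq> 0"
    proof
      assume "\<pi> mod p = 0"
      hence "p dvd h" using \<pi> dvd_trans mod_eq_0_iff_dvd by blast
      from min[OF this] False less.prems show False by simp
    qed
    moreover from this have "pdeg (\<pi> mod p) < pdeg p"
      using less.prems by (intro degree_mod_less')
    ultimately obtain u where u: "\<pi> dvd u * (\<pi> mod p) - 1"
      using less.hyps[of "\<pi> mod p"] less.prems by auto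
    define r where "r = \<pi> mod p"
    have "\<pi> = (\<pi> div p) * p + r"
      by (simp add: r_def)
    hence "(u * r - 1) - \<pi> * u = (u * r - 1) - ((\<pi> div p) * p + r) * u" by simp
    also have "\<dots> = - (u * (\<pi> div p)) * p - 1"
      by (simp add: algebra_simps)
    finally have "- (u * (\<pi> div p)) * p - 1 = (u * (\<pi> mod p) - 1) - \<pi> * u"
      by (simp only: r_def)
    hence "\<pi> dvd - (u * (\<pi> div p)) * p - 1"
      using u by (metis dvd_diff dvd_triv_left)
    thus ?thesis by blast
  qed
qed

text \<open>Fermat's little theorem modulo \<open>\<pi>\<close>: multiplication by the variable permutes
  the \<open>2^d - 1\<close> nonzero residues (d is the degree of \<open>\<pi>\<close>), so it
  does not change their product, which is invertible.\<close>

lemma minimal_divisor_dvd: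
  fixes \<pi> h :: "bit poly"
  assumes \<pi>: "\<pi> dvd h" "pdeg \<pi> > 0" and min: "\<And>d. d dvd h \<Longrightarrow> pdeg d > 0 \<Longrightarrow> pdeg \<pi> \<le> pdeg d"
    and c0: "pcoeff \<pi> 0 \<noteq> 0"
  shows "\<pi> dvd xpow (2 ^ pdeg \<pi> - 1) - 1"
proof -
  let ?x = "xpow 1"
  define R where "R = {p :: bit poly. pdeg p < pdeg \<pi>} - {0}"
  have finR: "finite R" and cardR: "card R = 2 ^ pdeg \<pi> - 1"
    unfolding R_def using card_bitpoly[of "pdeg \<pi>"] \<pi>(2) by simp_all
  have inv: "\<exists>u. \<pi> dvd u * p - 1" if "p \<in> R" for p
    using that invertible_mod_minimal_divisor[OF \<pi>(1) min, of p] by (simp add: R_def)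
  have not_dvd_x: "\<not> \<pi> dvd ?x"
  proof
    assume "\<pi> dvd ?x"
    then obtain v where v: "?x = \<pi> * v" ..
    have "pcoeff ?x 0 = pcoeff \<pi> 0 * pcoeff v 0" unfolding v by (rule mult_pcoeff_0)
    hence "pcoeff v 0 = 0" using c0 by simp
    then obtain v' where v': "v = pCons 0 v'" by (cases v) auto
    have "pCons 0 [:1:] = pCons 0 (\<pi> * v')"
      using v by (simp add: v' monom_altdef)
    hence "1 = \<pi> * v'" by (simp only: pCons_eq_iff one_pCons)
    hence "\<pi> dvd 1" by (rule dvdI)
    moreover have "\<pi> \<noteq> 0" using \<pi>(2) by auto
    ultimately show False using \<pi>(2) is_unit_iff_degree[of \<pi>] by simp
  qed
  have not_dvd: "\<not> \<pi> dvd ?x * p" if "p \<in> R" for p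
  proof
    assume *: "\<pi> dvd ?x * p"
    from inv[OF that] obtain u where "\<pi> dvd u * p - 1" ..
    from dvd_diff[OF dvd_mult[OF *, of u] dvd_mult[OF this, of ?x]]
    have "\<pi> dvd u * (?x * p) - ?x * (u * p - 1)" .
    also have "u * (?x * p) - ?x * (u * p - 1) = ?x" by (simp add: algebra_simps)
    finally show False using not_dvd_x by simp
  qed
  define F where "F p = (?x * p) mod \<pi>" for p
  have \<pi>0: "\<pi> \<noteq> 0" using \<pi>(2) by auto
  have F_in: "F p \<in> R" if "p \<in> R" for p
  proof -
    have "F p \<noteq> 0" using not_dvd[OF that] by (simp add: F_def mod_eq_0_iff_dvd)
    thus ?thesis using \<pi>0 by (simp add: R_def F_def degree_mod_less')
  qed
  have "inj_on F R"
  proof (rule inj_onI, rule ccontr)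
    fix p q assume pq: "p \<in> R" "q \<in> R" "F p = F q" "p \<noteq> q"
    hence "p - q \<in> R" by (simp add: R_def degree_diff_less)
    moreover have "\<pi> dvd ?x * (p - q)"
      using pq(3) by (simp add: F_def mod_eq_dvd_iff right_diff_distrib)
    ultimately show False using not_dvd by blast
  qed
  hence "F ` R = R" using F_in finR by (intro endo_inj_surj) auto
  hence "(\<Prod>p\<in>R. F p) = \<Prod>R"
    using \<open>inj_on F R\<close> prod.reindex[of F R id] by simp
  hence "(\<Prod>p\<in>R. ?x * p) mod \<pi> = \<Prod>R mod \<pi>"
    unfolding F_def using mod_prod_eq[of "\<lambda>p. ?x * p" \<pi> R] by simp
  hence "\<pi> dvd ?x ^ card R * \<Prod>R - \<Prod>R"
    by (simp add: mod_eq_dvd_iff prod.distrib)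
  moreover have "\<exists>u. \<pi> dvd u * \<Prod>R - 1"
    using finR inv
  proof (induction R rule: finite_induct)
    case (insert p R)
    from insert.prems[OF insertI1] obtain u where u: "\<pi> dvd u * p - 1" ..
    from insert.IH[OF insert.prems[OF insertI2]] obtain v where v: "\<pi> dvd v * \<Prod>R - 1" ..
    have "u * v * (p * \<Prod>R) - 1 = (u * p - 1) * (v * \<Prod>R) + (v * \<Prod>R - 1)"
      by (simp add: algebra_simps)
    also have "\<pi> dvd \<dots>" by (rule dvd_add[OF dvd_mult2[OF u] v])
    finally show ?case using insert.hyps by (intro exI[of _ "u * v"]) simp
  next
    case empty
    show ?case by (rule exI[of _ 1]) simp
  qed
  then obtain u where u: "\<pi> dvd u * \<Prod>R - 1" ..
  ultimately have "\<pi> dvd u * (?x ^ card R * \<Prod>R - \<Prod>R) - (?x ^ card R - 1) * (u * \<Prod>R - 1)"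
    using dvd_diff[OF dvd_mult dvd_mult] by simp
  also have "\<dots> = ?x ^ card R - 1" by (simp add: algebra_simps)
  finally show ?thesis by (simp add: cardR monom_power)
qed

lemma dvd_xpow_minus_1:
  assumes "a dvd b"
  shows "xpow a - 1 dvd xpow b - 1"
proof -
  obtain c where c: "b = a * c" using assms ..
  have "xpow a - 1 dvd xpow a ^ c - 1"
    by (metis dvd_triv_left power_diff_1_eq)
  thus ?thesis by (simp add: c monom_power)
qed

text \<open>The Frobenius map in characteristic 2.\<close>

lemma xpow_minus_1_power: "(xpow a - 1) ^ (2 ^ n) = xpow (a * 2 ^ n) - 1"
proof (induction n)
  case (Suc n)
  have "(xpow a - 1) ^ (2 ^ Suc n) = ((xpow a - 1) ^ (2 ^ n)) ^ 2"
    by (simp add: mult.commute flip: power_mult)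
  also have "\<dots> = (xpow (a * 2 ^ n) - 1) ^ 2" by (simp only: Suc)
  also have "\<dots> = xpow (a * 2 ^ n) ^ 2 - 1 + ((1 - xpow (a * 2 ^ n)) + (1 - xpow (a * 2 ^ n)))"
    by (simp add: power2_eq_square algebra_simps)
  also have "\<dots> = xpow (a * 2 ^ Suc n) - 1"
    unfolding bitpoly_double by (simp add: monom_power mult.commute mult.left_commute)
  finally show ?case .
qed simp

text \<open>Split off divisors of minimal degree one by one. Each of them divides \<open>X^m -
  1\<close>, where m is the product of the \<open>2^i - 1\<close>, and there are at most e of
  them, fewer than \<open>2^e\<close>. So h divides \<open>(X^m - 1)^(2^e)\<close>, and in
  characteristic 2 this is \<open>X^(m 2^e) - 1\<close>.\<close>

lemma dvd_xpow_order_mult: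
  fixes h :: "bit poly"
  assumes "h \<noteq> 0" "pcoeff h 0 \<noteq> 0" "pdeg h \<le> e"
  shows "h dvd xpow (order_mult e) - 1"
proof -
  define odd_part where "odd_part = (\<Prod>i=1..e. 2 ^ i - 1 :: nat)"
  have "h dvd (xpow odd_part - 1) ^ pdeg h"
    using assms
  proof (induction "pdeg h" arbitrary: h rule: less_induct)
    case less
    show ?case
    proof (cases "pdeg h = 0")
      case True
      thus ?thesis using less.prems is_unit_iff_degree by auto
    next
      case False
      hence "h dvd h \<and> pdeg h > 0" by simp
      from ex_has_least_nat[of "\<lambda>\<pi>. \<pi> dvd h \<and> pdeg \<pi> > 0" h pdeg, OF this]
      obtain \<pi> where \<pi>: "\<pi> dvd h" "pdeg \<pi> > 0"
        and "\<forall>d. d dvd h \<and> pdeg d > 0 \<longrightarrow> pdeg \<pi> \<le> pdeg d" by (elim exE conjE)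
      hence min: "pdeg \<pi> \<le> pdeg d" if "d dvd h" "pdeg d > 0" for d
        using that by simp
      obtain h' where h': "h = \<pi> * h'" using \<pi>(1) ..
      have "pcoeff h 0 = pcoeff \<pi> 0 * pcoeff h' 0" unfolding h' by (rule mult_pcoeff_0)
      hence c: "pcoeff \<pi> 0 \<noteq> 0" "pcoeff h' 0 \<noteq> 0" using less.prems(2) by auto
      have nz: "\<pi> \<noteq> 0" "h' \<noteq> 0" using less.prems(1) h' by auto
      have deg: "pdeg h = pdeg \<pi> + pdeg h'" using nz by (simp add: h' degree_mult_eq)
      have "\<pi> dvd xpow (2 ^ pdeg \<pi> - 1) - 1"
        by (rule minimal_divisor_dvd[OF \<pi> min c(1)])
      also have "2 ^ pdeg \<pi> - 1 dvd odd_part"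
        unfolding odd_part_def using \<pi>(2) less.prems(3) deg
        by (intro dvd_prodI[of _ "pdeg \<pi>"]) auto
      hence "xpow (2 ^ pdeg \<pi> - 1) - 1 dvd xpow odd_part - 1" by (rule dvd_xpow_minus_1)
      finally have "\<pi> dvd xpow odd_part - 1" .
      moreover have "h' dvd (xpow odd_part - 1) ^ pdeg h'"
        using less.hyps[of h'] deg \<pi>(2) nz c less.prems(3) by simp
      ultimately have "h dvd (xpow odd_part - 1) * (xpow odd_part - 1) ^ pdeg h'"
        unfolding h' by (rule mult_dvd_mono)
      also have "\<dots> = (xpow odd_part - 1) ^ Suc (pdeg h')" by simp
      also have "\<dots> dvd (xpow odd_part - 1) ^ pdeg h"
        by (rule le_imp_power_dvd) (use deg \<pi>(2) in simp)
      finally show ?thesis .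
    qed
  qed
  also have "(xpow odd_part - 1) ^ pdeg h dvd (xpow odd_part - 1) ^ (2 ^ e)"
    using assms(3) less_exp[of e] by (intro le_imp_power_dvd) linarith
  also have "\<dots> = xpow (odd_part * 2 ^ e) - 1" by (rule xpow_minus_1_power)
  also have "odd_part * 2 ^ e = order_mult e" by (simp add: order_mult_def odd_part_def mult.commute)
  finally show ?thesis .
qed

section \<open>Small finite quotients kill the witnesses\<close>

definition lift_poly :: "bit poly \<Rightarrow> laurent" where
  "lift_poly p = (\<Sum>j\<le>pdeg p. Poly_Mapping.single (int j) (pcoeff p j))"

lemma lift_poly_eq:
  assumes "pdeg p \<le> N"
  shows "lift_poly p = (\<Sum>j\<le>N. Poly_Mapping.single (int j) (pcoeff p j))"
  unfolding lift_poly_def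
  by (rule sum.mono_neutral_left) (use assms in \<open>auto simp: coeff_eq_0\<close>)

lemma lift_poly_add: "lift_poly (p + q) = lift_poly p + lift_poly q"
proof -
  let ?N = "max (pdeg p) (pdeg q)"
  have "pdeg (p + q) \<le> ?N" by (rule degree_add_le_max)
  thus ?thesis
    using lift_poly_eq[of p ?N] lift_poly_eq[of q ?N] lift_poly_eq[of "p + q" ?N]
    by (simp add: single_add sum.distrib)
qed

lemma lift_poly_pCons_0: "lift_poly (pCons 0 p) = tpow 1 * lift_poly p"
proof -
  have "lift_poly (pCons 0 p) = (\<Sum>j\<le>Suc (pdeg p). Poly_Mapping.single (int j) (pcoeff (pCons 0 p) j))"
    by (rule lift_poly_eq) (simp add: degree_pCons_le)
  also have "\<dots> = (\<Sum>j\<le>pdeg p. Poly_Mapping.single (1 + int j) (pcoeff p j))"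
    by (subst sum.atMost_Suc_shift) simp
  also have "\<dots> = tpow 1 * lift_poly p"
    unfolding lift_poly_def sum_distrib_left by (simp add: mult_single)
  finally show ?thesis .
qed

lemma lift_poly_xpow [simp]: "lift_poly (xpow n) = tpow (int n)"
  using lift_poly_eq[of "xpow n" n]
  by (simp add: degree_monom_eq if_distrib[of "Poly_Mapping.single _"] sum.delta cong: if_cong)

lemma lift_poly_0 [simp]: "lift_poly 0 = 0"
  by (simp add: lift_poly_def)

lemma lift_poly_1 [simp]: "lift_poly 1 = 1"
  using lift_poly_xpow[of 0] by (simp del: lift_poly_xpow)

lemma hall_closed: "enc g \<in> carrier hall \<Longrightarrow> enc h \<in> carrier hall \<Longrightarrow> enc (g \<odot> h) \<in> carrier hall"
  using hall.m_closed[of "enc g" "enc h"] by simp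

lemma hall_gens: "enc gx \<in> carrier hall" "enc gy \<in> carrier hall" "enc gt \<in> carrier hall"
  using fg_hall by (simp_all add: finite_generating_set_def)

lemma hall_t: "enc (k, 0, 0, 0) \<in> carrier hall"
proof -
  have pos: "enc (int n, 0, 0, 0) \<in> carrier hall" for n
  proof (induction n)
    case 0
    show ?case using hall.one_closed by (simp add: eone_def)
  next
    case (Suc n)
    from hall_closed[OF hall_gens(3) Suc] show ?case by (simp add: gt_def)
  qed
  have neg: "enc (- int n, 0, 0, 0) \<in> carrier hall" for n
    using hall.inv_closed[OF pos[of n]] hall_inv[OF pos[of n]] by simp
  show ?thesis
  proof (cases "k \<ge> 0")
    case True
    thus ?thesis using pos[of "nat k"] by simp
  next
    case False
    thus ?thesis using neg[of "nat (- k)"] by simp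
  qed
qed

lemma hall_x: "enc (0, a, 0, 0) \<in> carrier hall"
proof (induction a rule: laurent_induct)
  case zero
  show ?case using hall_t[of 0] .
next
  case (add k a)
  have "enc ((- k, 0, 0, 0) \<odot> gx \<odot> (k, 0, 0, 0)) \<in> carrier hall"
    by (intro hall_closed hall_t hall_gens)
  hence "enc (0, tpow k, 0, 0) \<in> carrier hall" by (simp add: gx_def)
  from hall_closed[OF add this] show ?case by simp
qed

lemma \<rho>_one [simp]: "\<rho> 1 = 1"
  using \<rho>_tpow[of 0] by (simp add: \<phi>_small)

text \<open>The factors \<open>(0, a, 0, 0)\<close> and y are involutions, so this product is their
  commutator. An element with entry \<open>a\<close> that dies in a quotient thus takes the
  central element \<open>\<rho> a\<close> with it.\<close>

lemma central_commutator: "(0, a, 0, 0) \<odot> gy \<odot> (0, a, 0, 0) \<odot> gy = (0, 0, 0, \<rho> a)"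
  by (simp add: gy_def)

text \<open>This is \<open>z\<^sub>k / z\<^sub>0\<close> for \<open>k = near s\<close>.\<close>

definition witness :: "nat \<Rightarrow> nat" where
  "witness s = enc (0, 0, 0, tpow (int (near s)) + 1)"

lemma witness_closed: "witness s \<in> carrier hall"
proof -
  have "enc ((0, tpow (int (near s)) + 1, 0, 0) \<odot> gy \<odot> (0, tpow (int (near s)) + 1, 0, 0) \<odot> gy) \<in> carrier hall"
    by (intro hall_closed hall_x hall_gens)
  thus ?thesis unfolding central_commutator
    by (simp add: witness_def)
qed

lemma witness_neq_one: "witness s \<noteq> \<one>\<^bsub>hall\<^esub>"
proof
  assume "witness s = \<one>\<^bsub>hall\<^esub>"
  hence "tpow (int (near s)) + tpow 0 = 0"
    by (simp add: witness_def eone_def)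
  hence "near s = 0" unfolding laurent_add_eq_0_iff tpow_inj by simp
  thus False using near_ge[of s] by simp
qed

text \<open>In a quotient of order less than \<open>2^e\<close>, two of the \<open>2^e\<close>
  polynomials of degree below e give the same conjugate product of \<open>x\<close>. Hence the
  polynomials f such that \<open>x^f\<close> dies form a nonzero ideal J with an element of
  degree below e, so J contains \<open>t^far s - 1\<close>. The commutator of this element
  with \<open>y\<close> dies too, and by the identification of \<open>far s\<close> with
  \<open>near s\<close> it is the witness.\<close>

theorem witness_quotient_order:
  assumes "separating_hom hall (witness s) Q \<psi>"
  shows "2 ^ scale (2 * s + 3) \<le> card (carrier Q)"
proof (rule ccontr)
  define e where "e = scale (2 * s + 3)"
  assume "\<not> 2 ^ scale (2 * s + 3) \<le> card (carrier Q)"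
  hence small: "card (carrier Q) < 2 ^ e" by (simp add: e_def)
  have e0: "e > 0" using scale_ge_2[of "2 * s + 3"] by (simp add: e_def)
  interpret Q: group Q using assms by (simp add: separating_hom_def)
  have finQ: "finite (carrier Q)" and hom: "\<psi> \<in> hom hall Q" and sep: "\<psi> (witness s) \<noteq> \<one>\<^bsub>Q\<^esub>"
    using assms by (simp_all add: separating_hom_def)
  interpret \<psi>: group_hom hall Q \<psi>
    by (intro group_hom.intro group_hom_axioms.intro hall.is_group Q.is_group hom)
  have mult: "\<psi> (enc (g \<odot> h)) = \<psi> (enc g) \<otimes>\<^bsub>Q\<^esub> \<psi> (enc h)"
    if "enc g \<in> carrier hall" "enc h \<in> carrier hall" for g h
    using \<psi>.hom_mult[OF that] by simp
  define u where "u a = \<psi> (enc (0, a, 0, 0))" for a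
  have u_closed: "u a \<in> carrier Q" for a unfolding u_def by (rule \<psi>.hom_closed[OF hall_x])
  have u_add: "u (a + b) = u b \<otimes>\<^bsub>Q\<^esub> u a" for a b
    unfolding u_def using mult[OF hall_x[of b] hall_x[of a]] by simp
  have u_0: "u 0 = \<one>\<^bsub>Q\<^esub>"
    unfolding u_def using \<psi>.hom_one by (simp add: eone_def)
  have u_tpow: "u (tpow k * a) = \<one>\<^bsub>Q\<^esub>" if "u a = \<one>\<^bsub>Q\<^esub>" for k a
  proof -
    let ?p = "\<psi> (enc (- k, 0, 0, 0))" and ?q = "\<psi> (enc (k, 0, 0, 0))"
    have "\<psi> (enc ((- k, 0, 0, 0) \<odot> (0, a, 0, 0) \<odot> (k, 0, 0, 0))) = ?p \<otimes>\<^bsub>Q\<^esub> u a \<otimes>\<^bsub>Q\<^esub> ?q"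
      unfolding u_def by (simp only: mult hall_closed hall_t hall_x)
    also have "\<dots> = \<psi> (enc ((- k, 0, 0, 0) \<odot> (k, 0, 0, 0)))"
      by (simp only: that mult hall_t Q.r_one \<psi>.hom_closed)
    also have "(- k, 0, 0, 0) \<odot> (k, 0, 0, 0) = (0, 0, 0, 0)" by simp
    also have "\<psi> (enc (0, 0, 0, 0)) = \<one>\<^bsub>Q\<^esub>" using u_0 by (simp add: u_def)
    finally show ?thesis by (simp add: u_def mult.commute)
  qed
  define J where "J = {p. u (lift_poly p) = \<one>\<^bsub>Q\<^esub>}"
  have J_add: "p + q \<in> J" if "p \<in> J" "q \<in> J" for p q
    using that by (simp add: J_def lift_poly_add u_add)
  have J_x: "pCons 0 p \<in> J" if "p \<in> J" for p
    using that by (simp add: J_def lift_poly_pCons_0 u_tpow)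
  have J_mult: "q * p \<in> J" if "p \<in> J" for p q
  proof (induction q)
    case 0
    show ?case by (simp add: J_def u_0)
  next
    case (pCons c q)
    have "Polynomial.smult c p \<in> J"
      using that by (cases c) (simp_all add: J_def u_0)
    thus ?case using J_add J_x[OF pCons.IH] by simp
  qed
  \<comment> \<open>Pigeonhole: there are more polynomials of degree below e than elements of the quotient.\<close>
  have "\<exists>h. h \<in> J \<and> h \<noteq> 0 \<and> pdeg h < e"
  proof -
    let ?R = "{p. pdeg p < e}"
    have "card (carrier Q) < card ?R" using small card_bitpoly(2)[OF e0] by simp
    moreover have "(\<lambda>p. u (lift_poly p)) ` ?R \<subseteq> carrier Q" using u_closed by auto
    hence "card ((\<lambda>p. u (lift_poly p)) ` ?R) \<le> card (carrier Q)" by (rule card_mono[OF finQ])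
    ultimately have "card ((\<lambda>p. u (lift_poly p)) ` ?R) < card ?R" by linarith
    hence "\<not> inj_on (\<lambda>p. u (lift_poly p)) ?R" using card_image by force
    then obtain p q where pq: "pdeg p < e" "pdeg q < e" "u (lift_poly p) = u (lift_poly q)" "p \<noteq> q"
      unfolding inj_on_def by auto
    have "u (lift_poly (p + q)) = u (lift_poly (q + q))"
      by (simp only: lift_poly_add u_add pq(3))
    hence "p + q \<in> J" by (simp only: J_def mem_Collect_eq bitpoly_double lift_poly_0 u_0)
    moreover have "p + q \<noteq> 0"
      using pq(4) by (metis add.assoc add.left_neutral add.right_neutral bitpoly_double)
    moreover have "pdeg (p + q) < e" using pq by (intro degree_add_less)
    ultimately show ?thesis by blast
  qed
  then obtain h0 where h0: "h0 \<in> J \<and> h0 \<noteq> 0" "pdeg h0 < e" by (elim exE conjE) simp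
  from ex_has_least_nat[of "\<lambda>h. h \<in> J \<and> h \<noteq> 0" h0 pdeg, OF h0(1)]
  obtain h where h: "h \<in> J" "h \<noteq> 0" "\<forall>g. g \<in> J \<and> g \<noteq> 0 \<longrightarrow> pdeg h \<le> pdeg g"
    by (elim exE conjE)
  \<comment> \<open>An element of J of least degree is not divisible by the variable, because t acts
    invertibly.\<close>
  have "pdeg h \<le> pdeg h0" using h(3) h0(1) by (simp only: simp_thms)
  hence "pdeg h \<le> e" using h0(2) by linarith
  moreover have "pcoeff h 0 \<noteq> 0"
  proof
    assume "pcoeff h 0 = 0"
    then obtain g where g: "h = pCons 0 g" by (cases h) auto
    have "u (tpow (- 1) * lift_poly h) = \<one>\<^bsub>Q\<^esub>"
      using h(1) by (intro u_tpow) (simp add: J_def)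
    hence "g \<in> J" by (simp add: g lift_poly_pCons_0 J_def)
    moreover have "g \<noteq> 0" using h(2) g by auto
    ultimately have "pdeg h \<le> pdeg g" using h(3) by (simp only: simp_thms)
    thus False using g \<open>g \<noteq> 0\<close> by simp
  qed
  ultimately have "h dvd xpow (order_mult e) - 1" using h(2) by (intro dvd_xpow_order_mult)
  then obtain q where "xpow (order_mult e) - 1 = h * q" by (rule dvdE)
  hence "xpow (order_mult e) - 1 = q * h" by (simp only: mult.commute)
  hence "xpow (order_mult e) + 1 \<in> J"
    using J_mult[OF h(1), of q] by (simp only: bitpoly_diff)
  hence u1: "u (tpow (int (order_mult e)) + 1) = \<one>\<^bsub>Q\<^esub>"
    by (simp add: J_def lift_poly_add)
  have "witness s = enc ((0, tpow (int (order_mult e)) + 1, 0, 0) \<odot> gy \<odot> (0, tpow (int (order_mult e)) + 1, 0, 0) \<odot> gy)"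
    unfolding central_commutator e_def far_def[symmetric]
    by (simp add: witness_def)
  hence "\<psi> (witness s) = u (tpow (int (order_mult e)) + 1) \<otimes>\<^bsub>Q\<^esub> \<psi> (enc gy) \<otimes>\<^bsub>Q\<^esub> u (tpow (int (order_mult e)) + 1) \<otimes>\<^bsub>Q\<^esub> \<psi> (enc gy)"
    unfolding u_def by (simp only: mult hall_closed hall_gens hall_x)
  also have "\<dots> = \<psi> (enc (gy \<odot> gy))"
    by (simp add: u1 mult hall_gens \<psi>.hom_closed)
  also have "gy \<odot> gy = eone" by (simp add: gy_def eone_def)
  also have "\<psi> (enc eone) = \<one>\<^bsub>Q\<^esub>" using \<psi>.hom_one by simp
  finally show False using sep by simp
qed

section \<open>Finite fields of characteristic two\<close>

text \<open>An algebraic closure contains all finite fields of characteristic 2 at once.\<close>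

type_synonym K = "bit alg_closure"

lemma K_double [simp]: "(z :: K) + z = 0"
proof -
  have "(1 :: K) + 1 = to_ac (1 + 1)" by (simp only: to_ac_add to_ac_1)
  hence "(1 :: K) + 1 = 0" by (simp only: bit_add_self to_ac_0)
  hence "z * (1 + 1) = 0" by simp
  thus ?thesis by (simp only: distrib_left mult_1_right)
qed

lemma K_two [simp]: "(2 :: K) = 0"
  by (metis K_double one_add_one)

lemma K_add_eq_0_iff: "(x :: K) + y = 0 \<longleftrightarrow> x = y"
  by (metis K_double add_left_cancel)

definition frob_fixed :: "nat \<Rightarrow> K set" where "frob_fixed r = {z. z ^ (2 ^ r) = z}"
definition unit_roots :: "nat \<Rightarrow> K set" where "unit_roots r = {z. z ^ (2 ^ r - 1) = 1}"

lemma K_frobenius: "((x :: K) + y) ^ (2 ^ r) = x ^ (2 ^ r) + y ^ (2 ^ r)"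
proof (induction r)
  case (Suc r)
  have "(x + y) ^ (2 ^ Suc r) = ((x + y) ^ (2 ^ r)) ^ 2"
    by (simp add: mult.commute flip: power_mult)
  also have "\<dots> = (x ^ (2 ^ r)) ^ 2 + (y ^ (2 ^ r)) ^ 2"
    by (simp add: Suc power2_sum)
  finally show ?case by (simp add: mult.commute flip: power_mult)
qed simp

lemma frob_fixed_0 [simp]: "0 \<in> frob_fixed r" by (simp add: frob_fixed_def)

lemma frob_fixed_add: "x \<in> frob_fixed r \<Longrightarrow> y \<in> frob_fixed r \<Longrightarrow> x + y \<in> frob_fixed r"
  by (simp add: frob_fixed_def K_frobenius)

lemma finite_frob_fixed: "finite (frob_fixed r)" and card_frob_fixed: "card (frob_fixed r) \<le> 2 ^ r" if "r > 0"
proof -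
  let ?p = "Polynomial.monom 1 (2 ^ r) - Polynomial.monom 1 1 :: K poly"
  have frob_fixed: "frob_fixed r = {z. poly ?p z = 0}"
    by (simp add: frob_fixed_def poly_monom)
  have "(1::nat) < 2 ^ r" by (rule one_less_power) (use that in simp_all)
  hence ne: "1 \<noteq> (2::nat) ^ r" by linarith
  have "Polynomial.coeff ?p (2 ^ r) = 1"
    by (simp only: coeff_diff coeff_monom refl ne if_True if_False diff_zero)
  hence nz: "?p \<noteq> 0" by (metis coeff_0 zero_neq_one)
  have deg: "Polynomial.degree ?p \<le> 2 ^ r"
    by (rule degree_diff_le) (simp_all add: degree_monom_eq)
  show "finite (frob_fixed r)" unfolding frob_fixed by (rule poly_roots_finite[OF nz])
  show "card (frob_fixed r) \<le> 2 ^ r" unfolding frob_fixed using card_poly_roots_bound[OF nz] deg by simp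
qed

lemma unit_roots_nonzero: "r > 0 \<Longrightarrow> z \<in> unit_roots r \<Longrightarrow> z \<noteq> 0"
  using one_less_power[of "2::nat" r] by (auto simp: unit_roots_def power_0_left)

lemma unit_roots_frob_fixed: "z \<in> unit_roots r \<Longrightarrow> z \<in> frob_fixed r"
proof -
  assume "z \<in> unit_roots r"
  hence 1: "z ^ (2 ^ r - 1) = 1" by (simp only: unit_roots_def mem_Collect_eq)
  have "Suc (2 ^ r - 1) = (2 :: nat) ^ r" by simp
  hence "z ^ (2 ^ r) = z * z ^ (2 ^ r - 1)" by (simp only: flip: power_Suc)
  thus "z \<in> frob_fixed r" unfolding 1 by (simp add: frob_fixed_def)
qed

lemma frob_fixed_powi:
  assumes "z \<in> unit_roots r"
  shows "z powi k \<in> frob_fixed r"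
proof -
  have "(z powi k) ^ 2 ^ r = (z ^ 2 ^ r) powi k"
    by (simp only: power_int_power power_int_power' mult.commute)
  also have "z ^ 2 ^ r = z" using unit_roots_frob_fixed[OF assms] by (simp add: frob_fixed_def)
  finally show ?thesis by (simp add: frob_fixed_def)
qed

text \<open>The polynomial \<open>X^n - 1\<close> with odd n splits over K. A repeated root would be a
  root of its derivative \<open>X^(n - 1)\<close>, that is 0, but 0 is not a root.\<close>

lemma card_unit_roots:
  assumes "r > 0"
  shows "card (unit_roots r) = 2 ^ r - 1" "finite (unit_roots r)"
proof -
  define n where "n = (2::nat) ^ r - 1"
  have n: "odd n" "n > 0" using assms one_less_power[of "2::nat" r] by (auto simp: n_def)
  define p :: "K poly" where "p = Polynomial.monom 1 n - 1"
  have unit_roots: "unit_roots r = {z. poly p z = 0}"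
    by (simp add: unit_roots_def p_def poly_monom n_def)
  have deg: "Polynomial.degree p = n"
    unfolding p_def using n degree_add_eq_left[of "- 1" "Polynomial.monom (1 :: K) n"]
    by (simp add: degree_monom_eq)
  hence "p \<noteq> 0" using n by auto
  then obtain A where A: "size A = Polynomial.degree p"
      "p = Polynomial.smult (Polynomial.lead_coeff p) (\<Prod>x\<in>#A. [:-x, 1:])"
    using alg_closed_imp_factorization by blast
  have roots: "set_mset A = {z. poly p z = 0}"
  proof -
    have lc: "Polynomial.lead_coeff p \<noteq> 0" using \<open>p \<noteq> 0\<close> by simp
    have "poly p z = 0 \<longleftrightarrow> z \<in># A" for z
      by (subst A(2)) (use lc in \<open>auto simp: poly_prod_mset prod_mset_zero_iff\<close>)
    thus ?thesis by auto
  qed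
  have of_nat_n: "(of_nat n :: K) = 1"
  proof -
    obtain m where "n = 2 * m + 1" using n(1) by (elim oddE)
    thus ?thesis by simp
  qed
  have "count A z \<le> 1" for z
  proof (rule ccontr)
    assume "\<not> count A z \<le> 1"
    hence "count A z \<ge> 2" by simp
    hence "{#z, z#} \<subseteq># A" by (simp add: subseteq_mset_def)
    then obtain B where B: "A = {#z, z#} + B" by (metis subset_mset.le_iff_add)
    define q where "q = Polynomial.smult (Polynomial.lead_coeff p) (\<Prod>x\<in>#B. [:-x, 1:])"
    have "(\<Prod>x\<in>#A. [:-x, 1:]) = [:-z, 1:] * ([:-z, 1:] * (\<Prod>x\<in>#B. [:-x, 1:]))"
      by (simp add: B)
    moreover define L where "L = [:-z, 1:]"
    ultimately have p: "p = L * (L * q)"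
      using A(2) by (simp only: q_def mult_smult_right)
    have "poly L z = 0" by (simp add: L_def)
    hence "poly (pderiv p) z = 0"
      by (simp add: p pderiv_mult)
    moreover have "pderiv p = Polynomial.monom (of_nat n) (n - 1)"
      by (simp add: p_def pderiv_diff pderiv_monom)
    ultimately have "z ^ (n - 1) = 0" by (simp add: of_nat_n poly_monom)
    hence "z = 0" by simp
    moreover have "poly p z = 0" using roots B by auto
    ultimately show False using n by (simp add: p_def poly_monom power_0_left)
  qed
  hence le1: "count A z \<le> 1" for z .
  have "A = mset_set (set_mset A)"
  proof (rule multiset_eqI)
    fix z
    show "count A z = count (mset_set (set_mset A)) z"
    proof (cases "z \<in># A")
      case True
      hence "count A z > 0" by simp
      hence "count A z = 1" using le1[of z] by linarith
      thus ?thesis using True by simp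
    next
      case False
      thus ?thesis by (simp add: not_in_iff)
    qed
  qed
  hence "size A = card (set_mset A)" by (metis size_mset_set)
  thus "card (unit_roots r) = 2 ^ r - 1" using A(1) deg roots by (simp add: unit_roots n_def)
  show "finite (unit_roots r)" unfolding unit_roots by (rule poly_roots_finite[OF \<open>p \<noteq> 0\<close>])
qed

section \<open>Evaluating Laurent polynomials\<close>

definition ev :: "K \<Rightarrow> laurent \<Rightarrow> K" where
  "ev z = lin_ext (\<lambda>k. z powi k)"

lemma ev_add [simp]: "ev z (a + b) = ev z a + ev z b"
  unfolding ev_def by (rule lin_ext_add) simp

lemma ev_0 [simp]: "ev z 0 = 0" by (simp add: ev_def)

lemma ev_tpow [simp]: "ev z (tpow k) = z powi k" by (simp add: ev_def)

lemma ev_1 [simp]: "ev z 1 = 1"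
  using ev_tpow[of z 0] by (simp del: ev_tpow)

lemma ev_mult:
  assumes "z \<noteq> 0"
  shows "ev z (a * b) = ev z a * ev z b"
proof (rule additive_eqI[where f = "\<lambda>a. ev z (a * b)"])
  fix k
  show "ev z (tpow k * b) = ev z (tpow k) * ev z b"
    by (rule additive_eqI[where f = "\<lambda>b. ev z (tpow k * b)"])
       (simp_all add: distrib_left power_int_add assms)
qed (simp_all add: distrib_right)

lemma ev_frob_fixed:
  assumes "z \<in> unit_roots r"
  shows "ev z a \<in> frob_fixed r"
proof (induction a rule: laurent_induct)
  case (add k a)
  thus ?case using frob_fixed_powi[OF assms] by (simp add: frob_fixed_add)
qed simp

lemma ev_sum: "finite B \<Longrightarrow> ev z (sum f B) = (\<Sum>s\<in>B. ev z (f s))"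
  by (induction B rule: finite_induct) simp_all

text \<open>Multiplication by \<open>z^N\<close> turns b into a polynomial of degree at most \<open>2
  N\<close>.\<close>

lemma card_roots_le:
  assumes "b \<noteq> 0" "supp_within N b" "0 \<notin> S"
  shows "card {z \<in> S. ev z b = 0} \<le> 2 * N"
proof -
  define P :: "K poly" where "P = (\<Sum>k\<in>supp b. Polynomial.monom 1 (nat (k + int N)))"
  have nn: "k + int N \<ge> 0" "nat (k + int N) \<le> 2 * N" if "k \<in> supp b" for k
  proof -
    have "k \<in> {- int N..int N}" using that assms(2) unfolding supp_within_def by (rule subsetD[rotated])
    thus "k + int N \<ge> 0" "nat (k + int N) \<le> 2 * N" by auto
  qed
  have "Polynomial.coeff P (nat (k + int N)) = 1" if k: "k \<in> supp b" for k
  proof -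
    have "nat (l + int N) = nat (k + int N) \<longleftrightarrow> l = k" if "l \<in> supp b" for l
      using nn(1)[OF that] nn(1)[OF k] by linarith
    hence "Polynomial.coeff P (nat (k + int N)) = (\<Sum>l\<in>supp b. if l = k then 1 else 0)"
      unfolding P_def coeff_sum by (intro sum.cong) simp_all
    also have "\<dots> = 1" using k by simp
    finally show ?thesis .
  qed
  moreover obtain k where "k \<in> supp b" using assms(1) by (metis ex_in_conv keys_eq_empty)
  ultimately have "P \<noteq> 0" by (metis coeff_0 zero_neq_one)
  have "Polynomial.degree P \<le> 2 * N"
    unfolding P_def by (rule degree_sum_le) (auto simp: degree_monom_eq intro: nn)
  have "{z \<in> S. ev z b = 0} \<subseteq> {z. poly P z = 0}"
  proof
    fix z assume z: "z \<in> {z \<in> S. ev z b = 0}"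
    hence z0: "z \<noteq> 0" using assms(3) by auto
    have "poly P z = (\<Sum>k\<in>supp b. z ^ N * z powi k)"
      unfolding P_def poly_sum
    proof (rule sum.cong)
      fix k assume "k \<in> supp b"
      hence "z ^ nat (k + int N) = z powi (k + int N)"
        using nn(1) by (simp add: power_int_def)
      thus "poly (Polynomial.monom 1 (nat (k + int N))) z = z ^ N * z powi k"
        using z0 by (simp add: poly_monom power_int_add)
    qed simp
    also have "\<dots> = z ^ N * ev z b"
      by (simp add: ev_def lin_ext_def sum_distrib_left)
    finally show "z \<in> {z. poly P z = 0}" using z by simp
  qed
  hence "card {z \<in> S. ev z b = 0} \<le> card {z. poly P z = 0}"
    by (rule card_mono[OF poly_roots_finite[OF \<open>P \<noteq> 0\<close>]])
  also have "\<dots> \<le> 2 * N"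
    using card_poly_roots_bound[OF \<open>P \<noteq> 0\<close>] \<open>Polynomial.degree P \<le> 2 * N\<close> by linarith
  finally show ?thesis .
qed

lemma ex_nonroot:
  assumes "b \<noteq> 0" "supp_within N b" "r > 0" "2 * N < 2 ^ r - 1"
  shows "\<exists>z\<in>unit_roots r. ev z b \<noteq> 0"
proof (rule ccontr)
  assume "\<not> (\<exists>z\<in>unit_roots r. ev z b \<noteq> 0)"
  hence "{z \<in> unit_roots r. ev z b = 0} = unit_roots r" by auto
  moreover have "0 \<notin> unit_roots r" using unit_roots_nonzero[OF assms(3)] by auto
  ultimately have "card (unit_roots r) \<le> 2 * N" using card_roots_le[OF assms(1,2)] by metis
  thus False using assms(4) card_unit_roots(1)[OF assms(3)] by simp
qed

section \<open>Separating elements in small quotients\<close>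

lemma \<rho>_idem [simp]: "\<rho> (\<rho> a) = \<rho> a"
proof (rule additive_eqI[where f = "\<lambda>a. \<rho> (\<rho> a)"])
  fix k
  have "\<phi> (\<phi> k) = \<phi> k" by (rule \<phi>_other) auto
  thus "\<rho> (\<rho> (tpow k)) = \<rho> (tpow k)" by simp
qed simp_all

lemma coef_\<rho>_far: "coef (\<rho> a) (int (far s)) = 0"
  by (induction a rule: laurent_induct) (simp_all add: lookup_add lookup_tpow)

text \<open>The central entry of every group element is in normal form, because only normal forms are
  ever added to it.\<close>

lemma hall_\<rho>: "n \<in> carrier hall \<Longrightarrow> \<rho> (snd (snd (snd (dec n)))) = snd (snd (snd (dec n)))"
proof -
  let ?H = "{n. \<rho> (snd (snd (snd (dec n)))) = snd (snd (snd (dec n)))}"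
  have "subgroup ?H big_group"
  proof (rule big_group.subgroupI)
    fix m assume m: "m \<in> ?H"
    thus "inv\<^bsub>big_group\<^esub> m \<in> ?H" by (cases "dec m") simp
    fix n assume "n \<in> ?H"
    thus "m \<otimes>\<^bsub>big_group\<^esub> n \<in> ?H" using m by (cases "dec m"; cases "dec n") simp
  next
    have "enc eone \<in> ?H" by (simp add: eone_def)
    thus "?H \<noteq> {}" by blast
  qed simp
  moreover have "enc ` {gx, gy, gt} \<subseteq> ?H"
    by (simp add: gx_def gy_def gt_def)
  ultimately have "generate big_group (enc ` {gx, gy, gt}) \<subseteq> ?H"
    by (intro big_group.generate_subgroup_incl)
  moreover assume "n \<in> carrier hall"
  ultimately show ?thesis unfolding hall_def by auto
qed

definition bounded_by :: "nat \<Rightarrow> elem \<Rightarrow> bool" where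
  "bounded_by N g \<longleftrightarrow> (case g of (k, a, b, c) \<Rightarrow>
     \<bar>k\<bar> \<le> int N \<and> supp_within N a \<and> supp_within N b \<and> supp_within N c)"

text \<open>Supports of products lie in sums of supports, and \<open>\<rho>\<close> never increases the
  absolute value of an exponent. Hence a bound for the generators gives a bound that is linear
  in the length of a word.\<close>

lemma bounded_by_mult:
  assumes "bounded_by N g" "bounded_by N' h"
  shows "bounded_by (N + N') (g \<odot> h)"
proof -
  obtain k a b c k' a' b' c' where gh: "g = (k, a, b, c)" "h = (k', a', b', c')"
    by (cases g; cases h) blast
  have m: "supp_within N u \<Longrightarrow> supp_within (N + N') u" "supp_within N' u \<Longrightarrow> supp_within (N + N') u" for u
    by (erule supp_within_mono, simp)+
  have "supp_within (N + N') (a * tpow k')" "supp_within (N + N') (tpow k * b')" "supp_within (N + N') (a * b')"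
    using assms by (auto simp: gh bounded_by_def intro!: supp_within_mult supp_within_tpow)
  thus ?thesis using assms
    by (auto simp: gh bounded_by_def intro!: supp_within_add supp_within_\<rho> intro: m)
qed

lemma bounded_by_mono: "bounded_by N g \<Longrightarrow> N \<le> N' \<Longrightarrow> bounded_by N' g"
  by (cases g) (auto simp: bounded_by_def intro: supp_within_mono)

lemma ex_bounded_by: "\<exists>N. bounded_by N g"
proof -
  obtain k a b c where g: "g = (k, a, b, c)" by (cases g)
  obtain Na Nb Nc where "supp_within Na a" "supp_within Nb b" "supp_within Nc c"
    using ex_supp_within by metis
  hence "bounded_by (nat \<bar>k\<bar> + Na + Nb + Nc) g"
    by (auto simp: g bounded_by_def intro: supp_within_mono)
  thus ?thesis ..
qed

text \<open>The central elements that are identified with 1 become, after evaluation at z, the subgroup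
  that has to be factored out of the last coordinate.\<close>

definition rel_values :: "K \<Rightarrow> K set" where "rel_values z = ev z ` {d. \<rho> d = 0}"

lemma rel_values_add: "x \<in> rel_values z \<Longrightarrow> y \<in> rel_values z \<Longrightarrow> x + y \<in> rel_values z"
proof -
  assume "x \<in> rel_values z" "y \<in> rel_values z"
  then obtain d e where "x = ev z d" "y = ev z e" "\<rho> d = 0" "\<rho> e = 0" by (auto simp: rel_values_def)
  thus ?thesis unfolding rel_values_def by (intro image_eqI[of _ _ "d + e"]) simp_all
qed

lemma rel_values_0: "0 \<in> rel_values z"
  unfolding rel_values_def by (intro image_eqI[of _ _ 0]) simp_all

lemma rel_values_\<rho>: "ev z a + ev z (\<rho> a) \<in> rel_values z"
  unfolding rel_values_def by (intro image_eqI[of _ _ "a + \<rho> a"]) simp_all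

lemma rel_values_coset_eq_iff: "(+) x ` rel_values z = (+) y ` rel_values z \<longleftrightarrow> x + y \<in> rel_values z"
proof
  assume "(+) x ` rel_values z = (+) y ` rel_values z"
  moreover have "x + 0 \<in> (+) x ` rel_values z" using rel_values_0 by (rule imageI)
  ultimately obtain u where u: "u \<in> rel_values z" "x = y + u" by auto
  have "x + y = (y + y) + u" unfolding u(2) by (simp only: ac_simps)
  thus "x + y \<in> rel_values z" using u(1) by simp
next
  have *: "(+) x ` rel_values z \<subseteq> (+) y ` rel_values z" if "x + y \<in> rel_values z" for x y
  proof
    fix v assume "v \<in> (+) x ` rel_values z"
    then obtain u where u: "u \<in> rel_values z" "v = x + u" by auto
    have v: "v = y + ((x + y) + u)"
      unfolding u(2) by (metis (no_types) K_double add.assoc add.commute add.right_neutral)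
    show "v \<in> (+) y ` rel_values z" using v rel_values_add[OF that u(1)] by (rule image_eqI[of v "(+) y"])
  qed
  assume "x + y \<in> rel_values z"
  moreover from this have "y + x \<in> rel_values z" by (simp only: add.commute)
  ultimately show "(+) x ` rel_values z = (+) y ` rel_values z" using * by (intro equalityI)
qed

definition rel_elem :: "nat \<Rightarrow> laurent" where
  "rel_elem s = tpow (int (near s)) + tpow (int (far s))"

text \<open>Add \<open>\<rho> d = 0\<close> to d, monomial by monomial: only the exponents \<open>far
  s\<close> contribute, each with the element \<open>t^near s + t^far s\<close>.\<close>

lemma ker_\<rho>:
  assumes "\<rho> d = 0"
  shows "\<exists>B. finite B \<and> d = (\<Sum>s\<in>B. rel_elem s)"
proof -
  define B where "B = {s. int (far s) \<in> supp d}"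
  have inj: "inj_on (\<lambda>s. int (far s)) B" by (rule inj_onI) simp
  have "finite ((\<lambda>s. int (far s)) ` B)" by (rule finite_subset[of _ "supp d"]) (auto simp: B_def)
  hence fin: "finite B" using inj by (rule finite_imageD)
  have id: "lin_ext tpow d = d"
    by (rule additive_eqI[where g = "\<lambda>a. a"]) (simp_all add: lin_ext_add)
  have "d = lin_ext tpow d + \<rho> d" using id assms by simp
  also have "\<dots> = (\<Sum>k\<in>supp d. tpow k + tpow (\<phi> k))"
    by (simp add: lin_ext_def \<rho>_def sum.distrib)
  also have "\<dots> = (\<Sum>k\<in>(\<lambda>s. int (far s)) ` B. tpow k + tpow (\<phi> k))"
  proof (rule sum.mono_neutral_right)
    show "\<forall>k\<in>supp d - (\<lambda>s. int (far s)) ` B. tpow k + tpow (\<phi> k) = 0"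
    proof
      fix k assume "k \<in> supp d - (\<lambda>s. int (far s)) ` B"
      hence "k \<notin> int ` range far" by (auto simp: B_def)
      thus "tpow k + tpow (\<phi> k) = 0" by (simp add: \<phi>_other)
    qed
  qed (auto simp: B_def)
  also have "\<dots> = (\<Sum>s\<in>B. rel_elem s)"
    by (simp add: sum.reindex[OF inj] rel_elem_def add.commute)
  finally show ?thesis using fin by blast
qed

lemma unit_roots_powi_order_mult:
  assumes "z \<in> unit_roots r" "r > 0" "r \<le> r'"
  shows "z powi int (order_mult r') = 1"
proof -
  have "2 ^ r - 1 dvd order_mult r'" using assms by (intro order_mult_dvd) simp_all
  then obtain q where q: "order_mult r' = (2 ^ r - 1) * q" ..
  have "z ^ (2 ^ r - 1) = 1" using assms(1) by (simp only: unit_roots_def mem_Collect_eq)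
  thus ?thesis by (simp only: q power_int_of_nat power_mult power_one)
qed

lemma scale_pos: "scale j > 0" using scale_ge_2[of j] by simp

lemma scale_le_iff: "scale i \<le> scale j \<longleftrightarrow> i \<le> j"
  using scale_strict_mono by (simp add: strict_mono_less_eq)

text \<open>What the s-th relation looks like in the field with \<open>2^(scale j)\<close> elements,
  where \<open>t^far s\<close> becomes 1 as soon as \<open>2 s + 3 \<ge> j\<close>. All
  exponents left are small compared with the size of the field.\<close>

definition reduced_elem :: "nat \<Rightarrow> nat \<Rightarrow> laurent" where
  "reduced_elem j s = tpow (int (near s)) + (if 2 * s + 3 < j then tpow (int (far s)) else 1)"

lemma ev_rel_elem:
  assumes "z \<in> unit_roots (scale j)"
  shows "ev z (rel_elem s) = (if 2 * s < j then ev z (reduced_elem j s) else 0)"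
proof -
  have 1: "z powi int (near s) = 1" if "j \<le> 2 * s"
    unfolding near_def by (rule unit_roots_powi_order_mult[OF assms scale_pos]) (simp add: scale_le_iff that)
  have 2: "z powi int (far s) = 1" if "j \<le> 2 * s + 3"
    unfolding far_def by (rule unit_roots_powi_order_mult[OF assms scale_pos]) (simp add: scale_le_iff that)
  show ?thesis
    using 1 2 by (cases "j \<le> 2 * s"; cases "j \<le> 2 * s + 3")
      (simp_all add: rel_elem_def reduced_elem_def not_less[symmetric] del: power_int_of_nat)
qed

text \<open>Relations with \<open>2 s \<ge> j\<close> evaluate to \<open>1 + 1 = 0\<close>, so a subset
  of the finitely many others describes the value.\<close>

lemma rel_values_finite_description:
  assumes "z \<in> unit_roots (scale j)" "x \<in> rel_values z"
  shows "\<exists>B \<subseteq> {s. 2 * s < j}. x = ev z (\<Sum>s\<in>B. reduced_elem j s)"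
proof -
  obtain d where d: "x = ev z d" "\<rho> d = 0" using assms(2) by (auto simp: rel_values_def)
  then obtain B where B: "finite B" "d = (\<Sum>s\<in>B. rel_elem s)" using ker_\<rho> by metis
  have "x = (\<Sum>s\<in>B. if 2 * s < j then ev z (reduced_elem j s) else 0)"
    by (simp only: d(1) B(2) ev_sum[OF B(1)] ev_rel_elem[OF assms(1)])
  also have "\<dots> = (\<Sum>s\<in>{s \<in> B. 2 * s < j}. ev z (reduced_elem j s))"
    using B(1) by (simp add: sum.inter_filter)
  also have "\<dots> = ev z (\<Sum>s\<in>{s \<in> B. 2 * s < j}. reduced_elem j s)"
    using B(1) by (simp add: ev_sum)
  finally show ?thesis by (intro exI[of _ "{s \<in> B. 2 * s < j}"]) auto
qed

text \<open>Left: at most \<open>2^j\<close> Laurent polynomials with exponents bounded by the largest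
  exponent below the scale j have at most so many roots altogether. Right: the number of
  nonzero elements of the field.\<close>

lemma size_estimate:
  assumes "j \<ge> 2"
  shows "2 ^ j * (2 * order_mult (scale (j - 1))) < 2 ^ scale j - 1"
proof -
  define c where "c = scale (j - 1)"
  have j: "j \<le> c" using scale_ge[of "j - 1"] assms by (simp add: c_def)
  have "scale 1 \<le> c" unfolding c_def scale_le_iff using assms by simp
  hence c8: "8 \<le> c" by (simp add: scale_def)
  have "scale j = c ^ 3" unfolding c_def using scale_Suc[of "j - 1"] assms by simp
  moreover have "c + 1 + 2 * c ^ 2 + 1 \<le> c ^ 3"
  proof -
    have "8 * c ^ 2 \<le> c * c ^ 2" using c8 by (rule mult_right_mono) simp
    moreover have "8 * c \<le> c ^ 2" using mult_right_mono[OF c8, of c] by (simp add: power2_eq_square)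
    moreover have "c ^ 3 = c * c ^ 2" by (simp add: power3_eq_cube power2_eq_square)
    ultimately show ?thesis using c8 by linarith
  qed
  ultimately have "(2::nat) ^ (c + 1 + 2 * c ^ 2 + 1) \<le> 2 ^ scale j"
    by (intro power_increasing) simp_all
  moreover define Y where "Y = (2::nat) ^ (c + 1 + 2 * c ^ 2)"
  ultimately have "2 * Y \<le> 2 ^ scale j" by simp
  moreover have "2 ^ j * (2 * order_mult c) \<le> 2 ^ c * (2 * 2 ^ (2 * c ^ 2))"
    using j order_mult_le[of c] by (intro mult_mono power_increasing) simp_all
  hence "2 ^ j * (2 * order_mult c) \<le> Y" by (simp add: Y_def power_add)
  moreover have "2 \<le> Y"
    using power_increasing[of 1 "c + 1 + 2 * c ^ 2" "2::nat"] by (simp add: Y_def)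
  ultimately show ?thesis unfolding c_def[symmetric] by linarith
qed

lemma order_mult_scale_mono: "i \<le> j \<Longrightarrow> order_mult (scale i) \<le> order_mult (scale j)"
  using order_mult_strict_mono by (simp add: strict_mono_less_eq scale_le_iff)

lemma coef_sum: "coef (sum f B) k = (\<Sum>s\<in>B. coef (f s) k)"
  by (rule lookup_sum)

text \<open>If every z fails to separate c, each z is a root of the difference of c and one of at most
  \<open>2^j\<close> sums of reduced relations. By \<open>size_estimate\<close> one of these
  differences has to vanish, so c is itself such a sum over a set B. A relation in B with
  \<open>2 s + 3 < j\<close> would put the exponent \<open>far s\<close> into c, which is
  excluded by the normal form; any other one would put the exponent \<open>near s\<close> into
  c, which is larger than N because \<open>2 s \<ge> j - 3\<close>. So B is empty.\<close>

lemma central_separation: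
  assumes j: "j \<ge> 4" and N: "N < order_mult (scale (j - 3))"
    and c: "c \<noteq> 0" "\<rho> c = c" "supp_within N c"
  shows "\<exists>z\<in>unit_roots (scale j). ev z c \<notin> rel_values z"
proof (rule ccontr)
  assume neg: "\<not> (\<exists>z\<in>unit_roots (scale j). ev z c \<notin> rel_values z)"
  define L where "L = order_mult (scale (j - 1))"
  define W where "W B = (\<Sum>s\<in>B. reduced_elem j s)" for B
  let ?I = "{s. 2 * s < j}"
  have finI: "finite ?I" by (rule finite_subset[of _ "{..j}"]) auto
  have "card ?I \<le> card {..<j}" by (rule card_mono) auto
  hence cardI: "card ?I \<le> j" by simp
  have "order_mult (scale (j - 3)) \<le> L" unfolding L_def by (rule order_mult_scale_mono) arith
  hence "N < L" using N by linarith
  have supp_trunc: "supp_within L (reduced_elem j s)" if "2 * s < j" for s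
  proof -
    have "near s \<le> L" unfolding L_def near_def using that by (intro order_mult_scale_mono) simp
    moreover have "far s \<le> L" if "2 * s + 3 < j"
      unfolding L_def far_def using that by (intro order_mult_scale_mono) simp
    moreover have "supp_within L 1" using supp_within_tpow[of 0 L] by simp
    ultimately show ?thesis unfolding reduced_elem_def
      by (auto intro!: supp_within_add supp_within_tpow)
  qed
  have supp_W: "supp_within L (W B)" if "B \<subseteq> ?I" for B
    unfolding W_def
    by (rule supp_within_sum[OF finite_subset[OF that finI]]) (use that supp_trunc in auto)
  have "\<exists>B\<in>Pow ?I. c = W B"
  proof (rule ccontr)
    assume "\<not> (\<exists>B\<in>Pow ?I. c = W B)"
    hence ne: "c + W B \<noteq> 0" if "B \<in> Pow ?I" for B
      using that by (auto simp: laurent_add_eq_0_iff)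
    let ?R = "\<lambda>B. {z \<in> unit_roots (scale j). ev z (c + W B) = 0}"
    have "unit_roots (scale j) \<subseteq> (\<Union>B\<in>Pow ?I. ?R B)"
    proof
      fix z assume z: "z \<in> unit_roots (scale j)"
      hence "ev z c \<in> rel_values z" using neg by simp
      from rel_values_finite_description[OF z this] obtain B where B: "B \<subseteq> ?I" "ev z c = ev z (W B)"
        by (auto simp: W_def)
      hence "ev z (c + W B) = 0" by simp
      with z B(1) show "z \<in> (\<Union>B\<in>Pow ?I. ?R B)" by blast
    qed
    moreover have "finite (\<Union>B\<in>Pow ?I. ?R B)"
      using finI card_unit_roots(2)[OF scale_pos] by simp
    ultimately have "card (unit_roots (scale j)) \<le> card (\<Union>B\<in>Pow ?I. ?R B)" by (rule card_mono[rotated])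
    also have "\<dots> \<le> (\<Sum>B\<in>Pow ?I. card (?R B))"
      using finI by (intro card_UN_le) simp
    also have "\<dots> \<le> (\<Sum>B\<in>Pow ?I. 2 * L)"
    proof (rule sum_mono)
      fix B assume B: "B \<in> Pow ?I"
      have "supp_within L (c + W B)"
        using supp_W B c(3) \<open>N < L\<close> by (intro supp_within_add) (auto intro: supp_within_mono)
      moreover have "0 \<notin> unit_roots (scale j)" using unit_roots_nonzero[OF scale_pos] by blast
      ultimately show "card (?R B) \<le> 2 * L" by (intro card_roots_le ne[OF B])
    qed
    also have "\<dots> = 2 ^ card ?I * (2 * L)" using finI by (simp add: card_Pow)
    also have "\<dots> \<le> 2 ^ j * (2 * L)" using cardI by (intro mult_right_mono power_increasing) simp_all
    also have "\<dots> < 2 ^ scale j - 1" unfolding L_def using size_estimate j by simp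
    finally show False using card_unit_roots(1)[OF scale_pos] by simp
  qed
  then obtain B where B: "B \<subseteq> ?I" "c = W B" by blast
  have finB: "finite B" using finite_subset[OF B(1) finI] .
  have "B \<noteq> {}" using c(1) B(2) by (auto simp: W_def)
  have big: "j \<le> 2 * s + 3" if "s \<in> B" for s
  proof (rule ccontr)
    assume "\<not> j \<le> 2 * s + 3"
    hence s: "2 * s + 3 < j" by simp
    have t: "coef (reduced_elem j s') (int (far s)) = (if s' = s then 1 else 0)" for s'
      using s near_ge[of s] near_less_far[of s] by (auto simp: reduced_elem_def lookup_add lookup_tpow lookup_one when_def)
    have "coef c (int (far s)) = 1"
      unfolding B(2) W_def coef_sum t using finB that by simp
    thus False using coef_\<rho>_far[of c s] c(2) by simp
  qed
  obtain s where s: "s \<in> B" using \<open>B \<noteq> {}\<close> by blast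
  have t: "coef (reduced_elem j s') (int (near s)) = (if s' = s then 1 else 0)" if "s' \<in> B" for s'
    using big[OF that] near_ge[of s] by (auto simp: reduced_elem_def lookup_add lookup_tpow lookup_one when_def)
  have "coef c (int (near s)) = (\<Sum>s'\<in>B. if s' = s then 1 else 0)"
    unfolding B(2) W_def coef_sum by (rule sum.cong[OF refl t])
  hence "coef c (int (near s)) = 1" using finB s by simp
  hence "int (near s) \<in> supp c" by (simp add: in_keys_iff)
  hence "int (near s) \<in> {- int N..int N}" using c(3) unfolding supp_within_def by (rule subsetD[rotated])
  hence "near s \<le> N" by simp
  moreover have "order_mult (scale (j - 3)) \<le> near s"
    unfolding near_def using big[OF s] by (intro order_mult_scale_mono) simp
  ultimately show False using N by simp
qed

text \<open>One of the four entries separates n for a suitable z. For \<open>k\<close>, \<open>a\<close>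
  and \<open>b\<close> a nonroot of a nonzero Laurent polynomial suffices. Evaluation at z is
  compatible with multiplication up to the values of the relations in the last coordinate, so
  the quadruple of values defines a quotient; each coordinate takes at most \<open>2^r\<close>
  values.\<close>

theorem hall_separation:
  assumes n: "n \<in> carrier hall" "n \<noteq> \<one>\<^bsub>hall\<^esub>"
    and j: "j \<ge> 4" "N < order_mult (scale (j - 3))" and bd: "bounded_by N (dec n)"
  shows "\<exists>Q \<psi>. separating_hom hall n Q \<psi> \<and> card (carrier Q) \<le> 2 ^ (4 * scale j)"
proof -
  let ?r = "scale j"
  obtain k a b c where abc: "dec n = (k, a, b, c)" by (cases "dec n")
  have bd': "\<bar>k\<bar> \<le> int N" "supp_within N a" "supp_within N b" "supp_within N c"
    using bd by (simp_all add: bounded_by_def abc)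
  have \<rho>c: "\<rho> c = c" using hall_\<rho>[OF n(1)] by (simp add: abc)
  have "n \<noteq> enc eone" using n(2) by simp
  hence nz: "(k, a, b, c) \<noteq> (0, 0, 0, 0)" unfolding abc[symmetric] eone_def[symmetric] by (metis enc_dec)
  have small: "2 * N < 2 ^ ?r - 1"
  proof -
    have "order_mult (scale (j - 3)) \<le> order_mult (scale (j - 1))" by (rule order_mult_scale_mono) arith
    hence "2 * N \<le> 1 * (2 * order_mult (scale (j - 1)))" using j(2) by linarith
    also have "\<dots> \<le> 2 ^ j * (2 * order_mult (scale (j - 1)))" by (rule mult_right_mono) simp_all
    also have "\<dots> < 2 ^ ?r - 1" by (rule size_estimate) (use j in simp)
    finally show ?thesis .
  qed
  have "\<exists>z\<in>unit_roots ?r. z powi k \<noteq> 1 \<or> ev z a \<noteq> 0 \<or> ev z b \<noteq> 0 \<or> ev z c \<notin> rel_values z"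
  proof -
    consider "k \<noteq> 0" | "a \<noteq> 0" | "b \<noteq> 0" | "c \<noteq> 0" using nz by auto
    thus ?thesis
    proof cases
      case 1
      have "tpow k + 1 \<noteq> 0"
        using 1 tpow_inj[of k 0] laurent_add_eq_0_iff[of "tpow k" 1] by simp
      moreover have "supp_within N (tpow k + 1)"
        using bd'(1) supp_within_tpow[of 0 N] by (intro supp_within_add supp_within_tpow) simp_all
      ultimately obtain z where "z \<in> unit_roots ?r" "ev z (tpow k + 1) \<noteq> 0"
        using ex_nonroot[OF _ _ scale_pos small] by blast
      thus ?thesis by (intro bexI[of _ z]) (auto simp: K_add_eq_0_iff)
    next
      case 2
      from ex_nonroot[OF 2 bd'(2) scale_pos small] show ?thesis by blast
    next
      case 3
      from ex_nonroot[OF 3 bd'(3) scale_pos small] show ?thesis by blast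
    next
      case 4
      from central_separation[OF j 4 \<rho>c bd'(4)] show ?thesis by blast
    qed
  qed
  then obtain z where z: "z \<in> unit_roots ?r"
    and sep: "z powi k \<noteq> 1 \<or> ev z a \<noteq> 0 \<or> ev z b \<noteq> 0 \<or> ev z c \<notin> rel_values z" ..
  have z0: "z \<noteq> 0" by (rule unit_roots_nonzero[OF scale_pos z])
  define F where "F g = (case g of (k, a, b, c) \<Rightarrow> (z powi k, ev z a, ev z b, (+) (ev z c) ` rel_values z))" for g :: elem
  define f where "f m = F (dec m)" for m
  have F_cong: "F (g \<odot> h) = F (g' \<odot> h')" if eq: "F g = F g'" "F h = F h'" for g g' h h'
  proof -
    obtain k a b c k' a' b' c' where g: "g = (k, a, b, c)" "g' = (k', a', b', c')"
      by (cases g; cases g') blast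
    obtain l u v w l' u' v' w' where h: "h = (l, u, v, w)" "h' = (l', u', v', w')"
      by (cases h; cases h') blast
    have e: "z powi k = z powi k'" "ev z a = ev z a'" "ev z b = ev z b'" "ev z c + ev z c' \<in> rel_values z"
        "z powi l = z powi l'" "ev z u = ev z u'" "ev z v = ev z v'" "ev z w + ev z w' \<in> rel_values z"
      using eq by (simp_all add: F_def g h rel_values_coset_eq_iff)
    have av: "ev z (a * v) = ev z (a' * v')" by (simp only: ev_mult[OF z0] e)
    have "ev z (c + w + \<rho> (a * v)) + ev z (c' + w' + \<rho> (a' * v')) =
        ((ev z c + ev z c') + (ev z w + ev z w')) +
        ((ev z (a * v) + ev z (\<rho> (a * v))) + (ev z (a' * v') + ev z (\<rho> (a' * v')))) +
        (ev z (a * v) + ev z (a' * v'))"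
    proof -
      have arith: "c + w + r + (c' + w' + r') =
          ((c + c') + (w + w')) + ((s + r) + (s' + r')) + (s + s')" for c w r c' w' r' s s' :: K
      proof -
        have "((c + c') + (w + w')) + ((s + r) + (s' + r')) + (s + s') =
            c + w + r + (c' + w' + r') + ((s + s) + (s' + s'))"
          by (simp only: ac_simps)
        thus ?thesis by (simp only: K_double add_0_right)
      qed
      show ?thesis unfolding ev_add by (rule arith)
    qed
    also have "\<dots> \<in> rel_values z"
    proof -
      have 0: "ev z (a * v) + ev z (a' * v') = 0" by (simp only: av K_double)
      show ?thesis unfolding 0 add_0_right
        by (rule rel_values_add[OF rel_values_add[OF e(4) e(8)] rel_values_add[OF rel_values_\<rho> rel_values_\<rho>]])
    qed
    finally have "(+) (ev z (c + w + \<rho> (a * v))) ` rel_values z = (+) (ev z (c' + w' + \<rho> (a' * v'))) ` rel_values z"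
      by (simp only: rel_values_coset_eq_iff)
    thus ?thesis
      by (simp add: F_def g h power_int_add z0 ev_mult e)
  qed
  let ?T = "frob_fixed ?r \<times> frob_fixed ?r \<times> frob_fixed ?r \<times> ((\<lambda>x. (+) x ` rel_values z) ` frob_fixed ?r)"
  have F_in: "F g \<in> ?T" for g
    by (cases g) (simp add: F_def frob_fixed_powi[OF z] ev_frob_fixed[OF z])
  have finT: "finite ?T" using finite_frob_fixed[OF scale_pos] by simp
  have "card ?T \<le> 2 ^ ?r * (2 ^ ?r * (2 ^ ?r * 2 ^ ?r))"
    unfolding card_cartesian_product
    using card_frob_fixed[OF scale_pos] finite_frob_fixed[OF scale_pos]
    by (intro mult_le_mono order.trans[OF card_image_le]) simp_all
  also have "\<dots> = 2 ^ (4 * ?r)" by (simp flip: power_add)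
  finally have cardT: "card ?T \<le> 2 ^ (4 * ?r)" .
  have sub: "f ` carrier hall \<subseteq> ?T" unfolding f_def using F_in by blast
  have f_sep: "f n \<noteq> f \<one>\<^bsub>hall\<^esub>"
  proof
    assume "f n = f \<one>\<^bsub>hall\<^esub>"
    hence "F (k, a, b, c) = F (0, 0, 0, 0)" by (simp add: f_def abc eone_def)
    hence "z powi k = 1" "ev z a = 0" "ev z b = 0" "ev z c + ev z 0 \<in> rel_values z"
      unfolding rel_values_coset_eq_iff[symmetric] by (simp_all add: F_def)
    thus False using sep by simp
  qed
  have f_cong: "f (g \<otimes>\<^bsub>hall\<^esub> h) = f (g' \<otimes>\<^bsub>hall\<^esub> h')" if "f g = f g'" "f h = f h'" for g g' h h'
    using F_cong[of "dec g" "dec g'" "dec h" "dec h'"] that by (simp add: f_def)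
  obtain Q \<psi> where Q: "separating_hom hall n Q \<psi>" "card (carrier Q) = card (f ` carrier hall)"
    by (rule hall.quotient_of_congruence[where f = f, OF f_cong finite_subset[OF sub finT] n(1) f_sep])
  have "card (carrier Q) \<le> 2 ^ (4 * ?r)"
    using card_mono[OF finT sub] cardT Q(2) by linarith
  thus ?thesis using Q(1) by (intro exI conjI)
qed

theorem residually_finite_hall: "residually_finite hall"
  unfolding residually_finite_def
proof
  fix n assume n: "n \<in> carrier hall - {\<one>\<^bsub>hall\<^esub>}"
  obtain N where N: "bounded_by N (dec n)" using ex_bounded_by by blast
  have "N < order_mult (scale N)"
    using scale_ge[of N] less_exp[of "scale N"] order_mult_ge[of "scale N"] by linarith
  also have "\<dots> \<le> order_mult (scale (N + 4 - 3))" by (rule order_mult_scale_mono) simp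
  finally have "\<exists>Q \<psi>. separating_hom hall n Q \<psi> \<and> card (carrier Q) \<le> 2 ^ (4 * scale (N + 4))"
    using n N by (intro hall_separation) simp_all
  thus "\<exists>Q \<psi>. separating_hom hall n Q \<psi>" by (elim exE conjE) (intro exI)
qed

section \<open>Word length in an arbitrary generating set\<close>

lemma reach_emult:
  assumes "S \<subseteq> carrier hall" "reach hall S m (enc g)" "reach hall S n (enc h)"
  shows "reach hall S (m + n) (enc (g \<odot> h))"
  using hall.reach_mult[OF assms] by simp

text \<open>The witness is a commutator with \<open>y\<close> of a product of two conjugates of
  \<open>x\<close>, so it is a word with \<open>4 near s + 6\<close> letters in
  \<open>x\<close>, \<open>y\<close>, \<open>t\<close> and the inverse of \<open>t\<close>.
  Changing the generating set costs a constant factor.\<close>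

lemma witness_reach:
  assumes "finite_generating_set hall S"
  shows "\<exists>\<kappa>. \<forall>s. reach hall S (\<kappa> * (10 * near s)) (witness s)"
proof -
  have S: "S \<subseteq> carrier hall" "generate hall S = carrier hall"
    using assms by (simp_all add: finite_generating_set_def)
  have ex: "\<exists>n. reach hall S n g" if "g \<in> carrier hall" for g
    by (rule hall.ex_reach[OF S(1)]) (simp add: S(2) that)
  obtain n1 where n1: "reach hall S n1 (enc gx)" using ex[OF hall_gens(1)] ..
  obtain n2 where n2: "reach hall S n2 (enc gy)" using ex[OF hall_gens(2)] ..
  obtain n3 where n3: "reach hall S n3 (enc (1, 0, 0, 0))" using ex[OF hall_t] ..
  obtain n4 where n4: "reach hall S n4 (enc (- 1, 0, 0, 0))" using ex[OF hall_t] ..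
  define \<kappa> where "\<kappa> = n1 + n2 + n3 + n4"
  have x: "reach hall S \<kappa> (enc gx)" and y: "reach hall S \<kappa> (enc gy)"
    and t: "reach hall S \<kappa> (enc (1, 0, 0, 0))" and ti: "reach hall S \<kappa> (enc (- 1, 0, 0, 0))"
    by (rule reach_mono[OF n1] reach_mono[OF n2] reach_mono[OF n3] reach_mono[OF n4], simp add: \<kappa>_def)+
  have one: "reach hall S 0 (enc (0, 0, 0, 0))"
    using hall.reach_one[of S 0] by (simp add: eone_def)
  have tpos: "reach hall S (\<kappa> * m) (enc (int m, 0, 0, 0))" for m
  proof (induction m)
    case (Suc m)
    from reach_emult[OF S(1) t this] show ?case by (simp add: algebra_simps)
  qed (use one in simp)
  have tneg: "reach hall S (\<kappa> * m) (enc (- int m, 0, 0, 0))" for m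
  proof (induction m)
    case (Suc m)
    from reach_emult[OF S(1) ti this] show ?case by (simp add: algebra_simps)
  qed (use one in simp)
  have "reach hall S (\<kappa> * (10 * near s)) (witness s)" for s
  proof -
    let ?m = "near s"
    let ?a = "tpow (int ?m) + 1"
    let ?l = "\<kappa> * ?m + \<kappa> + \<kappa> * ?m + \<kappa>"
    have "reach hall S ?l (enc ((- int ?m, 0, 0, 0) \<odot> gx \<odot> (int ?m, 0, 0, 0) \<odot> gx))"
      by (intro reach_emult[OF S(1)] tpos tneg x)
    hence l: "reach hall S ?l (enc (0, ?a, 0, 0))"
      by (simp add: gx_def add.commute)
    have "reach hall S (?l + \<kappa> + ?l + \<kappa>) (enc ((0, ?a, 0, 0) \<odot> gy \<odot> (0, ?a, 0, 0) \<odot> gy))"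
      by (intro reach_emult[OF S(1)] l y)
    hence w: "reach hall S (?l + \<kappa> + ?l + \<kappa>) (witness s)"
      unfolding central_commutator by (simp add: witness_def)
    have "\<kappa> * 1 \<le> \<kappa> * ?m" using near_ge[of s] by (intro mult_left_mono) simp_all
    hence "\<kappa> \<le> \<kappa> * ?m" by simp
    moreover have "\<kappa> * (10 * ?m) = 10 * (\<kappa> * ?m)" by simp
    ultimately have "?l + \<kappa> + ?l + \<kappa> \<le> \<kappa> * (10 * ?m)"
      by linarith
    with w show ?thesis by (rule reach_mono)
  qed
  thus ?thesis by (intro exI allI)
qed

lemma reach_bounded:
  assumes "finite_generating_set hall S"
  shows "\<exists>\<kappa>. \<forall>n g. reach hall S n g \<longrightarrow> bounded_by (\<kappa> * n) (dec g)"
proof -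
  let ?S = "S \<union> (\<lambda>s. inv\<^bsub>hall\<^esub> s) ` S"
  have S: "S \<subseteq> carrier hall" "finite ?S"
    using assms by (simp_all add: finite_generating_set_def)
  define b where "b s = (SOME N. bounded_by N (dec s))" for s
  have b: "bounded_by (b s) (dec s)" for s
    unfolding b_def by (rule someI_ex[OF ex_bounded_by])
  define \<kappa> where "\<kappa> = sum b ?S"
  have \<kappa>: "bounded_by \<kappa> (dec s)" if "s \<in> ?S" for s
    using b by (rule bounded_by_mono) (simp only: \<kappa>_def member_le_sum[OF that _ S(2)] zero_le)
  have fold: "bounded_by (\<kappa> * length ws) (dec (foldr (mult hall) ws \<one>\<^bsub>hall\<^esub>))" if "set ws \<subseteq> ?S" for ws
    using that
  proof (induction ws)
    case Nil
    show ?case by (simp add: eone_def bounded_by_def)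
  next
    case (Cons w ws)
    have w: "w \<in> ?S" and "set ws \<subseteq> ?S" using Cons.prems by simp_all
    from bounded_by_mult[OF \<kappa>[OF w] Cons.IH[OF this(2)]] show ?case by simp
  qed
  have "bounded_by (\<kappa> * n) (dec g)" if "reach hall S n g" for n g
  proof -
    from that obtain ws where ws: "set ws \<subseteq> ?S" "length ws \<le> n" "foldr (mult hall) ws \<one>\<^bsub>hall\<^esub> = g"
      by (rule reachE)
    from fold[OF ws(1)] have "bounded_by (\<kappa> * length ws) (dec g)" by (simp only: ws(3))
    thus ?thesis by (rule bounded_by_mono) (simp add: ws(2))
  qed
  thus ?thesis by (intro exI[of _ \<kappa>] allI impI)
qed

section \<open>Growth\<close>

lemma poly_le_power:
  fixes f :: "real poly"
  shows "\<exists>D. \<forall>\<^sub>F n in sequentially. poly f (real n) \<le> real n ^ D"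
proof (intro exI)
  let ?d = "Polynomial.degree f"
  define A where "A = (\<Sum>i\<le>?d. \<bar>Polynomial.coeff f i\<bar>)"
  show "\<forall>\<^sub>F n in sequentially. poly f (real n) \<le> real n ^ Suc ?d"
    using eventually_ge_at_top[of "nat \<lceil>A\<rceil>"] eventually_ge_at_top[of 1]
  proof eventually_elim
    case (elim n)
    have n: "A \<le> real n" "1 \<le> real n" using elim by linarith+
    have "poly f (real n) = (\<Sum>i\<le>?d. Polynomial.coeff f i * real n ^ i)" by (rule poly_altdef)
    also have "\<dots> \<le> (\<Sum>i\<le>?d. \<bar>Polynomial.coeff f i\<bar> * real n ^ ?d)"
      using n by (intro sum_mono mult_mono power_increasing) simp_all
    also have "\<dots> = A * real n ^ ?d" by (simp add: A_def sum_distrib_right)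
    also have "\<dots> \<le> real n * real n ^ ?d" using n by (intro mult_right_mono) simp_all
    finally show ?case by simp
  qed
qed

text \<open>For given n take the last witness whose length, as bounded by \<open>witness_reach\<close>,
  is at most n. The bound for the next one exceeds n, so n is at most a constant times
  \<open>2^(2 c^2)\<close> with \<open>c = scale (2 s + 2)\<close>, whereas detecting the
  witness requires order at least \<open>2^(c^3)\<close>.\<close>

lemma Rf_hall_lower:
  assumes "finite_generating_set hall S"
  shows "\<forall>\<^sub>F n in sequentially. n ^ D \<le> Rf hall S n"
proof -
  obtain \<kappa> where \<kappa>: "\<And>s. reach hall S (\<kappa> * (10 * near s)) (witness s)"
    using witness_reach[OF assms] by auto
  define \<kappa>' where "\<kappa>' = Suc \<kappa>"
  define T where "T s = \<kappa>' * (10 * near s)" for s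
  have reach: "reach hall S n (witness s)" if "T s \<le> n" for s n
    using \<kappa>[of s] by (rule reach_mono) (use that in \<open>simp add: T_def \<kappa>'_def\<close>)
  define L where "L = 10 * \<kappa>'"
  \<comment> \<open>If the index of the witness is at least s0, then c is at least \<open>D (L + 2)\<close>,
    enough for \<open>D (L + 2 c^2) \<le> c^3\<close>.\<close>
  define s0 where "s0 = D * (L + 2)"
  have T_mono: "T s \<le> T s'" if "s \<le> s'" for s s'
    using that strict_mono_less_eq[OF near_strict_mono] by (simp add: T_def)
  have T_ge: "s \<le> T s" for s
  proof -
    have "s \<le> near s" using near_strict_mono by (rule strict_mono_imp_increasing)
    also have "\<dots> \<le> T s" by (simp add: T_def \<kappa>'_def)
    finally show ?thesis .
  qed
  show ?thesis
    using eventually_ge_at_top[of "T s0"]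
  proof eventually_elim
    case (elim n)
    have "n < T (Suc n)" using T_ge[of "Suc n"] by simp
    define s' where "s' = (LEAST s. n < T s)"
    have s': "n < T s'" unfolding s'_def
      by (rule LeastI[of "\<lambda>s. n < T s", OF \<open>n < T (Suc n)\<close>])
    have "s0 < s'"
    proof (rule ccontr)
      assume "\<not> s0 < s'"
      hence "T s' \<le> T s0" by (intro T_mono) simp
      thus False using s' elim by linarith
    qed
    then obtain s where s: "s' = Suc s" "s0 \<le> s" by (cases s') auto
    have "\<not> n < T s" unfolding s'_def[symmetric] using s(1) not_less_Least[of s "\<lambda>s. n < T s"]
      by (simp add: s'_def)
    hence Ts: "T s \<le> n" by simp
    define c where "c = scale (2 * s + 2)"
    have "witness s \<in> carrier hall - {\<one>\<^bsub>hall\<^esub>}"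
      using witness_closed witness_neq_one by (intro DiffI) simp_all
    from residually_finite_hall[unfolded residually_finite_def, THEN bspec, OF this]
    obtain Q \<psi> where Q: "separating_hom hall (witness s) Q \<psi>" by (elim exE)
    have "2 ^ scale (2 * s + 3) \<le> min_quotient_order hall (witness s)"
      by (rule hall.min_quotient_order_ge[OF Q witness_quotient_order])
    also have "\<dots> \<le> Rf hall S n"
      by (rule hall.Rf_ge[OF assms witness_closed witness_neq_one reach[OF Ts]])
    finally have Rf: "2 ^ scale (2 * s + 3) \<le> Rf hall S n" .
    have scale: "scale (2 * s + 3) = c ^ 3"
      unfolding c_def using scale_Suc[of "2 * s + 2"] by (simp add: numeral_3_eq_3)
    have "n \<le> L * order_mult c"
      using s' by (simp add: s(1) T_def L_def near_def c_def)
    also have "\<dots> \<le> 2 ^ L * 2 ^ (2 * c ^ 2)"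
      using less_exp[of L] order_mult_le[of c] by (intro mult_mono) simp_all
    also have "\<dots> = 2 ^ (L + 2 * c ^ 2)" by (simp add: power_add)
    finally have "n ^ D \<le> (2 ^ (L + 2 * c ^ 2)) ^ D" by (rule power_mono) simp
    also have "\<dots> = 2 ^ (D * (L + 2 * c ^ 2))" by (simp add: mult.commute flip: power_mult)
    also have "\<dots> \<le> 2 ^ (c ^ 3)"
    proof (rule power_increasing)
      have c_pos: "1 \<le> c ^ 2" using scale_pos[of "2 * s + 2"] by (simp add: c_def)
      have "L * 1 \<le> L * c ^ 2" using c_pos by (rule mult_left_mono) simp
      hence "D * (L + 2 * c ^ 2) \<le> D * ((L + 2) * c ^ 2)"
        by (intro mult_left_mono) (simp_all add: algebra_simps)
      also have "\<dots> = s0 * c ^ 2" by (simp only: s0_def mult.assoc)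
      also have "s0 \<le> c" using s(2) scale_ge[of "2 * s + 2"] unfolding c_def by linarith
      hence "s0 * c ^ 2 \<le> c * c ^ 2" by (rule mult_right_mono) simp
      also have "\<dots> = c ^ 3" by (simp add: power3_eq_cube power2_eq_square)
      finally show "D * (L + 2 * c ^ 2) \<le> c ^ 3" .
    qed simp
    finally show ?case using Rf by (simp add: scale)
  qed
qed

text \<open>The bound N on supports determines the field, through the least index i + 1 with
  \<open>order_mult (scale (i + 1))\<close> above N. Minimality bounds \<open>scale i\<close>
  by the logarithm of N; the field of \<open>hall_separation\<close> belongs to \<open>scale
  (i + 4)\<close>, which is the power \<open>scale i ^ 81\<close> because \<open>3^4 =
  81\<close>.\<close>

lemma Rf_hall_le_polylog:
  assumes "finite_generating_set hall S"
  shows "\<exists>\<kappa>\<ge>1. \<forall>\<^sub>F n in sequentially. \<exists>m. 2 ^ m \<le> \<kappa> * n \<and> Rf hall S n \<le> 2 ^ (4 * m ^ 81)"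
proof -
  obtain \<kappa>0 where \<kappa>0: "\<And>n g. reach hall S n g \<Longrightarrow> bounded_by (\<kappa>0 * n) (dec g)"
    using reach_bounded[OF assms] by auto
  define \<kappa> where "\<kappa> = Suc \<kappa>0"
  obtain \<kappa>1 where \<kappa>1: "\<And>s. reach hall S (\<kappa>1 * (10 * near s)) (witness s)"
    using witness_reach[OF assms] by auto
  have "\<forall>\<^sub>F n in sequentially. \<exists>m. 2 ^ m \<le> \<kappa> * n \<and> Rf hall S n \<le> 2 ^ (4 * m ^ 81)"
    using eventually_ge_at_top[of "\<kappa>1 * (10 * near 0)"] eventually_ge_at_top[of "order_mult (scale 0)"]
  proof eventually_elim
    case (elim n)
    define N where "N = \<kappa> * n"
    have nN: "n \<le> N" by (simp add: N_def \<kappa>_def)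
    have ex: "N < order_mult (scale N)"
      using scale_ge[of N] less_exp[of "scale N"] order_mult_ge[of "scale N"] by linarith
    define i' where "i' = (LEAST i. N < order_mult (scale i))"
    have i': "N < order_mult (scale i')" unfolding i'_def
      by (rule LeastI[of "\<lambda>i. N < order_mult (scale i)", OF ex])
    have "i' \<noteq> 0" using i' elim(2) nN by (intro notI) simp
    then obtain i where i: "i' = Suc i" by (cases i') auto
    have "\<not> N < order_mult (scale i)"
      using not_less_Least[of i "\<lambda>i. N < order_mult (scale i)"] i by (simp add: i'_def)
    hence low: "order_mult (scale i) \<le> N" by simp
    have "scale (i + 4) = scale i ^ 81"
      by (simp add: scale_def power_add flip: power_mult)
    moreover have "Rf hall S n \<le> 2 ^ (4 * scale (i + 4))"
    proof (rule hall.Rf_le[OF assms witness_closed witness_neq_one])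
      show "reach hall S n (witness 0)" by (rule reach_mono[OF \<kappa>1 elim(1)])
    next
      fix g assume g: "g \<in> carrier hall" "g \<noteq> \<one>\<^bsub>hall\<^esub>" "reach hall S n g"
      have "bounded_by N (dec g)"
        by (rule bounded_by_mono[OF \<kappa>0[OF g(3)]]) (simp add: N_def \<kappa>_def)
      moreover have "N < order_mult (scale (i + 4 - 3))" using i' by (simp add: i)
      ultimately obtain Q \<psi> where Q: "separating_hom hall g Q \<psi>" "card (carrier Q) \<le> 2 ^ (4 * scale (i + 4))"
        using hall_separation[OF g(1,2), of "i + 4" N] by auto
      from hall.min_quotient_order_le[OF Q(1)] Q(2)
      show "min_quotient_order hall g \<le> 2 ^ (4 * scale (i + 4))" by (rule order.trans)
    qed
    moreover have "2 ^ scale i \<le> \<kappa> * n" using order_mult_ge[of "scale i"] low by (simp add: N_def)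
    ultimately show ?case by (intro exI[of _ "scale i"]) simp
  qed
  moreover have "\<kappa> \<ge> 1" by (simp add: \<kappa>_def)
  ultimately show ?thesis by blast
qed

text \<open>A power of a logarithm is below every positive power of n. The exponent 1/324 is chosen so
  that its 81st power is the fourth root of n, which leaves a second fourth root to absorb the
  constant C.\<close>

lemma Rf_hall_upper:
  assumes "finite_generating_set hall S" and "\<epsilon> > (0::real)"
  shows "\<forall>\<^sub>F n in sequentially. real (Rf hall S n) \<le> exp (real n powr (1 / 2 + \<epsilon>))"
proof -
  obtain \<kappa> where \<kappa>: "\<kappa> \<ge> 1"
      "\<forall>\<^sub>F n in sequentially. \<exists>m. 2 ^ m \<le> \<kappa> * n \<and> Rf hall S n \<le> 2 ^ (4 * m ^ 81)"
    using Rf_hall_le_polylog[OF assms(1)] by blast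
  define C where "C = 4 * (324 / ln 2 * real \<kappa> powr (1 / 324)) ^ 81"
  show ?thesis
    using \<kappa>(2) eventually_ge_at_top[of 1] eventually_ge_at_top[of "nat \<lceil>C ^ 4\<rceil>"]
  proof eventually_elim
    case (elim n)
    then obtain m where m: "2 ^ m \<le> \<kappa> * n" "Rf hall S n \<le> 2 ^ (4 * m ^ 81)" by blast
    have n1: "1 \<le> real n" "C ^ 4 \<le> real n" using elim(2,3) by linarith+
    have C0: "0 \<le> C" by (simp add: C_def)
    have \<kappa>n: "1 \<le> real \<kappa> * real n" using n1(1) \<kappa>(1) mult_mono[of 1 "real \<kappa>" 1 "real n"] by simp
    have "real (2 ^ m) \<le> real (\<kappa> * n)" using m(1) of_nat_le_iff by blast
    hence "2 ^ m \<le> real \<kappa> * real n" by simp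
    hence "ln (2 ^ m) \<le> ln (real \<kappa> * real n)" using \<kappa>n by (subst ln_le_cancel_iff) simp_all
    also have "\<dots> \<le> (real \<kappa> * real n) powr (1 / 324) / (1 / 324)"
      by (rule ln_powr_bound[OF \<kappa>n]) simp
    finally have "real m * ln 2 \<le> 324 * (real \<kappa> powr (1 / 324) * real n powr (1 / 324))"
      by (simp add: ln_realpow powr_mult)
    hence "real m \<le> (324 / ln 2 * real \<kappa> powr (1 / 324)) * real n powr (1 / 324)"
      by (simp add: field_simps)
    hence "real m ^ 81 \<le> ((324 / ln 2 * real \<kappa> powr (1 / 324)) * real n powr (1 / 324)) ^ 81"
      by (rule power_mono) simp
    hence "4 * real m ^ 81 \<le> C * (real n powr (1 / 324)) ^ 81"
      unfolding C_def power_mult_distrib by simp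
    also have "(real n powr (1 / 324)) ^ 81 = real n powr (1 / 4)"
      using n1(1) by (simp add: powr_powr flip: powr_realpow)
    also have "C * real n powr (1 / 4) \<le> real n powr (1 / 4) * real n powr (1 / 4)"
    proof (rule mult_right_mono)
      have "C = (C ^ 4) powr (1 / 4)"
        using C0 by (cases "C = 0") (simp_all add: powr_powr flip: powr_numeral)
      also have "\<dots> \<le> real n powr (1 / 4)" using n1(2) C0 by (intro powr_mono2) simp_all
      finally show "C \<le> real n powr (1 / 4)" .
    qed simp
    also have "\<dots> = real n powr (1 / 2)" by (simp flip: powr_add)
    finally have m_le: "4 * real m ^ 81 \<le> real n powr (1 / 2)" .
    have "real (Rf hall S n) \<le> real (2 ^ (4 * m ^ 81))" using m(2) of_nat_le_iff by blast
    also have "\<dots> = 2 ^ (4 * m ^ 81)" by simp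
    also have "\<dots> \<le> exp 1 ^ (4 * m ^ 81)"
      using exp_ge_add_one_self[of 1] by (intro power_mono) simp_all
    also have "\<dots> = exp (4 * real m ^ 81)"
      by (simp flip: exp_of_nat_mult)
    also have "\<dots> \<le> exp (real n powr (1 / 2 + \<epsilon>))"
    proof -
      have "real n powr (1 / 2) \<le> real n powr (1 / 2 + \<epsilon>)"
        using n1(1) assms(2) by (intro powr_mono) simp_all
      thus ?thesis using m_le by simp
    qed
    finally show ?case .
  qed
qed

theorem theorem4:
  shows "\<exists>G :: nat monoid.
    group G \<and> finitely_generated G \<and> recursively_presented G \<and> residually_finite G \<and>
    solvable G \<and> derived_length G = 3 \<and>
    (\<forall>S. finite_generating_set G S \<longrightarrow>
      (\<forall>f :: real poly. \<forall>\<^sub>F n in sequentially. real (Rf G S n) \<ge> poly f (real n)) \<and>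
      (\<forall>\<epsilon> :: real. \<epsilon> > 0 \<longrightarrow>
        (\<forall>\<^sub>F n in sequentially. real (Rf G S n) \<le> exp (real n powr (1 / 2 + \<epsilon>)))))"
proof (intro exI[of _ hall] conjI allI impI)
  show "finitely_generated hall"
    unfolding finitely_generated_def using fg_hall by (rule exI)
next
  fix S and f :: "real poly"
  assume S: "finite_generating_set hall S"
  obtain D where D: "\<forall>\<^sub>F n in sequentially. poly f (real n) \<le> real n ^ D"
    using poly_le_power by blast
  show "\<forall>\<^sub>F n in sequentially. poly f (real n) \<le> real (Rf hall S n)"
    using D Rf_hall_lower[OF S, of D]
  proof eventually_elim
    case (elim n)
    have "real n ^ D \<le> real (Rf hall S n)"
      using elim(2) by (simp only: of_nat_le_iff flip: of_nat_power)
    with elim(1) show ?case by (rule order.trans)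
  qed
qed (rule hall.is_group recursively_presented_hall residually_finite_hall solvable_hall derived_length_hall
    Rf_hall_upper; assumption?)+

end
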